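(* Let $\mathcal{F}$ be a class of graphs and let $\delta$ be a pseudometric on graphons such that (1) $\delta$ is compatible with $\delta_\square$, and (2) for all graphons $U,W$, if $t(F,U)=t(F,W)$ for every graph $F\in\mathcal{F}$ then $\delta(U,W)=0$. Then for every $\epsilon>0$ there are $k>0$ and $\eta>0$ such that, for all graphons $U,W$, if $\lvert t(F,U)-t(F,W)\rvert\le\eta$ for every graph $F\in\mathcal{F}$ on at most $k$ vertices, then $\delta(U,W)\le\epsilon$.
   Context: A graphon is a symmetric measurable function $W\colon[0,1]^2\to[0,1]$. For a finite simple graph $F$ and a graphon $W$, $t(F,W)=\int_{[0,1]^{V(F)}}\prod_{ij\in E(F)}W(x_i,x_j)\prod_{i\in V(F)}dx_i$. The cut norm of a bounded symmetric measurable $W\colon[0,1]^2\to\mathbb{R}$ is $\|W\|_\square=\sup_{S,T\subseteq[0,1]}\lvert\int_{S\times T}W(x,y)\,dx\,dy\rvert$ (over measurable sets). For an invertible measure-preserving map $\varphi\colon[0,1]\to[0,1]$ let $W^\varphi(x,y)=W(\varphi(x),\varphi(y))$; the cut distance is $\delta_\square(U,W)=\inf_{\varphi}\|U-W^\varphi\|_\square$ over all invertible measure-preserving maps. A pseudometric $\delta$ on graphons is compatible with $\delta_\square$ if for every sequence of graphons $(U_n)_n$ and every graphon $\widetilde U$, $\delta_\square(U_n,\widetilde U)\to0$ implies $\delta(U_n,\widetilde U)\to0$. *)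

theory Defs
  imports "HOL-Analysis.Analysis"
begin

(* "Measurable" means Lebesgue measurable throughout. A graphon is a genuine function on the
   unit square: PiE fixes its value to undefined elsewhere, so that a pseudometric on graphons
   cannot depend on values outside the square. *)
definition graphon :: "(real \<times> real \<Rightarrow> real) \<Rightarrow> bool" where
  "graphon W \<longleftrightarrow>
     W \<in> ({0..1} \<times> {0..1}) \<rightarrow>\<^sub>E {0..1} \<and>
     W \<in> borel_measurable (lebesgue_on ({0..1} \<times> {0..1})) \<and>
     (\<forall>x\<in>{0..1}. \<forall>y\<in>{0..1}. W (x, y) = W (y, x))"

type_synonym 'a graph = "'a set \<times> 'a set set"

definition simple_graph :: "'a graph \<Rightarrow> bool" where
  "simple_graph F \<longleftrightarrow> finite (fst F) \<and> snd F \<subseteq> {e. e \<subseteq> fst F \<and> card e = 2}"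

(* W (x i, x j) for an edge e = {i, j}; independent of the order of i and j as W is symmetric. *)
definition edge_weight :: "(real \<times> real \<Rightarrow> real) \<Rightarrow> ('a \<Rightarrow> real) \<Rightarrow> 'a set \<Rightarrow> real" where
  "edge_weight W x e = (THE w. \<exists>i j. e = {i, j} \<and> w = W (x i, x j))"

(* The completion is needed because the integrand is in general only Lebesgue measurable, hence
   not measurable for the product sigma-algebra itself. *)
definition hom_density :: "'a graph \<Rightarrow> (real \<times> real \<Rightarrow> real) \<Rightarrow> real" where
  "hom_density F W =
     (LINT x|completion (PiM (fst F) (\<lambda>_. lebesgue_on {0..1})). (\<Prod>e\<in>snd F. edge_weight W x e))"

definition cut_norm :: "(real \<times> real \<Rightarrow> real) \<Rightarrow> real" where
  "cut_norm W =
     (SUP (S, T) \<in> {(S, T). S \<in> sets (lebesgue_on {0..1}) \<and> T \<in> sets (lebesgue_on {0..1})}.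
        \<bar>LINT p:S \<times> T|lebesgue. W p\<bar>)"

definition invertible_measure_preserving :: "(real \<Rightarrow> real) \<Rightarrow> bool" where
  "invertible_measure_preserving \<phi> \<longleftrightarrow>
     bij_betw \<phi> {0..1} {0..1} \<and>
     \<phi> \<in> measurable (lebesgue_on {0..1}) (lebesgue_on {0..1}) \<and>
     inv_into {0..1} \<phi> \<in> measurable (lebesgue_on {0..1}) (lebesgue_on {0..1}) \<and>
     distr (lebesgue_on {0..1}) (lebesgue_on {0..1}) \<phi> = lebesgue_on {0..1}"

definition cut_dist :: "(real \<times> real \<Rightarrow> real) \<Rightarrow> (real \<times> real \<Rightarrow> real) \<Rightarrow> real" where
  "cut_dist U W =
     (INF \<phi> \<in> Collect invertible_measure_preserving.
        cut_norm (\<lambda>(x, y). U (x, y) - W (\<phi> x, \<phi> y)))"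

definition pseudometric_on :: "'b set \<Rightarrow> ('b \<Rightarrow> 'b \<Rightarrow> real) \<Rightarrow> bool" where
  "pseudometric_on A d \<longleftrightarrow>
     (\<forall>x\<in>A. \<forall>y\<in>A. 0 \<le> d x y) \<and>
     (\<forall>x\<in>A. d x x = 0) \<and>
     (\<forall>x\<in>A. \<forall>y\<in>A. d x y = d y x) \<and>
     (\<forall>x\<in>A. \<forall>y\<in>A. \<forall>z\<in>A. d x z \<le> d x y + d y z)"

definition compatible_with_cut_dist ::
    "((real \<times> real \<Rightarrow> real) \<Rightarrow> (real \<times> real \<Rightarrow> real) \<Rightarrow> real) \<Rightarrow> bool" where
  "compatible_with_cut_dist \<delta> \<longleftrightarrow>
     (\<forall>U W. (\<forall>n::nat. graphon (U n)) \<longrightarrow> graphon W \<longrightarrow>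
        (\<lambda>n. cut_dist (U n) W) \<longlonglongrightarrow> 0 \<longrightarrow> (\<lambda>n. \<delta> (U n) W) \<longlonglongrightarrow> 0)"

end

theory Submission
  imports Defs "HOL-Probability.Probability" "HOL-Library.Diagonal_Subsequence"
begin

text \<open>
  Graphons are sequentially compact for the cut distance and homomorphism densities are continuous
  for it. If the theorem failed, there would be graphons \<open>U\<^sub>n\<close>, \<open>W\<^sub>n\<close> whose densities become equal
  while \<open>\<delta> U\<^sub>n W\<^sub>n > \<epsilon>\<close>; along a subsequence they converge to graphons with equal densities, which
  have \<open>\<delta>\<close>-distance 0, and the triangle inequality gives a contradiction.

  Compactness: by the Frieze--Kannan decomposition a graphon is close in cut norm to a short
  combination of rectangles. After approximating the sides of the rectangles by unions of cells of a fine
  grid and permuting the cells, the sides are unions of cells of a coarse grid depending on the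
  precision only, which leaves finitely many approximants. A diagonal subsequence, rearranged
  successively, is then Cauchy in cut norm, and its limit is a Radon--Nikodym density of the
  limit of the integrals over measurable sets. Only permutations of grid cells, their inverses and their
  compositions are needed as measure preserving bijections.
\<close>

subsection \<open>Lebesgue measure on the square\<close>

text \<open>Two sigma-algebras compete. Graphons and \<open>cut_norm\<close> use the Lebesgue sets
  of the square, while Fubini, products of measure preserving maps and induction over rectangles
  live on the coarser \<open>\<Q>\<close>. So each graphon is exchanged for a
  \<open>\<Q>\<close>-measurable one equal to it off a \<open>\<Q>\<close>-null set.
  \<open>cut_dist\<close> and \<open>hom_density\<close> do not notice this, but nothing is known
  about how \<delta> treats null sets; hence \<delta> is only evaluated at the original graphons and
  at limits, and is controlled through compatibility alone.

  \<open>cut_dist\<close> is an infimum over bijections, so graphons must be aligned by genuine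
  bijections of the interval, for which piecewise translations suffice.

  Continuity of densities is established only along the sequences that compactness produces:
  \<open>graphon_compactness\<close> returns both kinds of convergence because both come from the
  same explicit bijections and the same cut norm bounds.

  The Frieze-Kannan coefficients are restricted to -\<epsilon>, 0 and \<epsilon>, so that finitely
  many approximants arise without rounding coefficients.\<close>

abbreviation unit_interval :: "real measure" ("\<I>") where
  "\<I> \<equiv> lebesgue_on {0..1}"

abbreviation unit_square :: "(real \<times> real) measure" ("\<Q>") where
  "\<Q> \<equiv> \<I> \<Otimes>\<^sub>M \<I>"

abbreviation lebesgue_square :: "(real \<times> real) measure" ("\<L>") where
  "\<L> \<equiv> lebesgue_on ({0..1} \<times> {0..1})"

lemma prob_space_unit_interval: "prob_space \<I>"
  by (rule prob_spaceI) (simp add: emeasure_restrict_space)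

interpretation unit_interval: prob_space \<I>
  by (rule prob_space_unit_interval)

interpretation unit_square: pair_prob_space \<I> \<I> ..

lemma space_unit_square [simp]: "space \<Q> = {0..1} \<times> {0..1}"
  by (simp add: space_pair_measure)

lemma null_sets_lborel_Times:
  fixes N :: "real set"
  assumes "N \<in> null_sets lborel"
  shows "N \<times> (UNIV :: real set) \<in> null_sets lborel" "(UNIV :: real set) \<times> N \<in> null_sets lborel"
proof -
  have [measurable]: "N \<in> sets borel" using assms by auto
  show "N \<times> (UNIV :: real set) \<in> null_sets lborel" "(UNIV :: real set) \<times> N \<in> null_sets lborel"
    using assms by (auto simp: null_sets_def lborel_prod[symmetric] lborel.emeasure_pair_measure_Times)
qed

text \<open>Measurability between completions requires, beyond Borel measurability, that preimages
  of null sets be null. Here such a preimage is a strip over a null set.\<close>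

lemma lebesgue_measurable_fst: "(fst :: real \<times> real \<Rightarrow> real) \<in> measurable lebesgue lebesgue"
  and lebesgue_measurable_snd: "(snd :: real \<times> real \<Rightarrow> real) \<in> measurable lebesgue lebesgue"
proof -
  note null = null_sets_lborel_Times
  show "(fst :: real \<times> real \<Rightarrow> real) \<in> measurable lebesgue lebesgue"
  proof (rule completion.measurable_completion2)
    show *: "(fst :: real \<times> real \<Rightarrow> real) \<in> lebesgue \<rightarrow>\<^sub>M lborel"
      by (rule measurable_completion) (simp add: borel_prod[symmetric])
    show "null_sets lborel \<subseteq> null_sets (distr lebesgue lborel (fst :: real \<times> real \<Rightarrow> real))"
    proof
      fix N :: "real set" assume N: "N \<in> null_sets lborel"
      have "(fst :: real \<times> real \<Rightarrow> real) -` N = N \<times> UNIV" by auto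
      then have "(fst :: real \<times> real \<Rightarrow> real) -` N \<inter> space lebesgue \<in> null_sets lebesgue"
        using null[OF N] by (auto intro: null_sets_completionI)
      then show "N \<in> null_sets (distr lebesgue lborel (fst :: real \<times> real \<Rightarrow> real))"
        using N by (auto simp: null_sets_def emeasure_distr[OF *])
    qed
  qed
  show "(snd :: real \<times> real \<Rightarrow> real) \<in> measurable lebesgue lebesgue"
  proof (rule completion.measurable_completion2)
    show *: "(snd :: real \<times> real \<Rightarrow> real) \<in> lebesgue \<rightarrow>\<^sub>M lborel"
      by (rule measurable_completion) (simp add: borel_prod[symmetric])
    show "null_sets lborel \<subseteq> null_sets (distr lebesgue lborel (snd :: real \<times> real \<Rightarrow> real))"
    proof
      fix N :: "real set" assume N: "N \<in> null_sets lborel"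
      have "(snd :: real \<times> real \<Rightarrow> real) -` N = UNIV \<times> N" by auto
      then have "(snd :: real \<times> real \<Rightarrow> real) -` N \<inter> space lebesgue \<in> null_sets lebesgue"
        using null[OF N] by (auto intro: null_sets_completionI)
      then show "N \<in> null_sets (distr lebesgue lborel (snd :: real \<times> real \<Rightarrow> real))"
        using N by (auto simp: null_sets_def emeasure_distr[OF *])
    qed
  qed
qed

lemma lebesgue_sets_Times:
  fixes A B :: "real set"
  assumes "A \<in> sets lebesgue" "B \<in> sets lebesgue"
  shows "A \<times> B \<in> sets lebesgue"
proof -
  have "A \<times> B = fst -` A \<inter> snd -` B" by auto
  then show ?thesis
    using measurable_sets[OF lebesgue_measurable_fst assms(1)]
      measurable_sets[OF lebesgue_measurable_snd assms(2)] by auto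
qed

text \<open>Both sides are enlarged to Borel sets by null sets. The rectangle then changes only
  inside two null strips, and the product formula for \<open>lborel\<close> applies.\<close>

lemma emeasure_lebesgue_Times:
  fixes A B :: "real set"
  assumes A: "A \<in> sets lebesgue" and B: "B \<in> sets lebesgue"
  shows "emeasure lebesgue (A \<times> B) = emeasure lebesgue A * emeasure lebesgue B"
proof -
  obtain A' where A': "A \<subseteq> A'" "A' \<in> sets borel" "A' - A \<in> null_sets lebesgue"
      "emeasure lebesgue A = emeasure lborel A'"
    using completion_upper[of A lborel] A by auto
  obtain B' where B': "B \<subseteq> B'" "B' \<in> sets borel" "B' - B \<in> null_sets lebesgue"
      "emeasure lebesgue B = emeasure lborel B'"
    using completion_upper[of B lborel] B by auto
  have nullA: "(A' - A) \<times> (UNIV :: real set) \<in> null_sets lebesgue"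
  proof -
    obtain N where N: "N \<in> null_sets lborel" "A' - A \<subseteq> N"
      using iffD1[OF null_sets_completion_iff2 A'(3)] by blast
    show ?thesis
      by (rule null_sets_completion_subset[OF _ null_sets_completionI[OF null_sets_lborel_Times(1)[OF N(1)]]])
        (use N(2) in auto)
  qed
  have nullB: "(UNIV :: real set) \<times> (B' - B) \<in> null_sets lebesgue"
  proof -
    obtain N where N: "N \<in> null_sets lborel" "B' - B \<subseteq> N"
      using iffD1[OF null_sets_completion_iff2 B'(3)] by blast
    show ?thesis
      by (rule null_sets_completion_subset[OF _ null_sets_completionI[OF null_sets_lborel_Times(2)[OF N(1)]]])
        (use N(2) in auto)
  qed
  from AE_not_in[OF nullA] AE_not_in[OF nullB]
  have "AE p in lebesgue. p \<in> A \<times> B \<longleftrightarrow> p \<in> A' \<times> B'"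
    by eventually_elim (use A'(1) B'(1) in auto)
  then have "emeasure lebesgue (A \<times> B) = emeasure lebesgue (A' \<times> B')"
    using A B A'(2) B'(2) by (intro emeasure_eq_AE lebesgue_sets_Times) auto
  also have "\<dots> = emeasure lborel (A' \<times> B')"
    using A'(2) B'(2) by (simp add: borel_Times)
  also have "\<dots> = emeasure lborel A' * emeasure lborel B'"
    using A'(2) B'(2) by (simp add: lborel_prod[symmetric] lborel.emeasure_pair_measure_Times)
  finally show ?thesis using A' B' by simp
qed

lemma space_lebesgue_square: "space \<L> = {0..1} \<times> {0..1}"
  by (simp only: space_restrict_space space_completion space_lborel space_borel Int_UNIV_right)

lemma emeasure_lebesgue_square:
  "A \<subseteq> {0..1} \<times> {0..1} \<Longrightarrow> emeasure \<L> A = emeasure lebesgue A"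
  using lebesgue_sets_Times[of "{0..1}" "{0..1}"] by (intro emeasure_restrict_space) simp_all

lemma unit_square_subalgebra: "(\<lambda>p. p) \<in> measurable \<L> \<Q>"
proof -
  have "fst \<in> measurable \<L> \<I>"
    by (rule measurable_restrict_space3[OF lebesgue_measurable_fst]) auto
  moreover have "snd \<in> measurable \<L> \<I>"
    by (rule measurable_restrict_space3[OF lebesgue_measurable_snd]) auto
  ultimately show ?thesis
    by (subst measurable_pair_iff) (simp only: comp_def)
qed

text \<open>A product measure is determined by its values on rectangles. Through this identity,
  integrals of \<open>\<Q>\<close>-measurable functions move freely between \<open>\<Q>\<close> and
  \<open>\<L>\<close>.\<close>

lemma unit_square_eq_distr: "\<Q> = distr \<L> \<Q> (\<lambda>p. p)"
proof (rule pair_measure_eqI[OF unit_interval.sigma_finite_measure_axioms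
      unit_interval.sigma_finite_measure_axioms])
  show "sets \<Q> = sets (distr \<L> \<Q> (\<lambda>p. p))"
    by (rule sets_distr[symmetric])
  fix A B assume "A \<in> sets \<I>" "B \<in> sets \<I>"
  then have AB: "A \<in> sets lebesgue" "B \<in> sets lebesgue" "A \<subseteq> {0..1}" "B \<subseteq> {0..1}"
      and meas: "A \<times> B \<in> sets \<Q>"
    by (auto simp: sets_restrict_space)
  have subs: "A \<times> B \<subseteq> {0..1} \<times> {0..1}"
    using AB(3,4) by (rule Sigma_mono)
  have "emeasure (distr \<L> \<Q> (\<lambda>p. p)) (A \<times> B)
      = emeasure \<L> (A \<times> B)"
    by (simp only: emeasure_distr[OF unit_square_subalgebra meas] vimage_ident Int_absorb2[OF subs]
        space_lebesgue_square)
  also have "\<dots> = emeasure lebesgue (A \<times> B)"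
    by (rule emeasure_lebesgue_square[OF subs])
  also have "\<dots> = emeasure lebesgue A * emeasure lebesgue B"
    by (rule emeasure_lebesgue_Times[OF AB(1,2)])
  also have "emeasure lebesgue A = emeasure \<I> A"
    by (rule emeasure_restrict_space[symmetric]) (use AB in auto)
  also have "emeasure lebesgue B = emeasure \<I> B"
    by (rule emeasure_restrict_space[symmetric]) (use AB in auto)
  finally show "emeasure \<I> A * emeasure \<I> B = emeasure (distr \<L> \<Q> (\<lambda>p. p)) (A \<times> B)"
    by (rule sym)
qed

lemma borel_measurable_unit_square:
  "f \<in> borel_measurable \<Q> \<Longrightarrow> f \<in> borel_measurable \<L>"
  by (rule measurable_compose[OF unit_square_subalgebra])

lemma integral_unit_square:
  fixes f :: "real \<times> real \<Rightarrow> real"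
  assumes "f \<in> borel_measurable \<Q>"
  shows "integral\<^sup>L \<L> f = integral\<^sup>L \<Q> f"
proof -
  have "integral\<^sup>L \<Q> f = integral\<^sup>L (distr \<L> \<Q> (\<lambda>p. p)) f"
    by (rule arg_cong[OF unit_square_eq_distr])
  then show ?thesis by (simp add: integral_distr[OF unit_square_subalgebra assms])
qed

lemma emeasure_unit_square:
  assumes "A \<in> sets \<Q>"
  shows "emeasure \<L> A = emeasure \<Q> A"
proof -
  have "emeasure \<Q> A = emeasure (distr \<L> \<Q> (\<lambda>p. p)) A"
    by (rule arg_cong[OF unit_square_eq_distr])
  then show ?thesis
    using sets.sets_into_space[OF assms]
    by (simp only: emeasure_distr[OF unit_square_subalgebra assms] Int_absorb2 vimage_ident
        space_lebesgue_square space_unit_square)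
qed

lemma sets_unit_square:
  "A \<in> sets \<Q> \<Longrightarrow> A \<in> sets \<L>"
  using measurable_sets[OF unit_square_subalgebra, of A] sets.sets_into_space[of A \<Q>]
  by (simp only: Int_absorb2 vimage_ident space_lebesgue_square space_unit_square)

lemma null_sets_unit_square:
  "N \<in> null_sets \<Q> \<Longrightarrow> N \<in> null_sets \<L>"
  by (auto simp: null_sets_def emeasure_unit_square sets_unit_square)

lemma prob_space_lebesgue_square: "prob_space \<L>"
proof (rule prob_spaceI)
  show "emeasure \<L> (space \<L>) = 1"
    using emeasure_unit_square[OF sets.top] unit_square.emeasure_space_1
    by (simp only: space_unit_square space_lebesgue_square)
qed

text \<open>The integral of a non-integrable function is 0 by convention; \<open>0 \<le> B\<close>
  takes care of that case.\<close>

lemma (in prob_space) abs_integral_le_const: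
  fixes f :: "'a \<Rightarrow> real"
  assumes "\<And>x. x \<in> space M \<Longrightarrow> \<bar>f x\<bar> \<le> B" "0 \<le> B"
  shows "\<bar>integral\<^sup>L M f\<bar> \<le> B"
proof (cases "integrable M f")
  case True
  have "\<bar>integral\<^sup>L M f\<bar> \<le> (\<integral>x. \<bar>f x\<bar> \<partial>M)" by (rule integral_abs_bound)
  also have "\<dots> \<le> (\<integral>x. B \<partial>M)" using True assms by (intro integral_mono) auto
  finally show ?thesis by (simp add: prob_space)
qed (simp add: not_integrable_integral_eq assms)

text \<open>A Lebesgue measurable function agrees with a Borel function off a Borel null set, and
  Borel subsets of the square belong to \<open>\<Q>\<close>.\<close>

lemma unit_square_representative:
  fixes g :: "real \<times> real \<Rightarrow> real"
  assumes "g \<in> borel_measurable \<L>"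
  obtains g' N where "g' \<in> borel_measurable \<Q>" "N \<in> null_sets \<Q>"
    "\<And>p. p \<in> {0..1} \<times> {0..1} - N \<Longrightarrow> g p = g' p"
proof -
  have sq: "{0..1} \<times> {0..1} \<in> sets (lborel :: (real \<times> real) measure)"
    by (simp add: borel_Times)
  have "(\<lambda>p. indicator ({0..1} \<times> {0..1}) p *\<^sub>R g p) \<in> borel_measurable lebesgue"
    using assms sq by (subst (asm) borel_measurable_restrict_space_iff) auto
  from completion_ex_borel_measurable_real[OF this[simplified]]
  obtain g' where g': "g' \<in> borel_measurable lborel"
      "AE p in lborel. indicator ({0..1} \<times> {0..1}) p *\<^sub>R g p = g' p" by auto
  from g'(2)[unfolded eventually_ae_filter] obtain N where N: "N \<in> null_sets lborel"
      "{p. indicator ({0..1} \<times> {0..1}) p *\<^sub>R g p \<noteq> g' p} \<subseteq> N"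
    by auto
  have id: "(\<lambda>p. p) \<in> measurable \<Q> (borel :: (real \<times> real) measure)"
  proof -
    have "(\<lambda>x. x) \<in> measurable \<I> borel"
      by (rule measurable_restrict_space1) (rule measurable_completion, simp)
    then have "(\<lambda>p. (fst p, snd p)) \<in> measurable \<Q> (borel \<Otimes>\<^sub>M borel)"
      by (intro measurable_Pair) (auto intro: measurable_compose)
    then show ?thesis unfolding borel_prod prod.collapse .
  qed
  let ?N = "N \<inter> ({0..1} \<times> {0..1})"
  have g'_meas: "g' \<in> borel_measurable \<Q>"
    by (rule measurable_compose[OF id]) (use g'(1) in simp)
  have N_meas: "?N \<in> sets \<Q>"
    using measurable_sets[OF id, of N] N(1) by auto
  have "emeasure \<L> ?N = emeasure lebesgue ?N"
    by (rule emeasure_lebesgue_square) (rule Int_lower2)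
  also have "\<dots> \<le> emeasure lebesgue N"
    using null_sets_completionI[OF N(1)] by (intro emeasure_mono) auto
  also have "\<dots> = 0" using null_sets_completionI[OF N(1)] by (rule null_setsD1)
  finally have "emeasure \<Q> ?N = 0"
    by (simp add: emeasure_unit_square[OF N_meas])
  then have "?N \<in> null_sets \<Q>"
    using N_meas by (rule null_setsI)
  moreover have "g p = g' p" if "p \<in> {0..1} \<times> {0..1} - ?N" for p
  proof -
    have "indicator ({0..1} \<times> {0..1}) p *\<^sub>R g p = g' p"
      using that N(2) by blast
    then show ?thesis using that by (simp only: indicator_simps DiffD1 scaleR_one)
  qed
  ultimately show thesis using that[OF g'_meas] by blast
qed

subsection \<open>Kernels and the cut norm\<close>

text \<open>For bounded \<open>\<Q>\<close>-measurable D this says that the cut norm is at most c.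
  The form as a predicate avoids carrying boundedness of a supremum through every estimate, and
  integrating over \<open>\<Q>\<close> makes Fubini available.\<close>

definition cut_le :: "(real \<times> real \<Rightarrow> real) \<Rightarrow> real \<Rightarrow> bool" where
  "cut_le D c \<longleftrightarrow> (\<forall>S\<in>sets \<I>. \<forall>T\<in>sets \<I>. \<bar>\<integral>p. indicator (S \<times> T) p * D p \<partial>\<Q>\<bar> \<le> c)"

definition bounded_kernel :: "(real \<times> real \<Rightarrow> real) \<Rightarrow> bool" where
  "bounded_kernel D \<longleftrightarrow> D \<in> borel_measurable \<Q> \<and> (\<exists>B. \<forall>p\<in>{0..1} \<times> {0..1}. \<bar>D p\<bar> \<le> B)"

lemma bounded_kernelI:
  "D \<in> borel_measurable \<Q> \<Longrightarrow> (\<And>p. p \<in> {0..1} \<times> {0..1} \<Longrightarrow> \<bar>D p\<bar> \<le> B) \<Longrightarrow> bounded_kernel D"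
  unfolding bounded_kernel_def by blast

lemma bounded_kernel_measurable [measurable_dest]: "bounded_kernel D \<Longrightarrow> D \<in> borel_measurable \<Q>"
  by (simp add: bounded_kernel_def)

lemma bounded_kernel_integrable: "bounded_kernel D \<Longrightarrow> integrable \<Q> D"
proof -
  assume D: "bounded_kernel D"
  then obtain B where "\<forall>p\<in>{0..1} \<times> {0..1}. \<bar>D p\<bar> \<le> B" by (auto simp: bounded_kernel_def)
  then show "integrable \<Q> D"
    using D by (intro unit_square.P.integrable_const_bound[of _ B] AE_I2) (auto simp: bounded_kernel_def)
qed

lemma bounded_kernel_add:
  assumes "bounded_kernel D" "bounded_kernel E"
  shows "bounded_kernel (\<lambda>p. D p + E p)"
proof -
  obtain B C where "\<forall>p\<in>{0..1} \<times> {0..1}. \<bar>D p\<bar> \<le> B" "\<forall>p\<in>{0..1} \<times> {0..1}. \<bar>E p\<bar> \<le> C"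
    using assms by (auto simp: bounded_kernel_def)
  then show ?thesis
    using assms by (intro bounded_kernelI[of _ "B + C"]) (auto simp: bounded_kernel_def intro: order_trans[OF abs_triangle_ineq add_mono])
qed

lemma bounded_kernel_mult:
  assumes "bounded_kernel D" "bounded_kernel E"
  shows "bounded_kernel (\<lambda>p. D p * E p)"
proof -
  obtain B C where "\<forall>p\<in>{0..1} \<times> {0..1}. \<bar>D p\<bar> \<le> B" "\<forall>p\<in>{0..1} \<times> {0..1}. \<bar>E p\<bar> \<le> C"
    using assms by (auto simp: bounded_kernel_def)
  then show ?thesis
    using assms by (intro bounded_kernelI[of _ "B * C"]) 
      (auto simp: bounded_kernel_def abs_mult intro!: mult_mono intro: order_trans[OF abs_ge_zero])
qed

lemma bounded_kernel_const: "bounded_kernel (\<lambda>p. c)"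
  by (rule bounded_kernelI[of _ "\<bar>c\<bar>"]) auto

lemma bounded_kernel_cmult: "bounded_kernel D \<Longrightarrow> bounded_kernel (\<lambda>p. c * D p)"
  by (rule bounded_kernel_mult[OF bounded_kernel_const])

lemma bounded_kernel_diff:
  "bounded_kernel D \<Longrightarrow> bounded_kernel E \<Longrightarrow> bounded_kernel (\<lambda>p. D p - E p)"
  using bounded_kernel_add[of D "\<lambda>p. (-1) * E p"] bounded_kernel_cmult[of E "-1"] by simp

lemma bounded_kernel_sum:
  "finite A \<Longrightarrow> (\<And>i. i \<in> A \<Longrightarrow> bounded_kernel (D i)) \<Longrightarrow> bounded_kernel (\<lambda>p. \<Sum>i\<in>A. D i p)"
  by (induction A rule: finite_induct) (auto intro: bounded_kernel_add bounded_kernel_const)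

lemma bounded_kernel_indicator:
  assumes "S \<in> sets \<I>" "T \<in> sets \<I>"
  shows "bounded_kernel (indicator (S \<times> T))"
  by (rule bounded_kernelI[of _ 1]) (use assms in \<open>auto simp: indicator_def\<close>)

lemma cut_leD:
  "cut_le D c \<Longrightarrow> S \<in> sets \<I> \<Longrightarrow> T \<in> sets \<I> \<Longrightarrow> \<bar>\<integral>p. indicator (S \<times> T) p * D p \<partial>\<Q>\<bar> \<le> c"
  by (simp add: cut_le_def)

lemma cut_le_cong:
  assumes "cut_le D c" "\<And>p. p \<in> {0..1} \<times> {0..1} \<Longrightarrow> D p = E p"
  shows "cut_le E c"
proof -
  have "(\<integral>p. indicator (S \<times> T) p * E p \<partial>\<Q>) = (\<integral>p. indicator (S \<times> T) p * D p \<partial>\<Q>)" for S T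
    by (rule Bochner_Integration.integral_cong) (use assms(2) in auto)
  then show ?thesis using assms(1) by (simp add: cut_le_def)
qed

lemma cut_le_add:
  assumes "cut_le D c" "cut_le E d" "bounded_kernel D" "bounded_kernel E"
  shows "cut_le (\<lambda>p. D p + E p) (c + d)"
  unfolding cut_le_def
proof (intro ballI)
  fix S T assume ST: "S \<in> sets \<I>" "T \<in> sets \<I>"
  have "(\<integral>p. indicator (S \<times> T) p * (D p + E p) \<partial>\<Q>)
     = (\<integral>p. indicator (S \<times> T) p * D p \<partial>\<Q>) + (\<integral>p. indicator (S \<times> T) p * E p \<partial>\<Q>)"
    by (subst Bochner_Integration.integral_add[symmetric])
      (auto simp: algebra_simps intro!: bounded_kernel_integrable bounded_kernel_mult assms bounded_kernel_indicator ST)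
  then show "\<bar>\<integral>p. indicator (S \<times> T) p * (D p + E p) \<partial>\<Q>\<bar> \<le> c + d"
    using cut_leD[OF assms(1) ST] cut_leD[OF assms(2) ST] by linarith
qed

lemma cut_le_minus_commute: "cut_le (\<lambda>p. D p - E p) c \<Longrightarrow> cut_le (\<lambda>p. E p - D p) c"
proof -
  have "(\<integral>p. indicator (S \<times> T) p * (E p - D p) \<partial>\<Q>) = - (\<integral>p. indicator (S \<times> T) p * (D p - E p) \<partial>\<Q>)" for S T
    by (subst Bochner_Integration.integral_minus[symmetric]) (simp add: algebra_simps)
  then show "cut_le (\<lambda>p. D p - E p) c \<Longrightarrow> cut_le (\<lambda>p. E p - D p) c"
    by (simp add: cut_le_def)
qed

lemma cut_le_trans:
  assumes "cut_le (\<lambda>p. D p - E p) c" "cut_le (\<lambda>p. E p - F p) d"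
    and "bounded_kernel D" "bounded_kernel E" "bounded_kernel F"
  shows "cut_le (\<lambda>p. D p - F p) (c + d)"
  using cut_le_add[OF assms(1,2) bounded_kernel_diff bounded_kernel_diff] assms(3-) by simp

lemma cut_le_mono: "cut_le D c \<Longrightarrow> c \<le> d \<Longrightarrow> cut_le D d"
  unfolding cut_le_def by (meson order_trans)

lemma cut_le_L1:
  assumes "bounded_kernel D" "(\<integral>p. \<bar>D p\<bar> \<partial>\<Q>) \<le> c"
  shows "cut_le D c"
  unfolding cut_le_def
proof (intro ballI)
  fix S T assume ST: "S \<in> sets \<I>" "T \<in> sets \<I>"
  have "\<bar>\<integral>p. indicator (S \<times> T) p * D p \<partial>\<Q>\<bar> \<le> (\<integral>p. \<bar>indicator (S \<times> T) p * D p\<bar> \<partial>\<Q>)"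
    by (rule integral_abs_bound)
  also have "\<dots> \<le> (\<integral>p. \<bar>D p\<bar> \<partial>\<Q>)"
    by (intro integral_mono integrable_abs bounded_kernel_integrable bounded_kernel_mult assms
        bounded_kernel_indicator ST) (auto simp: indicator_def)
  finally show "\<bar>\<integral>p. indicator (S \<times> T) p * D p \<partial>\<Q>\<bar> \<le> c" using assms(2) by linarith
qed

text \<open>Measurable for the product of the Lebesgue sigma-algebras of the two sides, which is
  more than the Borel sets. This class is closed under \<open>pullback\<close>, whose maps are only
  Lebesgue measurable.\<close>

definition borel_graphon :: "(real \<times> real \<Rightarrow> real) \<Rightarrow> bool" where
  "borel_graphon W \<longleftrightarrow> graphon W \<and> W \<in> borel_measurable \<Q>"

lemma graphon_range:
  "graphon W \<Longrightarrow> p \<in> {0..1} \<times> {0..1} \<Longrightarrow> 0 \<le> W p \<and> W p \<le> 1"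
  unfolding graphon_def using PiE_mem[of W "{0..1} \<times> {0..1}" "\<lambda>_. {0..1}" p] by auto

lemma graphon_sym: "graphon W \<Longrightarrow> W (x, y) = W (y, x)"
proof (cases "(x, y) \<in> {0..1} \<times> {0..1}")
  case False
  assume "graphon W"
  then have "W (x, y) = undefined" "W (y, x) = undefined"
    unfolding graphon_def using False by (auto intro!: PiE_arb[of W "{0..1} \<times> {0..1}" "\<lambda>_. {0..1}"])
  then show ?thesis by simp
qed (simp add: graphon_def)

lemma graphon_measurable: "graphon W \<Longrightarrow> W \<in> borel_measurable \<L>"
  by (simp add: graphon_def)

lemma borel_graphon_graphon: "borel_graphon W \<Longrightarrow> graphon W"
  by (simp add: borel_graphon_def)

lemma borel_graphon_bounded: "borel_graphon W \<Longrightarrow> bounded_kernel W"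
  by (rule bounded_kernelI[of _ 1]) (auto simp: borel_graphon_def dest: graphon_range)

text \<open>A function known only up to null sets may be asymmetric or leave [0,1] at some points.
  Averaging over the reflection and truncating repairs both, and changes nothing where the values
  were already those of a graphon.\<close>

lemma borel_graphon_symmetrise:
  assumes "g \<in> borel_measurable \<Q>"
  shows "borel_graphon (restrict (\<lambda>(x, y). max 0 (min 1 ((g (x, y) + g (y, x)) / 2))) ({0..1} \<times> {0..1}))"
    (is "borel_graphon ?h")
proof -
  have [measurable]: "g \<in> borel_measurable \<Q>" by fact
  have "(\<lambda>(x, y). max 0 (min 1 ((g (x, y) + g (y, x)) / 2))) \<in> borel_measurable \<Q>"
    by measurable
  then have meas: "?h \<in> borel_measurable \<Q>"
    by (subst measurable_cong[where g = "\<lambda>(x, y). max 0 (min 1 ((g (x, y) + g (y, x)) / 2))"]) auto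
  then show ?thesis
    unfolding borel_graphon_def graphon_def
    using borel_measurable_unit_square[OF meas] by (auto simp: add.commute)
qed

lemma null_sets_swap:
  assumes "N \<in> null_sets \<Q>"
  shows "{p \<in> {0..1} \<times> {0..1}. (snd p, fst p) \<in> N} \<in> null_sets \<Q>"
proof -
  have [measurable]: "N \<in> sets \<Q>" using assms by auto
  have "(\<lambda>(x, y). (y, x)) -` N \<inter> space \<Q> \<in> sets \<Q>"
    by (rule measurable_sets[OF measurable_pair_swap']) simp
  moreover have "emeasure \<Q> ((\<lambda>(x, y). (y, x)) -` N \<inter> space \<Q>) = emeasure \<Q> N"
    by (subst (2) unit_square.distr_pair_swap) (simp add: emeasure_distr)
  moreover have "(\<lambda>(x, y). (y, x)) -` N \<inter> space \<Q> = {p \<in> {0..1} \<times> {0..1}. (snd p, fst p) \<in> N}"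
    by auto
  ultimately show ?thesis using assms by (simp add: null_sets_def)
qed

lemma graphon_borel_representative:
  assumes "graphon W"
  obtains W' N where "borel_graphon W'" "N \<in> null_sets \<Q>" "\<And>p. p \<in> {0..1} \<times> {0..1} - N \<Longrightarrow> W p = W' p"
proof -
  obtain g N where g: "g \<in> borel_measurable \<Q>" "N \<in> null_sets \<Q>"
      "\<And>p. p \<in> {0..1} \<times> {0..1} - N \<Longrightarrow> W p = g p"
    using unit_square_representative[OF graphon_measurable[OF assms]] by blast
  \<comment> \<open>The exceptional set is enlarged by its mirror image because the symmetrised
    value at (x, y) also involves g at (y, x).\<close>
  let ?N = "N \<union> {p \<in> {0..1} \<times> {0..1}. (snd p, fst p) \<in> N}"
  show ?thesis
  proof (rule that[OF borel_graphon_symmetrise[OF g(1)], of ?N])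
    show "?N \<in> null_sets \<Q>" using g(2) null_sets_swap[OF g(2)] by (rule null_sets.Un)
    fix p assume p: "p \<in> {0..1} \<times> {0..1} - ?N"
    obtain x y where xy: "p = (x, y)" by (cases p)
    have "g (x, y) = W (x, y)" "g (y, x) = W (x, y)"
      using p g(3)[of "(x, y)"] g(3)[of "(y, x)"] graphon_sym[OF assms, of x y] by (auto simp: xy)
    then show "W p = (restrict (\<lambda>(x, y). max 0 (min 1 ((g (x, y) + g (y, x)) / 2))) ({0..1} \<times> {0..1})) p"
      using p graphon_range[OF assms, of p] by (auto simp: xy)
  qed
qed

subsection \<open>Measure preserving bijections\<close>

lemma ipm_bij: "invertible_measure_preserving \<phi> \<Longrightarrow> bij_betw \<phi> {0..1} {0..1}"
  and ipm_measurable: "invertible_measure_preserving \<phi> \<Longrightarrow> \<phi> \<in> measurable \<I> \<I>"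
  and ipm_inv_measurable: "invertible_measure_preserving \<phi> \<Longrightarrow> inv_into {0..1} \<phi> \<in> measurable \<I> \<I>"
  and ipm_distr: "invertible_measure_preserving \<phi> \<Longrightarrow> distr \<I> \<I> \<phi> = \<I>"
  by (simp_all add: invertible_measure_preserving_def)

lemma ipm_range: "invertible_measure_preserving \<phi> \<Longrightarrow> x \<in> {0..1} \<Longrightarrow> \<phi> x \<in> {0..1}"
  using bij_betwE[OF ipm_bij] by blast

lemma ipmI:
  assumes "\<phi> \<in> measurable \<I> \<I>" "\<psi> \<in> measurable \<I> \<I>" "distr \<I> \<I> \<phi> = \<I>"
    and "\<And>x. x \<in> {0..1} \<Longrightarrow> \<psi> (\<phi> x) = x" "\<And>x. x \<in> {0..1} \<Longrightarrow> \<phi> (\<psi> x) = x"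
  shows "invertible_measure_preserving \<phi>"
    and "\<And>x. x \<in> {0..1} \<Longrightarrow> inv_into {0..1} \<phi> x = \<psi> x"
proof -
  have r: "\<phi> \<in> {0..1} \<rightarrow> {0..1}" "\<psi> \<in> {0..1} \<rightarrow> {0..1}"
    using measurable_space[OF assms(1)] measurable_space[OF assms(2)] by auto
  have bij: "bij_betw \<phi> {0..1} {0..1}"
    by (rule bij_betw_byWitness[where f' = \<psi>]) (use assms(4,5) r in auto)
  show eq: "inv_into {0..1} \<phi> x = \<psi> x" if "x \<in> {0..1}" for x
    by (rule inv_into_f_eq[OF bij_betw_imp_inj_on[OF bij]]) (use that r assms(5) in auto)
  have "inv_into {0..1} \<phi> \<in> measurable \<I> \<I>"
    using assms(2) by (subst measurable_cong[where g = \<psi>]) (auto simp: eq)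
  then show "invertible_measure_preserving \<phi>"
    by (simp add: invertible_measure_preserving_def bij assms(1,3))
qed

lemma ipm_inv_left:
  "invertible_measure_preserving \<phi> \<Longrightarrow> x \<in> {0..1} \<Longrightarrow> inv_into {0..1} \<phi> (\<phi> x) = x"
  by (rule inv_into_f_f[OF bij_betw_imp_inj_on[OF ipm_bij]])

lemma ipm_inv_right:
  "invertible_measure_preserving \<phi> \<Longrightarrow> x \<in> {0..1} \<Longrightarrow> \<phi> (inv_into {0..1} \<phi> x) = x"
  using bij_betw_imp_surj_on[OF ipm_bij, of \<phi>] by (intro f_inv_into_f) auto

lemma ipm_inv:
  assumes "invertible_measure_preserving \<phi>"
  shows "invertible_measure_preserving (inv_into {0..1} \<phi>)"
proof (rule ipmI(1)[where \<psi> = \<phi>])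
  have "distr \<I> \<I> (inv_into {0..1} \<phi>) = distr (distr \<I> \<I> \<phi>) \<I> (inv_into {0..1} \<phi>)"
    by (simp only: ipm_distr[OF assms])
  also have "\<dots> = distr \<I> \<I> (inv_into {0..1} \<phi> \<circ> \<phi>)"
    by (rule distr_distr[OF ipm_inv_measurable[OF assms] ipm_measurable[OF assms]])
  also have "\<dots> = distr \<I> \<I> (\<lambda>x. x)"
    by (rule distr_cong) (auto simp: ipm_inv_left[OF assms])
  finally show "distr \<I> \<I> (inv_into {0..1} \<phi>) = \<I>" by simp
qed (use assms in \<open>auto intro: ipm_measurable ipm_inv_measurable simp: ipm_inv_left ipm_inv_right\<close>)

lemma ipm_comp:
  assumes "invertible_measure_preserving \<phi>" "invertible_measure_preserving \<psi>"
  shows "invertible_measure_preserving (\<lambda>x. \<phi> (\<psi> x))"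
proof (rule ipmI(1)[where \<psi> = "\<lambda>x. inv_into {0..1} \<psi> (inv_into {0..1} \<phi> x)"])
  show "(\<lambda>x. \<phi> (\<psi> x)) \<in> measurable \<I> \<I>"
    by (rule measurable_compose[OF ipm_measurable[OF assms(2)] ipm_measurable[OF assms(1)]])
  show "(\<lambda>x. inv_into {0..1} \<psi> (inv_into {0..1} \<phi> x)) \<in> measurable \<I> \<I>"
    by (rule measurable_compose[OF ipm_inv_measurable[OF assms(1)] ipm_inv_measurable[OF assms(2)]])
  have "distr (distr \<I> \<I> \<psi>) \<I> \<phi> = distr \<I> \<I> (\<phi> \<circ> \<psi>)"
    by (rule distr_distr[OF ipm_measurable[OF assms(1)] ipm_measurable[OF assms(2)]])
  then show "distr \<I> \<I> (\<lambda>x. \<phi> (\<psi> x)) = \<I>"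
    by (simp add: ipm_distr[OF assms(1)] ipm_distr[OF assms(2)] comp_def)
qed (use ipm_range[OF assms(2)] ipm_range[OF ipm_inv[OF assms(1)]] in
    \<open>auto simp: ipm_inv_left[OF assms(1)] ipm_inv_left[OF assms(2)]
      ipm_inv_right[OF assms(1)] ipm_inv_right[OF assms(2)]\<close>)

lemma ipm_id: "invertible_measure_preserving (\<lambda>x. x)"
  by (rule ipmI(1)[where \<psi> = "\<lambda>x. x"]) auto

lemma ipm_map_prod_measurable:
  assumes "invertible_measure_preserving \<phi>"
  shows "map_prod \<phi> \<phi> \<in> measurable \<Q> \<Q>"
proof -
  note [measurable] = ipm_measurable[OF assms]
  have "(\<lambda>p. (\<phi> (fst p), \<phi> (snd p))) \<in> measurable \<Q> \<Q>" by measurable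
  then show ?thesis by (simp add: map_prod_def case_prod_beta)
qed

lemma ipm_map_prod_distr:
  assumes "invertible_measure_preserving \<phi>"
  shows "distr \<Q> \<Q> (map_prod \<phi> \<phi>) = \<Q>"
proof -
  have "distr \<I> \<I> \<phi> \<Otimes>\<^sub>M distr \<I> \<I> \<phi> = distr \<Q> \<Q> (\<lambda>(x, y). (\<phi> x, \<phi> y))"
    by (rule pair_measure_distr) (simp_all add: ipm_measurable[OF assms] ipm_distr[OF assms]
        unit_interval.sigma_finite_measure_axioms)
  then show ?thesis by (simp add: ipm_distr[OF assms] map_prod_def)
qed

lemma bounded_kernel_pullback:
  assumes "invertible_measure_preserving \<phi>" "bounded_kernel D"
  shows "bounded_kernel (\<lambda>p. D (map_prod \<phi> \<phi> p))"
proof -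
  obtain B where B: "\<forall>p\<in>{0..1} \<times> {0..1}. \<bar>D p\<bar> \<le> B" using assms(2) by (auto simp: bounded_kernel_def)
  have "D \<in> borel_measurable \<Q>" using assms(2) by (simp add: bounded_kernel_def)
  then show ?thesis
    by (intro bounded_kernelI[of _ B] measurable_compose[OF ipm_map_prod_measurable[OF assms(1)]])
      (use B ipm_range[OF assms(1)] in auto)
qed

lemma integral_pullback:
  fixes f :: "real \<times> real \<Rightarrow> real"
  assumes "invertible_measure_preserving \<phi>" "f \<in> borel_measurable \<Q>"
  shows "(\<integral>p. f (map_prod \<phi> \<phi> p) \<partial>\<Q>) = (\<integral>p. f p \<partial>\<Q>)"
  using integral_distr[OF ipm_map_prod_measurable[OF assms(1)] assms(2)]
  by (simp only: ipm_map_prod_distr[OF assms(1)])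

text \<open>As \<phi> is a bijection, \<open>S \<times> T\<close> is the preimage of the rectangle
  whose sides are the images of S and T, and a change of variables gives the bound. The images are
  written as preimages under the inverse, which makes them measurable.\<close>

lemma cut_le_pullback:
  assumes "invertible_measure_preserving \<phi>" "bounded_kernel D" "cut_le D c"
  shows "cut_le (\<lambda>p. D (map_prod \<phi> \<phi> p)) c"
  unfolding cut_le_def
proof (intro ballI)
  fix S T assume ST: "S \<in> sets \<I>" "T \<in> sets \<I>"
  define S' where "S' = inv_into {0..1} \<phi> -` S \<inter> {0..1}"
  define T' where "T' = inv_into {0..1} \<phi> -` T \<inter> {0..1}"
  have S'T': "S' \<in> sets \<I>" "T' \<in> sets \<I>"
    using measurable_sets[OF ipm_inv_measurable[OF assms(1)]] ST by (auto simp: S'_def T'_def)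
  have "(\<integral>p. indicator (S \<times> T) p * D (map_prod \<phi> \<phi> p) \<partial>\<Q>)
      = (\<integral>p. indicator (S' \<times> T') (map_prod \<phi> \<phi> p) * D (map_prod \<phi> \<phi> p) \<partial>\<Q>)"
  proof (rule Bochner_Integration.integral_cong[OF refl])
    fix p assume "p \<in> space \<Q>"
    then have "p \<in> S \<times> T \<longleftrightarrow> map_prod \<phi> \<phi> p \<in> S' \<times> T'"
      using ipm_range[OF assms(1)] ipm_inv_left[OF assms(1)] by (cases p) (auto simp: S'_def T'_def)
    then show "indicator (S \<times> T) p * D (map_prod \<phi> \<phi> p)
        = indicator (S' \<times> T') (map_prod \<phi> \<phi> p) * D (map_prod \<phi> \<phi> p)"
      by (simp add: indicator_def)
  qed
  also have "\<dots> = (\<integral>p. indicator (S' \<times> T') p * D p \<partial>\<Q>)"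
    by (rule integral_pullback[OF assms(1)])
      (rule bounded_kernel_measurable[OF bounded_kernel_mult[OF bounded_kernel_indicator[OF S'T'] assms(2)]])
  finally show "\<bar>\<integral>p. indicator (S \<times> T) p * D (map_prod \<phi> \<phi> p) \<partial>\<Q>\<bar> \<le> c"
    using cut_leD[OF assms(3) S'T'] by simp
qed

definition pullback :: "(real \<Rightarrow> real) \<Rightarrow> (real \<times> real \<Rightarrow> real) \<Rightarrow> real \<times> real \<Rightarrow> real" where
  "pullback \<phi> W = restrict (\<lambda>p. W (map_prod \<phi> \<phi> p)) ({0..1} \<times> {0..1})"

lemma pullback_apply: "p \<in> {0..1} \<times> {0..1} \<Longrightarrow> pullback \<phi> W p = W (map_prod \<phi> \<phi> p)"
  unfolding pullback_def by (rule restrict_apply')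

lemma borel_graphon_pullback:
  assumes "invertible_measure_preserving \<phi>" "borel_graphon W"
  shows "borel_graphon (pullback \<phi> W)"
proof -
  have "(\<lambda>p. W (map_prod \<phi> \<phi> p)) \<in> borel_measurable \<Q>"
    using assms(2) by (intro measurable_compose[OF ipm_map_prod_measurable[OF assms(1)]]) (simp add: borel_graphon_def)
  then have meas: "pullback \<phi> W \<in> borel_measurable \<Q>"
    by (subst measurable_cong[OF pullback_apply]) auto
  have "pullback \<phi> W p \<in> {0..1}" if p: "p \<in> {0..1} \<times> {0..1}" for p
  proof -
    have "map_prod \<phi> \<phi> p \<in> {0..1} \<times> {0..1}"
      using ipm_range[OF assms(1)] p by (cases p) auto
    then show ?thesis
      using graphon_range[OF borel_graphon_graphon[OF assms(2)]] pullback_apply[OF p, of \<phi> W] by auto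
  qed
  then have "pullback \<phi> W \<in> ({0..1} \<times> {0..1}) \<rightarrow>\<^sub>E {0..1}"
    by (intro PiE_I) (auto simp: pullback_def)
  then show ?thesis
    unfolding borel_graphon_def graphon_def
    using borel_measurable_unit_square[OF meas] meas graphon_sym[OF borel_graphon_graphon[OF assms(2)]]
    by (auto simp: pullback_apply)
qed

section \<open>From bounds over \<open>\<Q>\<close> to \<open>cut_norm\<close> and
  \<open>cut_dist\<close>\<close>

lemma set_integral_square:
  fixes D :: "real \<times> real \<Rightarrow> real"
  assumes "S \<in> sets \<I>" "T \<in> sets \<I>"
  shows "(LINT p:S \<times> T|lebesgue. D p) = (\<integral>p. indicator (S \<times> T) p * D p \<partial>\<L>)"
proof -
  have sub: "S \<times> T \<subseteq> {0..1} \<times> {0..1}"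
    using assms by (intro Sigma_mono) (auto simp: sets_restrict_space)
  have "(\<integral>p. indicator (S \<times> T) p * D p \<partial>\<L>)
      = (\<integral>p. indicator ({0..1} \<times> {0..1}) p *\<^sub>R (indicator (S \<times> T) p * D p) \<partial>lebesgue)"
    using lebesgue_sets_Times[of "{0..1}" "{0..1}"] by (intro integral_restrict_space) simp
  also have "\<dots> = (\<integral>p. indicator (S \<times> T) p *\<^sub>R D p \<partial>lebesgue)"
    using sub by (intro Bochner_Integration.integral_cong) (auto simp: indicator_def subset_iff)
  finally show ?thesis by (simp add: set_lebesgue_integral_def)
qed

text \<open>\<open>cut_norm\<close> is a supremum of reals, hence meaningful only once the integrals
  are bounded. On a square of measure 1 the bound 1 for D provides this, and the empty rectangle
  gives the lower bound 0.\<close>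

lemma cut_norm_bounds:
  assumes "\<And>p. p \<in> {0..1} \<times> {0..1} \<Longrightarrow> \<bar>D p\<bar> \<le> 1"
  shows "0 \<le> cut_norm D"
    and "(\<And>S T. S \<in> sets \<I> \<Longrightarrow> T \<in> sets \<I> \<Longrightarrow> \<bar>\<integral>p. indicator (S \<times> T) p * D p \<partial>\<L>\<bar> \<le> c) \<Longrightarrow> cut_norm D \<le> c"
proof -
  interpret L: prob_space \<L> by (rule prob_space_lebesgue_square)
  let ?X = "{(S, T). S \<in> sets \<I> \<and> T \<in> sets \<I>}"
  let ?f = "\<lambda>(S, T). \<bar>LINT p:S \<times> T|lebesgue. D p\<bar>"
  have ne: "({}, {}) \<in> ?X" by auto
  have "bdd_above (?f ` ?X)"
  proof (rule bdd_aboveI2)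
    fix z assume "z \<in> ?X"
    then obtain S T where z: "z = (S, T)" "S \<in> sets \<I>" "T \<in> sets \<I>" by auto
    have "\<bar>\<integral>p. indicator (S \<times> T) p * D p \<partial>\<L>\<bar> \<le> 1"
    proof (rule L.abs_integral_le_const)
      fix p assume "p \<in> space \<L>"
      then show "\<bar>indicator (S \<times> T) p * D p\<bar> \<le> 1"
        using assms[of p] by (simp only: space_lebesgue_square) (auto simp: indicator_def)
    qed simp
    then show "?f z \<le> 1" using z by (simp add: set_integral_square)
  qed
  from cSUP_upper[OF ne this] show "0 \<le> cut_norm D"
    by (simp add: cut_norm_def set_lebesgue_integral_def)
  assume *: "\<And>S T. S \<in> sets \<I> \<Longrightarrow> T \<in> sets \<I> \<Longrightarrow> \<bar>\<integral>p. indicator (S \<times> T) p * D p \<partial>\<L>\<bar> \<le> c"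
  show "cut_norm D \<le> c"
    unfolding cut_norm_def
  proof (rule cSUP_least)
    fix z assume "z \<in> ?X"
    then show "?f z \<le> c" using * by (auto simp: set_integral_square)
  qed (use ne in auto)
qed

lemma graphon_diff_bound:
  assumes "graphon U" "graphon W" "invertible_measure_preserving \<phi>" "p \<in> {0..1} \<times> {0..1}"
  shows "\<bar>(\<lambda>(x, y). U (x, y) - W (\<phi> x, \<phi> y)) p\<bar> \<le> 1"
proof -
  have "map_prod \<phi> \<phi> p \<in> {0..1} \<times> {0..1}"
    using ipm_range[OF assms(3)] assms(4) by (cases p) auto
  then show ?thesis
    using graphon_range[OF assms(1,4)] graphon_range[OF assms(2), of "map_prod \<phi> \<phi> p"]
    by (auto simp: abs_le_iff split: prod.splits)
qed

lemma cut_dist_nonneg: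
  assumes "graphon U" "graphon W"
  shows "0 \<le> cut_dist U W"
  unfolding cut_dist_def
  by (rule cINF_greatest) (use ipm_id cut_norm_bounds(1)[OF graphon_diff_bound[OF assms]] in auto)

text \<open>One explicit bijection bounds the infimum. This is where estimates for the
  representative U' return to the original graphon U: their integrals over rectangles
  coincide.\<close>

lemma cut_dist_le:
  assumes "graphon U" "borel_graphon U'" "N \<in> null_sets \<Q>"
    and eq: "\<And>p. p \<in> {0..1} \<times> {0..1} - N \<Longrightarrow> U p = U' p"
    and W: "borel_graphon W" and \<phi>: "invertible_measure_preserving \<phi>"
    and cut: "cut_le (\<lambda>p. U' p - W (map_prod \<phi> \<phi> p)) c"
  shows "cut_dist U W \<le> c"
proof -
  note gW = borel_graphon_graphon[OF W]
  let ?D = "\<lambda>(x, y). U (x, y) - W (\<phi> x, \<phi> y)"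
  have "cut_dist U W \<le> cut_norm ?D"
    unfolding cut_dist_def
  proof (rule cINF_lower)
    show "bdd_below ((\<lambda>\<phi>. cut_norm (\<lambda>(x, y). U (x, y) - W (\<phi> x, \<phi> y))) ` Collect invertible_measure_preserving)"
      by (rule bdd_belowI2[of _ 0]) (use cut_norm_bounds(1)[OF graphon_diff_bound[OF assms(1) gW]] in auto)
  qed (use \<phi> in simp)
  also have "\<dots> \<le> c"
  proof (rule cut_norm_bounds(2)[OF graphon_diff_bound[OF assms(1) gW \<phi>]])
    fix S T assume ST: "S \<in> sets \<I>" "T \<in> sets \<I>"
    have bk: "bounded_kernel (\<lambda>p. indicator (S \<times> T) p * (U' p - W (map_prod \<phi> \<phi> p)))"
      by (intro bounded_kernel_mult bounded_kernel_indicator ST bounded_kernel_diff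
          bounded_kernel_pullback \<phi> borel_graphon_bounded W assms(2))
    have DW: "(\<lambda>p. W (map_prod \<phi> \<phi> p)) \<in> borel_measurable \<L>"
      by (intro borel_measurable_unit_square bounded_kernel_measurable bounded_kernel_pullback \<phi> borel_graphon_bounded W)
    have ind: "(indicator (S \<times> T) :: _ \<Rightarrow> real) \<in> borel_measurable \<L>"
      by (intro borel_measurable_unit_square bounded_kernel_measurable bounded_kernel_indicator ST)
    have D: "?D = (\<lambda>p. U p - W (map_prod \<phi> \<phi> p))" by auto
    have "(\<integral>p. indicator (S \<times> T) p * ?D p \<partial>\<L>)
        = (\<integral>p. indicator (S \<times> T) p * (U' p - W (map_prod \<phi> \<phi> p)) \<partial>\<L>)"
    proof (rule integral_cong_AE)
      show "(\<lambda>p. indicator (S \<times> T) p * ?D p) \<in> borel_measurable \<L>"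
        unfolding D by (intro borel_measurable_times ind borel_measurable_diff DW graphon_measurable assms(1))
      show "(\<lambda>p. indicator (S \<times> T) p * (U' p - W (map_prod \<phi> \<phi> p))) \<in> borel_measurable \<L>"
        by (rule borel_measurable_unit_square[OF bounded_kernel_measurable[OF bk]])
      from AE_not_in[OF null_sets_unit_square[OF assms(3)]]
      have "AE p in \<L>. p \<in> {0..1} \<times> {0..1} - N"
        using AE_space[of \<L>] by eventually_elim (simp only: space_lebesgue_square Diff_iff simp_thms)
      then show "AE p in \<L>. indicator (S \<times> T) p * ?D p
          = indicator (S \<times> T) p * (U' p - W (map_prod \<phi> \<phi> p))"
        unfolding D by eventually_elim (simp add: eq)
    qed
    also have "\<dots> = (\<integral>p. indicator (S \<times> T) p * (U' p - W (map_prod \<phi> \<phi> p)) \<partial>\<Q>)"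
      by (rule integral_unit_square[OF bounded_kernel_measurable[OF bk]])
    finally show "\<bar>\<integral>p. indicator (S \<times> T) p * ?D p \<partial>\<L>\<bar> \<le> c"
      using cut_leD[OF cut ST] by simp
  qed
  finally show ?thesis .
qed

subsection \<open>The counting lemma\<close>

lemma edge_weight_pair:
  assumes "graphon W"
  shows "edge_weight W x {i, j} = W (x i, x j)"
  unfolding edge_weight_def
  by (rule the_equality) (auto simp: doubleton_eq_iff graphon_sym[OF assms])

lemma edge_pairE:
  assumes "card e = 2"
  obtains i j where "e = {i, j}" "i \<noteq> j"
  using assms by (auto simp: card_2_iff)

lemma edge_weight_cong:
  assumes "graphon W" "card e = 2" "\<And>k. k \<in> e \<Longrightarrow> x k = y k"
  shows "edge_weight W x e = edge_weight W y e"
  using assms(2) by (rule edge_pairE) (use assms(1,3) in \<open>auto simp: edge_weight_pair\<close>)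

lemma edge_weight_measurable:
  assumes "borel_graphon W" "card e = 2" "e \<subseteq> V"
  shows "(\<lambda>x. edge_weight W x e) \<in> borel_measurable (PiM V (\<lambda>_. \<I>))"
  using assms(2)
proof (rule edge_pairE)
  fix i j assume e: "e = {i, j}" "i \<noteq> j"
  have [measurable]: "W \<in> borel_measurable \<Q>" using assms(1) by (simp add: borel_graphon_def)
  have [measurable]: "i \<in> V" "j \<in> V" using e assms(3) by auto
  have "(\<lambda>x. W (x i, x j)) \<in> borel_measurable (PiM V (\<lambda>_. \<I>))" by measurable
  then show ?thesis by (simp add: e edge_weight_pair[OF borel_graphon_graphon[OF assms(1)]])
qed

lemma edge_weight_range:
  assumes "graphon W" "card e = 2" "\<And>k. k \<in> e \<Longrightarrow> x k \<in> {0..1}"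
  shows "0 \<le> edge_weight W x e \<and> edge_weight W x e \<le> 1"
  using assms(2)
proof (rule edge_pairE)
  fix i j assume e: "e = {i, j}"
  then have "(x i, x j) \<in> {0..1} \<times> {0..1}" using assms(3) by blast
  then show ?thesis using graphon_range[OF assms(1)] by (simp add: e edge_weight_pair[OF assms(1)])
qed

lemma cut_le_nonneg: "cut_le D c \<Longrightarrow> 0 \<le> c"
  using cut_leD[of D c "{}" "{}"] by simp

lemma bounded_kernel_fst:
  assumes "f \<in> borel_measurable \<I>" "\<And>x. x \<in> {0..1} \<Longrightarrow> 0 \<le> f x \<and> f x \<le> 1"
  shows "bounded_kernel (\<lambda>p. f (fst p))"
proof (rule bounded_kernelI[of _ 1])
  show "(\<lambda>p. f (fst p)) \<in> borel_measurable \<Q>"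
    by (rule measurable_compose[OF measurable_fst assms(1)])
qed (use assms(2) in auto)

lemma bounded_kernel_snd:
  assumes "f \<in> borel_measurable \<I>" "\<And>x. x \<in> {0..1} \<Longrightarrow> 0 \<le> f x \<and> f x \<le> 1"
  shows "bounded_kernel (\<lambda>p. f (snd p))"
proof (rule bounded_kernelI[of _ 1])
  show "(\<lambda>p. f (snd p)) \<in> borel_measurable \<Q>"
    by (rule measurable_compose[OF measurable_snd assms(1)])
qed (use assms(2) in auto)

text \<open>A linear functional of a [0,1]-valued weight is maximised by the indicator of the set
  where its coefficient is positive.\<close>
lemma weight_le_indicator_fst:
  assumes D: "bounded_kernel D"
    and f: "f \<in> borel_measurable \<I>" "\<And>x. x \<in> {0..1} \<Longrightarrow> 0 \<le> f x \<and> f x \<le> 1"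
  obtains S where "S \<in> sets \<I>" "(\<integral>p. f (fst p) * D p \<partial>\<Q>) \<le> (\<integral>p. indicator S (fst p) * D p \<partial>\<Q>)"
proof -
  have [measurable]: "D \<in> borel_measurable \<Q>" using D by measurable
  define h where "h x = (\<integral>y. D (x, y) \<partial>\<I>)" for x
  have h[measurable]: "h \<in> borel_measurable \<I>" unfolding h_def by measurable
  define S where "S = {x \<in> space \<I>. 0 < h x}"
  have S: "S \<in> sets \<I>" unfolding S_def by measurable
  have fub: "bounded_kernel (\<lambda>p. g (fst p) * D p) \<and> integrable \<I> (\<lambda>x. g x * h x)
      \<and> (\<integral>p. g (fst p) * D p \<partial>\<Q>) = (\<integral>x. g x * h x \<partial>\<I>)"
    if g: "g \<in> borel_measurable \<I>" "\<And>x. x \<in> {0..1} \<Longrightarrow> 0 \<le> g x \<and> g x \<le> 1" for g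
  proof -
    have bk: "bounded_kernel (\<lambda>p. g (fst p) * D p)"
      by (intro bounded_kernel_mult bounded_kernel_fst g D)
    have int: "integrable \<Q> (\<lambda>(x, y). g x * D (x, y))"
      using bounded_kernel_integrable[OF bk] by (simp add: split_beta')
    show ?thesis
      using bk unit_square.integral_fst[OF int] unit_square.integrable_fst[OF int]
      by (simp add: h_def split_beta')
  qed
  have indS: "indicator S \<in> borel_measurable \<I>" "\<And>x. x \<in> {0..1} \<Longrightarrow> 0 \<le> (indicator S x :: real) \<and> indicator S x \<le> (1 :: real)"
    using S by (auto simp: indicator_def)
  have "(\<integral>x. f x * h x \<partial>\<I>) \<le> (\<integral>x. indicator S x * h x \<partial>\<I>)"
  proof (rule integral_mono)
    fix x assume x: "x \<in> space \<I>"
    then have "0 \<le> f x" "f x \<le> 1" using f(2) by auto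
    then show "f x * h x \<le> indicator S x * h x"
      using x by (cases "0 < h x") (auto simp: S_def indicator_def mult_nonneg_nonpos intro: mult_left_le_one_le)
  qed (use fub[OF f] fub[OF indS] in auto)
  with fub[OF f] fub[OF indS] show thesis by (intro that[OF S]) auto
qed

lemma integral_swap:
  fixes f :: "real \<times> real \<Rightarrow> real"
  assumes "f \<in> borel_measurable \<Q>"
  shows "(\<integral>p. f (snd p, fst p) \<partial>\<Q>) = (\<integral>p. f p \<partial>\<Q>)"
  using unit_square.integral_product_swap[OF assms] by (simp add: split_beta')

lemma bounded_kernel_swap:
  assumes "bounded_kernel D"
  shows "bounded_kernel (\<lambda>p. D (snd p, fst p))"
proof -
  have [measurable]: "D \<in> borel_measurable \<Q>" using assms by measurable
  have "(\<lambda>p. D (snd p, fst p)) \<in> borel_measurable \<Q>" by measurable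
  then show ?thesis using assms by (auto simp: bounded_kernel_def)
qed

lemma weight_le_indicator_snd:
  assumes D: "bounded_kernel D"
    and f: "f \<in> borel_measurable \<I>" "\<And>x. x \<in> {0..1} \<Longrightarrow> 0 \<le> f x \<and> f x \<le> 1"
  obtains S where "S \<in> sets \<I>" "(\<integral>p. f (snd p) * D p \<partial>\<Q>) \<le> (\<integral>p. indicator S (snd p) * D p \<partial>\<Q>)"
proof -
  obtain S where S: "S \<in> sets \<I>"
      "(\<integral>p. f (fst p) * D (snd p, fst p) \<partial>\<Q>) \<le> (\<integral>p. indicator S (fst p) * D (snd p, fst p) \<partial>\<Q>)"
    using weight_le_indicator_fst[OF bounded_kernel_swap[OF D] f] .
  have "(\<integral>p. g (fst p) * D (snd p, fst p) \<partial>\<Q>) = (\<integral>p. g (snd p) * D p \<partial>\<Q>)"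
    if "g \<in> borel_measurable \<I>" for g :: "real \<Rightarrow> real"
    using integral_swap[of "\<lambda>p. g (snd p) * D p"] that bounded_kernel_measurable[OF D]
    by (simp add: measurable_compose[OF measurable_snd])
  from this[OF f(1)] this[of "indicator S"] S show thesis by (intro that[OF S(1)]) simp
qed

text \<open>The integral is linear in f and in g separately, so first f and then g can be replaced
  by an indicator without decreasing it. What remains is an integral over a rectangle. The lower
  bound is the same argument for the negated kernel.\<close>

lemma cut_le_weights:
  assumes D: "bounded_kernel D" and cut: "cut_le D c"
    and f: "f \<in> borel_measurable \<I>" "\<And>x. x \<in> {0..1} \<Longrightarrow> 0 \<le> f x \<and> f x \<le> 1"
    and g: "g \<in> borel_measurable \<I>" "\<And>x. x \<in> {0..1} \<Longrightarrow> 0 \<le> g x \<and> g x \<le> 1"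
  shows "\<bar>\<integral>p. f (fst p) * (g (snd p) * D p) \<partial>\<Q>\<bar> \<le> c"
proof -
  have le: "(\<integral>p. f (fst p) * (g (snd p) * E p) \<partial>\<Q>) \<le> c" if E: "bounded_kernel E" "cut_le E c" for E
  proof -
    obtain S where S: "S \<in> sets \<I>" "(\<integral>p. f (fst p) * (g (snd p) * E p) \<partial>\<Q>)
        \<le> (\<integral>p. indicator S (fst p) * (g (snd p) * E p) \<partial>\<Q>)"
      using weight_le_indicator_fst[OF bounded_kernel_mult[OF bounded_kernel_snd[OF g] E(1)] f] .
    have indS: "indicator S \<in> borel_measurable \<I>" "\<And>x. x \<in> {0..1} \<Longrightarrow> 0 \<le> (indicator S x :: real) \<and> indicator S x \<le> (1 :: real)"
      using S by (auto simp: indicator_def)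
    obtain T where T: "T \<in> sets \<I>" "(\<integral>p. g (snd p) * (indicator S (fst p) * E p) \<partial>\<Q>)
        \<le> (\<integral>p. indicator T (snd p) * (indicator S (fst p) * E p) \<partial>\<Q>)"
      using weight_le_indicator_snd[OF bounded_kernel_mult[OF bounded_kernel_fst[OF indS] E(1)] g] .
    have "(\<integral>p. indicator T (snd p) * (indicator S (fst p) * E p) \<partial>\<Q>) = (\<integral>p. indicator (S \<times> T) p * E p \<partial>\<Q>)"
      by (rule Bochner_Integration.integral_cong) (auto simp: indicator_def)
    then have "(\<integral>p. indicator T (snd p) * (indicator S (fst p) * E p) \<partial>\<Q>) \<le> c"
      using cut_leD[OF E(2) S(1) T(1)] by simp
    with S(2) T(2) show ?thesis by (simp add: mult.left_commute)
  qed
  have "cut_le (\<lambda>p. 0 - D p) c"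
    by (rule cut_le_minus_commute) (use cut in simp)
  then have "(\<integral>p. f (fst p) * (g (snd p) * (0 - D p)) \<partial>\<Q>) \<le> c"
    by (intro le bounded_kernel_diff bounded_kernel_const D)
  moreover have "(\<integral>p. f (fst p) * (g (snd p) * (0 - D p)) \<partial>\<Q>) = - (\<integral>p. f (fst p) * (g (snd p) * D p) \<partial>\<Q>)"
    by simp
  ultimately show ?thesis using le[OF D cut] by linarith
qed

lemma measurable_edge_product:
  assumes "\<And>e. e \<in> E \<Longrightarrow> borel_graphon (w e) \<and> card e = 2 \<and> e \<subseteq> V"
  shows "(\<lambda>x. \<Prod>e\<in>E. edge_weight (w e) x e) \<in> borel_measurable (PiM V (\<lambda>_. \<I>))"
  by (rule borel_measurable_prod) (use assms edge_weight_measurable in blast)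

lemma edge_product_range:
  assumes "\<And>e. e \<in> E \<Longrightarrow> borel_graphon (w e) \<and> card e = 2 \<and> e \<subseteq> V"
    and "\<And>k. k \<in> V \<Longrightarrow> x k \<in> {0..1}"
  shows "0 \<le> (\<Prod>e\<in>E. edge_weight (w e) x e) \<and> (\<Prod>e\<in>E. edge_weight (w e) x e) \<le> 1"
proof -
  have "0 \<le> edge_weight (w e) x e \<and> edge_weight (w e) x e \<le> 1" if "e \<in> E" for e
    by (rule edge_weight_range) (use assms that borel_graphon_graphon in blast)+
  then show ?thesis by (simp add: prod_nonneg prod_le_1)
qed

text \<open>Freeze all coordinates except those of i and j. An edge containing both would have to be
  \<open>{i, j}\<close>, which is excluded, so the product splits into a function of
  \<open>x i\<close> times a function of \<open>x j\<close>, both with values in [0,1], and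
  \<open>cut_le_weights\<close> applies. The weights may differ from edge to edge because the
  telescoping in \<open>counting_lemma\<close> mixes two graphons.\<close>

lemma counting_edge:
  fixes V :: "'a set"
  assumes V: "finite V" "i \<in> V" "j \<in> V" "i \<noteq> j"
    and E: "\<And>e. e \<in> E \<Longrightarrow> borel_graphon (w e) \<and> card e = 2 \<and> e \<subseteq> V \<and> e \<noteq> {i, j}"
    and D: "bounded_kernel D" "cut_le D c"
  shows "\<bar>\<integral>x. D (x i, x j) * (\<Prod>e\<in>E. edge_weight (w e) x e) \<partial>PiM V (\<lambda>_. \<I>)\<bar> \<le> c"
proof -
  define V' where "V' = V - {i, j}"
  have V': "V = insert i (insert j V')" "finite V'" "j \<notin> V'" "i \<notin> insert j V'"
    using V by (auto simp: V'_def)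
  interpret product_prob_space "\<lambda>_ :: 'a. \<I>"
    by unfold_locales
  have prob: "prob_space (PiM W (\<lambda>_. \<I>))" for W :: "'a set"
    by (rule prob_space_PiM) (rule prob_space_unit_interval)
  note E' = E[THEN conjunct1] E[THEN conjunct2, THEN conjunct1] E[THEN conjunct2, THEN conjunct2, THEN conjunct1]
  have finE: "finite E"
  proof -
    have "E \<subseteq> Pow V" using E by auto
    then show ?thesis using V(1) by (meson finite_Pow_iff finite_subset)
  qed
  define F where "F x = D (x i, x j) * (\<Prod>e\<in>E. edge_weight (w e) x e)" for x
  have [measurable]: "D \<in> borel_measurable \<Q>" using D(1) by measurable
  obtain B where B: "\<And>p. p \<in> {0..1} \<times> {0..1} \<Longrightarrow> \<bar>D p\<bar> \<le> B"
    using D(1) by (auto simp: bounded_kernel_def)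
  have Fm[measurable]: "F \<in> borel_measurable (PiM V (\<lambda>_. \<I>))"
  proof -
    have [measurable]: "(\<lambda>x. \<Prod>e\<in>E. edge_weight (w e) x e) \<in> borel_measurable (PiM V (\<lambda>_. \<I>))"
      by (rule measurable_edge_product) (use E in blast)
    have [measurable]: "i \<in> V" "j \<in> V" by fact+
    show ?thesis unfolding F_def by measurable
  qed
  have FB: "\<bar>F x\<bar> \<le> B" if x: "\<And>k. k \<in> V \<Longrightarrow> x k \<in> {0..1}" for x
  proof -
    have "0 \<le> (\<Prod>e\<in>E. edge_weight (w e) x e) \<and> (\<Prod>e\<in>E. edge_weight (w e) x e) \<le> 1"
      by (rule edge_product_range[where V = V]) (use E x in blast)+
    moreover have "\<bar>D (x i, x j)\<bar> \<le> B" using B[of "(x i, x j)"] x V by blast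
    ultimately show ?thesis
      unfolding F_def abs_mult by (intro order_trans[OF mult_right_le_one_le]) auto
  qed
  have intF: "integrable (PiM V (\<lambda>_. \<I>)) F"
  proof -
    interpret R: prob_space "PiM V (\<lambda>_. \<I>)" by (rule prob)
    show ?thesis
      by (rule R.integrable_const_bound[of _ B]) (auto intro!: AE_I2 FB simp: space_PiM PiE_iff)
  qed
  define G where "G z = (\<integral>a. F (z(i := a)) \<partial>\<I>)" for z
  have Gm: "G \<in> borel_measurable (PiM (insert j V') (\<lambda>_. \<I>))"
  proof -
    have "(\<lambda>(z, a). F (z(i := a))) \<in> borel_measurable (PiM (insert j V') (\<lambda>_. \<I>) \<Otimes>\<^sub>M \<I>)"
      using measurable_compose[OF measurable_add_dim[of i "insert j V'" "\<lambda>_. \<I>"], of F borel] Fm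
      unfolding V'(1) by (simp add: split_beta')
    then show ?thesis
      unfolding G_def by (rule unit_interval.borel_measurable_lebesgue_integral)
  qed
  have GB: "\<bar>G z\<bar> \<le> B" if "z \<in> space (PiM (insert j V') (\<lambda>_. \<I>))" for z
    unfolding G_def
  proof (rule unit_interval.abs_integral_le_const)
    fix a assume "a \<in> space \<I>"
    then show "\<bar>F (z(i := a))\<bar> \<le> B"
      by (intro FB) (use that in \<open>auto simp: V'(1) space_PiM PiE_iff\<close>)
  next
    show "0 \<le> B" using B[of "(0, 0)"] by simp
  qed
  have intG: "integrable (PiM (insert j V') (\<lambda>_. \<I>)) G"
  proof -
    interpret R: prob_space "PiM (insert j V') (\<lambda>_. \<I>)" by (rule prob)
    show ?thesis
      by (rule R.integrable_const_bound[of _ B]) (auto intro!: AE_I2 GB Gm)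
  qed
  have "(\<integral>x. F x \<partial>PiM V (\<lambda>_. \<I>)) = (\<integral>z. G z \<partial>PiM (insert j V') (\<lambda>_. \<I>))"
    unfolding G_def using product_integral_insert[of "insert j V'" i F] V' intF by simp
  also have "\<dots> = (\<integral>y. (\<integral>b. G (y(j := b)) \<partial>\<I>) \<partial>PiM V' (\<lambda>_. \<I>))"
    by (rule product_integral_insert[OF V'(2,3) intG])
  finally have eq: "(\<integral>x. F x \<partial>PiM V (\<lambda>_. \<I>)) = (\<integral>y. (\<integral>b. G (y(j := b)) \<partial>\<I>) \<partial>PiM V' (\<lambda>_. \<I>))" .
  have inner: "\<bar>\<integral>b. G (y(j := b)) \<partial>\<I>\<bar> \<le> c" if y: "y \<in> space (PiM V' (\<lambda>_. \<I>))" for y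
  proof -
    define f where "f a = (\<Prod>e\<in>{e \<in> E. i \<in> e}. edge_weight (w e) (y(i := a)) e)" for a
    \<comment> \<open>Edges through neither i nor j are constant here; they are absorbed into
      g.\<close>
    define g where "g b = (\<Prod>e\<in>{e \<in> E. i \<notin> e}. edge_weight (w e) (y(j := b)) e)" for b
    have iE: "e \<subseteq> insert i V'" if "e \<in> E" "i \<in> e" for e
    proof -
      have "j \<notin> e"
      proof
        assume "j \<in> e"
        then have "{i, j} \<subseteq> e" using that by auto
        moreover have "card {i, j} = card e" using E'(2)[OF that(1)] V(4) by simp
        moreover have "finite e" using E'(3)[OF that(1)] V(1) by (rule finite_subset)
        ultimately have "e = {i, j}" by (metis card_subset_eq)
        then show False using E[OF that(1)] by blast
      qed
      then show ?thesis using E'(3)[OF that(1)] V'(1) by auto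
    qed
    have jE: "e \<subseteq> insert j V'" if "e \<in> E" "i \<notin> e" for e
      using E'(3)[OF that(1)] that(2) V'(1) by auto
    have upd: "y(k := a) \<in> space (PiM (insert k V') (\<lambda>_. \<I>))" if "a \<in> {0..1}" for k a
      using y that by (auto simp: space_PiM PiE_iff extensional_def)
    have rng: "x k \<in> {0..1}" if "x \<in> space (PiM (insert l V') (\<lambda>_. \<I>))" "k \<in> insert l V'" for x k l
      using that by (auto simp: space_PiM PiE_iff)
    have f: "f \<in> borel_measurable \<I>"
      unfolding f_def
      by (rule measurable_compose[OF measurable_component_update[OF y]])
        (use V' iE E' in \<open>auto intro!: measurable_edge_product\<close>)
    have g: "g \<in> borel_measurable \<I>"
      unfolding g_def
      by (rule measurable_compose[OF measurable_component_update[OF y]])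
        (use V' jE E' in \<open>auto intro!: measurable_edge_product\<close>)
    have f01: "0 \<le> f a \<and> f a \<le> 1" if "a \<in> {0..1}" for a
      unfolding f_def
      by (rule edge_product_range[where V = "insert i V'"]) (use iE E' rng[OF upd[OF that]] in auto)
    have g01: "0 \<le> g a \<and> g a \<le> 1" if "a \<in> {0..1}" for a
      unfolding g_def
      by (rule edge_product_range[where V = "insert j V'"]) (use jE E' rng[OF upd[OF that]] in auto)
    have split: "F (y(j := b, i := a)) = f a * (g b * D (a, b))" for a b
    proof -
      let ?x = "y(j := b, i := a)"
      have "(\<Prod>e\<in>E. edge_weight (w e) ?x e)
          = (\<Prod>e\<in>{e \<in> E. i \<in> e}. edge_weight (w e) ?x e) * (\<Prod>e\<in>{e \<in> E. i \<notin> e}. edge_weight (w e) ?x e)"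
        using finE by (subst prod.union_disjoint[symmetric]) (auto intro!: prod.cong)
      also have "(\<Prod>e\<in>{e \<in> E. i \<in> e}. edge_weight (w e) ?x e) = f a"
        unfolding f_def
      proof (rule prod.cong[OF refl])
        fix e assume e: "e \<in> {e \<in> E. i \<in> e}"
        then have "j \<notin> e" using iE[of e] V'(3,4) by auto
        then show "edge_weight (w e) ?x e = edge_weight (w e) (y(i := a)) e"
          using e E' by (intro edge_weight_cong borel_graphon_graphon) auto
      qed
      also have "(\<Prod>e\<in>{e \<in> E. i \<notin> e}. edge_weight (w e) ?x e) = g b"
        unfolding g_def
      proof (rule prod.cong[OF refl])
        fix e assume e: "e \<in> {e \<in> E. i \<notin> e}"
        then show "edge_weight (w e) ?x e = edge_weight (w e) (y(j := b)) e"
          using E' by (intro edge_weight_cong borel_graphon_graphon) auto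
      qed
      finally have "(\<Prod>e\<in>E. edge_weight (w e) ?x e) = f a * g b" .
      moreover have "?x i = a" "?x j = b" using V(4) by auto
      ultimately show ?thesis by (simp only: F_def mult_ac)
    qed
    have bk: "bounded_kernel (\<lambda>p. f (fst p) * (g (snd p) * D p))"
      by (intro bounded_kernel_mult bounded_kernel_fst bounded_kernel_snd f g D(1) f01 g01)
    have "(\<integral>b. G (y(j := b)) \<partial>\<I>) = (\<integral>b. (\<integral>a. f a * (g b * D (a, b)) \<partial>\<I>) \<partial>\<I>)"
      by (simp only: G_def split)
    also have "\<dots> = (\<integral>p. f (fst p) * (g (snd p) * D p) \<partial>\<Q>)"
      using unit_square.integral_snd[of "\<lambda>a b. f a * (g b * D (a, b))"] bounded_kernel_integrable[OF bk]
      by (simp add: split_beta')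
    finally show ?thesis using cut_le_weights[OF D f f01 g g01] by simp
  qed
  interpret R: prob_space "PiM V' (\<lambda>_. \<I>)" by (rule prob)
  have "\<bar>\<integral>y. (\<integral>b. G (y(j := b)) \<partial>\<I>) \<partial>PiM V' (\<lambda>_. \<I>)\<bar> \<le> c"
    by (rule R.abs_integral_le_const) (use inner cut_le_nonneg[OF D(2)] in auto)
  then show ?thesis unfolding eq[symmetric] F_def .
qed

lemma hom_density_borel:
  assumes "simple_graph F" "borel_graphon W"
  shows "hom_density F W = (\<integral>x. (\<Prod>e\<in>snd F. edge_weight W x e) \<partial>PiM (fst F) (\<lambda>_. \<I>))"
  unfolding hom_density_def
  by (rule integral_completion, rule measurable_edge_product) (use assms in \<open>auto simp: simple_graph_def\<close>)

text \<open>Telescoping over hybrids: the edges in A carry U and the others W. Moving one edge into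
  A changes the integral by an expression of the form treated in \<open>counting_edge\<close>, hence
  by at most c.\<close>

lemma counting_lemma:
  fixes F :: "'a graph"
  assumes F: "simple_graph F" and U: "borel_graphon U" and W: "borel_graphon W"
    and cut: "cut_le (\<lambda>p. U p - W p) c"
  shows "\<bar>hom_density F U - hom_density F W\<bar> \<le> real (card (snd F)) * c"
proof -
  let ?V = "fst F" and ?E = "snd F"
  have fin: "finite ?V" "finite ?E" and edges: "\<And>e. e \<in> ?E \<Longrightarrow> card e = 2 \<and> e \<subseteq> ?V"
  proof -
    show "finite ?V" using F by (simp add: simple_graph_def)
    moreover have "?E \<subseteq> Pow ?V" using F by (auto simp: simple_graph_def)
    ultimately show "finite ?E" by (meson finite_Pow_iff finite_subset)
    show "card e = 2 \<and> e \<subseteq> ?V" if "e \<in> ?E" for e using F that by (auto simp: simple_graph_def)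
  qed
  let ?M = "PiM ?V (\<lambda>_. \<I>)"
  interpret R: prob_space ?M by (rule prob_space_PiM) (rule prob_space_unit_interval)
  define w where "w A e = (if e \<in> A then U else W)" for A :: "'a set set" and e
  have bw: "borel_graphon (w A e)" for A e using U W by (simp add: w_def)
  define h where "h A = (\<integral>x. (\<Prod>e\<in>?E. edge_weight (w A e) x e) \<partial>?M)" for A
  have "\<bar>h A - h {}\<bar> \<le> real (card A) * c" if "finite A" "A \<subseteq> ?E" for A
    using that
  proof (induction A rule: finite_induct)
    case (insert e0 A)
    then have e0: "e0 \<in> ?E" "e0 \<notin> A" by auto
    obtain i j where ij: "e0 = {i, j}" "i \<noteq> j"
      by (rule edge_pairE[OF conjunct1[OF edges[OF e0(1)]]])
    have ijV: "i \<in> ?V" "j \<in> ?V" using edges[OF e0(1)] ij(1) by auto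
    have rng: "x k \<in> {0..1}" if "x \<in> space ?M" "k \<in> ?V" for x k
      using that by (auto simp: space_PiM PiE_iff)
    have int: "integrable ?M (\<lambda>x. \<Prod>e\<in>?E. edge_weight (w B e) x e)" for B
    proof (rule R.integrable_const_bound[of _ 1])
      show "(\<lambda>x. \<Prod>e\<in>?E. edge_weight (w B e) x e) \<in> borel_measurable ?M"
        by (rule measurable_edge_product) (use bw edges in auto)
      show "AE x in ?M. norm (\<Prod>e\<in>?E. edge_weight (w B e) x e) \<le> 1"
      proof (rule AE_I2)
        fix x assume "x \<in> space ?M"
        then have "0 \<le> (\<Prod>e\<in>?E. edge_weight (w B e) x e) \<and> (\<Prod>e\<in>?E. edge_weight (w B e) x e) \<le> 1"
          by (intro edge_product_range[where V = ?V]) (use bw edges rng in auto)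
        then show "norm (\<Prod>e\<in>?E. edge_weight (w B e) x e) \<le> 1" by simp
      qed
    qed
    have fac: "(\<Prod>e\<in>?E. edge_weight (w B e) x e) = edge_weight (w B e0) x e0 * (\<Prod>e\<in>?E - {e0}. edge_weight (w A e) x e)"
      if "B = A \<or> B = insert e0 A" for B x
    proof -
      have "(\<Prod>e\<in>?E. edge_weight (w B e) x e) = edge_weight (w B e0) x e0 * (\<Prod>e\<in>?E - {e0}. edge_weight (w B e) x e)"
        by (rule prod.remove[OF fin(2) e0(1)])
      also have "(\<Prod>e\<in>?E - {e0}. edge_weight (w B e) x e) = (\<Prod>e\<in>?E - {e0}. edge_weight (w A e) x e)"
        by (rule prod.cong) (use that in \<open>auto simp: w_def\<close>)
      finally show ?thesis .
    qed
    have "h (insert e0 A) - h A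
        = (\<integral>x. (\<Prod>e\<in>?E. edge_weight (w (insert e0 A) e) x e) - (\<Prod>e\<in>?E. edge_weight (w A e) x e) \<partial>?M)"
      unfolding h_def by (rule Bochner_Integration.integral_diff[symmetric]) (rule int)+
    also have "\<dots> = (\<integral>x. (\<lambda>p. U p - W p) (x i, x j) * (\<Prod>e\<in>?E - {e0}. edge_weight (w A e) x e) \<partial>?M)"
    proof (rule Bochner_Integration.integral_cong[OF refl])
      fix x
      have "edge_weight (w (insert e0 A) e0) x e0 = U (x i, x j)" "edge_weight (w A e0) x e0 = W (x i, x j)"
        using e0(2) edge_weight_pair[OF borel_graphon_graphon[OF U]] edge_weight_pair[OF borel_graphon_graphon[OF W]]
        by (simp_all add: w_def ij(1))
      then show "(\<Prod>e\<in>?E. edge_weight (w (insert e0 A) e) x e) - (\<Prod>e\<in>?E. edge_weight (w A e) x e)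
          = (\<lambda>p. U p - W p) (x i, x j) * (\<Prod>e\<in>?E - {e0}. edge_weight (w A e) x e)"
        using fac[of "insert e0 A" x] fac[of A x] by (simp add: left_diff_distrib)
    qed
    also have "\<bar>\<dots>\<bar> \<le> c"
      by (rule counting_edge[OF fin(1) ijV ij(2)])
        (use bw edges ij(1) cut in \<open>auto intro: bounded_kernel_diff borel_graphon_bounded U W\<close>)
    finally have "\<bar>h (insert e0 A) - h A\<bar> \<le> c" .
    moreover have "\<bar>h A - h {}\<bar> \<le> real (card A) * c" using insert by auto
    ultimately have "\<bar>h (insert e0 A) - h {}\<bar> \<le> real (card A) * c + c" by linarith
    then show ?case using insert(1,2) by (simp add: algebra_simps)
  qed simp
  from this[OF fin(2) order_refl] have "\<bar>h ?E - h {}\<bar> \<le> real (card ?E) * c" .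
  moreover have "h ?E = hom_density F U"
    unfolding hom_density_borel[OF F U] h_def
    by (intro Bochner_Integration.integral_cong refl prod.cong) (auto simp: w_def)
  moreover have "h {} = hom_density F W"
    unfolding hom_density_borel[OF F W] h_def by (simp add: w_def)
  ultimately show ?thesis by simp
qed

text \<open>Applying \<phi> in every coordinate preserves the product measure.
  \<open>compose\<close> is used so that the result stays extensional on the vertex set.\<close>

lemma hom_density_pullback:
  fixes F :: "'a graph"
  assumes F: "simple_graph F" and W: "borel_graphon W" and \<phi>: "invertible_measure_preserving \<phi>"
  shows "hom_density F (pullback \<phi> W) = hom_density F W"
proof -
  let ?V = "fst F" and ?E = "snd F"
  let ?M = "PiM ?V (\<lambda>_. \<I>)"
  note pW = borel_graphon_pullback[OF \<phi> W]
  have edges: "card e = 2 \<and> e \<subseteq> ?V" if "e \<in> ?E" for e using F that by (auto simp: simple_graph_def)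
  have V: "finite ?V" using F by (simp add: simple_graph_def)
  have distr: "distr ?M ?M (compose ?V \<phi>) = ?M"
    using distr_PiM_finite_prob_space'[OF V, of "\<lambda>_. \<I>" "\<lambda>_. \<I>" \<phi>]
    by (simp add: prob_space_unit_interval ipm_measurable[OF \<phi>] ipm_distr[OF \<phi>])
  have comp: "compose ?V \<phi> \<in> measurable ?M ?M"
    unfolding compose_def
  proof (rule measurable_restrict)
    fix i assume [measurable]: "i \<in> ?V"
    note [measurable] = ipm_measurable[OF \<phi>]
    show "(\<lambda>x. \<phi> (x i)) \<in> measurable ?M \<I>" by measurable
  qed
  have "hom_density F W = (\<integral>x. (\<Prod>e\<in>?E. edge_weight W x e) \<partial>distr ?M ?M (compose ?V \<phi>))"
    by (simp only: hom_density_borel[OF F W] distr)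
  also have "\<dots> = (\<integral>x. (\<Prod>e\<in>?E. edge_weight W (compose ?V \<phi> x) e) \<partial>?M)"
    by (rule integral_distr[OF comp], rule measurable_edge_product) (use edges W in auto)
  also have "\<dots> = (\<integral>x. (\<Prod>e\<in>?E. edge_weight (pullback \<phi> W) x e) \<partial>?M)"
  proof (rule Bochner_Integration.integral_cong[OF refl], rule prod.cong[OF refl])
    fix x e assume x: "x \<in> space ?M" and e: "e \<in> ?E"
    obtain i j where ij: "e = {i, j}"
      by (rule edge_pairE[OF conjunct1[OF edges[OF e]]])
    have "i \<in> ?V" "j \<in> ?V" using edges[OF e] ij by auto
    moreover from this have "(x i, x j) \<in> {0..1} \<times> {0..1}" using x by (auto simp: space_PiM PiE_iff)
    ultimately show "edge_weight W (compose ?V \<phi> x) e = edge_weight (pullback \<phi> W) x e"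
      by (simp add: ij edge_weight_pair[OF borel_graphon_graphon[OF W]]
          edge_weight_pair[OF borel_graphon_graphon[OF pW]] pullback_apply compose_def)
  qed
  finally show ?thesis by (simp add: hom_density_borel[OF F pW])
qed

text \<open>Used to carry null sets of the square back to null sets of the product over all
  vertices: two distinct coordinates are jointly uniform on the square.\<close>

lemma distr_PiM_pair:
  fixes V :: "'a set"
  assumes "finite V" "i \<in> V" "j \<in> V" "i \<noteq> j"
  shows "distr (PiM V (\<lambda>_. \<I>)) \<Q> (\<lambda>x. (x i, x j)) = \<Q>"
proof (rule pair_measure_eqI[OF unit_interval.sigma_finite_measure_axioms
      unit_interval.sigma_finite_measure_axioms, symmetric])
  interpret product_prob_space "\<lambda>_ :: 'a. \<I>" V
    by unfold_locales
  show "sets \<Q> = sets (distr (PiM V (\<lambda>_. \<I>)) \<Q> (\<lambda>x. (x i, x j)))" by simp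
  fix A B assume AB: "A \<in> sets \<I>" "B \<in> sets \<I>"
  have [measurable]: "i \<in> V" "j \<in> V" by fact+
  have m: "(\<lambda>x. (x i, x j)) \<in> measurable (PiM V (\<lambda>_. \<I>)) \<Q>" by measurable
  let ?X = "\<lambda>k. if k = i then A else B"
  have "emeasure (distr (PiM V (\<lambda>_. \<I>)) \<Q> (\<lambda>x. (x i, x j))) (A \<times> B)
      = emeasure (PiM V (\<lambda>_. \<I>)) {x \<in> space (PiM V (\<lambda>_. \<I>)). \<forall>k\<in>{i, j}. x k \<in> ?X k}"
    using AB assms(4) by (subst emeasure_distr[OF m]) (auto intro!: arg_cong2[where f = emeasure])
  also have "\<dots> = (\<Prod>k\<in>{i, j}. emeasure \<I> (?X k))"
    using AB assms by (intro emeasure_PiM_Collect) auto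
  also have "\<dots> = emeasure \<I> A * emeasure \<I> B"
    using assms(4) by simp
  finally show "emeasure \<I> A * emeasure \<I> B = emeasure (distr (PiM V (\<lambda>_. \<I>)) \<Q> (\<lambda>x. (x i, x j))) (A \<times> B)"
    by simp
qed

text \<open>Serves the integrand of \<open>hom_density\<close> for a merely Lebesgue measurable
  graphon, which is compared with the product measurable integrand of its representative.\<close>

lemma measurable_completion_AE:
  fixes f g :: "'a \<Rightarrow> real"
  assumes g: "g \<in> borel_measurable M" and AE: "AE x in M. f x = g x"
  shows "f \<in> borel_measurable (completion M)"
proof (rule measurableI)
  fix A :: "real set" assume A: "A \<in> sets borel"
  have m: "g -` A \<inter> space M \<in> sets (completion M)"
    using measurable_sets[OF g A] by simp
  then have "AE x in completion M. x \<in> g -` A \<inter> space M \<longleftrightarrow> x \<in> f -` A \<inter> space M"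
    using AE_completion[OF AE] by (elim AE_mp) auto
  from completion.in_sets_AE[OF this] m show "f -` A \<inter> space (completion M) \<in> sets (completion M)"
    by simp
qed simp

text \<open>Each of the finitely many edges spoils only a null set of vertex assignments. This
  depends on edges having two distinct ends: a loop would evaluate U on the diagonal, which is
  itself null.\<close>

lemma hom_density_cong_AE:
  fixes F :: "'a graph"
  assumes F: "simple_graph F" and U: "graphon U" and U': "borel_graphon U'"
    and N: "N \<in> null_sets \<Q>" and eq: "\<And>p. p \<in> {0..1} \<times> {0..1} - N \<Longrightarrow> U p = U' p"
  shows "hom_density F U = hom_density F U'"
proof -
  let ?V = "fst F" and ?E = "snd F"
  let ?M = "PiM ?V (\<lambda>_. \<I>)"
  have V: "finite ?V" using F by (simp add: simple_graph_def)
  have edges: "card e = 2 \<and> e \<subseteq> ?V" if "e \<in> ?E" for e using F that by (auto simp: simple_graph_def)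
  have fin: "finite ?E"
  proof -
    have "?E \<subseteq> Pow ?V" using edges by auto
    then show ?thesis using V by (meson finite_Pow_iff finite_subset)
  qed
  have "AE x in ?M. edge_weight U x e = edge_weight U' x e" if e: "e \<in> ?E" for e
  proof -
    obtain i j where ij: "e = {i, j}" "i \<noteq> j"
      by (rule edge_pairE[OF conjunct1[OF edges[OF e]]])
    have ijV[measurable]: "i \<in> ?V" "j \<in> ?V" using edges[OF e] ij by auto
    have m: "(\<lambda>x. (x i, x j)) \<in> measurable ?M \<Q>" by measurable
    have "AE p in distr ?M \<Q> (\<lambda>x. (x i, x j)). p \<notin> N"
      unfolding distr_PiM_pair[OF V ijV ij(2)] by (rule AE_not_in[OF N])
    from AE_distrD[OF m this] AE_space show ?thesis
    proof eventually_elim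
      case (elim x)
      then have "(x i, x j) \<in> {0..1} \<times> {0..1} - N" using ijV by (auto simp: space_PiM PiE_iff)
      then show ?case
        using eq by (simp add: ij(1) edge_weight_pair[OF U] edge_weight_pair[OF borel_graphon_graphon[OF U']])
    qed
  qed
  then have "AE x in ?M. \<forall>e\<in>?E. edge_weight U x e = edge_weight U' x e"
    using fin by (intro eventually_ball_finite) auto
  then have AE: "AE x in ?M. (\<Prod>e\<in>?E. edge_weight U x e) = (\<Prod>e\<in>?E. edge_weight U' x e)"
    by eventually_elim simp
  have m': "(\<lambda>x. \<Prod>e\<in>?E. edge_weight U' x e) \<in> borel_measurable ?M"
    by (rule measurable_edge_product) (use edges U' in auto)
  show ?thesis
    unfolding hom_density_def
    by (rule integral_cong_AE[OF measurable_completion_AE[OF m' AE] measurable_completion[OF m'] AE_completion[OF AE]])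
qed

subsection \<open>Weak regularity and rearrangements\<close>

lemma frieze_kannan:
  assumes U: "bounded_kernel U" "\<And>p. p \<in> {0..1} \<times> {0..1} \<Longrightarrow> \<bar>U p\<bar> \<le> 1"
    and \<epsilon>: "0 < \<epsilon>" "1 < real m * \<epsilon>\<^sup>2"
  obtains a :: "nat \<Rightarrow> real" and S T :: "nat \<Rightarrow> real set"
  where "\<And>i. a i \<in> {- \<epsilon>, 0, \<epsilon>}" "\<And>i. S i \<in> sets \<I>" "\<And>i. T i \<in> sets \<I>"
    "cut_le (\<lambda>p. U p - (\<Sum>i<m. a i * indicator (S i \<times> T i) p)) \<epsilon>"
proof -
  let ?R = "\<lambda>n a S T p. U p - (\<Sum>i<n. a i * indicator (S i \<times> T i) p)"
  have bkR: "bounded_kernel (?R n a S T)" if "\<And>i. S i \<in> sets \<I>" "\<And>i. T i \<in> sets \<I>"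
    for n and a :: "nat \<Rightarrow> real" and S T :: "nat \<Rightarrow> real set"
    by (intro bounded_kernel_diff U(1) bounded_kernel_sum bounded_kernel_cmult bounded_kernel_indicator that finite_lessThan)
  have "\<exists>a S T. (\<forall>i. a i \<in> {- \<epsilon>, 0, \<epsilon>}) \<and> (\<forall>i. S i \<in> sets \<I>) \<and> (\<forall>i. T i \<in> sets \<I>) \<and>
      (cut_le (?R n a S T) \<epsilon> \<or> (\<integral>p. (?R n a S T p)\<^sup>2 \<partial>\<Q>) \<le> 1 - real n * \<epsilon>\<^sup>2)" for n
  proof (induction n)
    case 0
    have "(\<integral>p. (U p)\<^sup>2 \<partial>\<Q>) \<le> 1"
      using unit_square.P.abs_integral_le_const[of "\<lambda>p. (U p)\<^sup>2" 1] U(2) by (auto simp: abs_square_le_1)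
    then show ?case by (intro exI[of _ "\<lambda>_. 0"] exI[of _ "\<lambda>_. {}"]) simp
  next
    case (Suc n)
    then obtain a S T where aST: "\<And>i. a i \<in> {- \<epsilon>, 0, \<epsilon>}" "\<And>i. S i \<in> sets \<I>" "\<And>i. T i \<in> sets \<I>"
      and alt: "cut_le (?R n a S T) \<epsilon> \<or> (\<integral>p. (?R n a S T p)\<^sup>2 \<partial>\<Q>) \<le> 1 - real n * \<epsilon>\<^sup>2" by blast
    show ?case
    proof (cases "cut_le (?R n a S T) \<epsilon>")
      case True
      \<comment> \<open>The bound is already reached; a term with coefficient 0 keeps the number of
        terms at the prescribed value.\<close>
      have "?R (Suc n) (a(n := 0)) S T = ?R n a S T" by simp
      with True aST show ?thesis
        by (intro exI[of _ "a(n := 0)"] exI[of _ S] exI[of _ T]) auto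
    next
      case False
      then obtain S' T' where ST': "S' \<in> sets \<I>" "T' \<in> sets \<I>"
        and large: "\<epsilon> < \<bar>\<integral>p. indicator (S' \<times> T') p * ?R n a S T p \<partial>\<Q>\<bar>"
        unfolding cut_le_def by (auto simp: not_le)
      define R where "R = ?R n a S T"
      define J where "J = (indicator (S' \<times> T') :: real \<times> real \<Rightarrow> real)"
      define s where "s = (\<integral>p. J p * R p \<partial>\<Q>)"
      define b where "b = (if 0 < s then \<epsilon> else - \<epsilon>)"
      have larges: "\<epsilon> < \<bar>s\<bar>" using large by (simp only: s_def R_def J_def)
      have bs: "\<epsilon>\<^sup>2 \<le> b * s" "b\<^sup>2 = \<epsilon>\<^sup>2"
      proof -
        have "b * s = \<epsilon> * \<bar>s\<bar>" by (simp add: b_def)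
        then show "\<epsilon>\<^sup>2 \<le> b * s"
          using larges \<epsilon>(1) by (simp add: power2_eq_square)
        show "b\<^sup>2 = \<epsilon>\<^sup>2" by (simp add: b_def)
      qed
      have bk: "bounded_kernel R" "bounded_kernel J"
        unfolding R_def J_def by (intro bkR aST bounded_kernel_indicator ST')+
      note int = bounded_kernel_integrable[OF bounded_kernel_mult]
      have JJ: "J p * J p = J p" for p by (simp add: J_def indicator_def)
      have "(\<integral>p. (R p - b * J p)\<^sup>2 \<partial>\<Q>) = (\<integral>p. R p * R p + (- 2 * b * (J p * R p) + b\<^sup>2 * J p) \<partial>\<Q>)"
      proof (rule Bochner_Integration.integral_cong[OF refl])
        fix p
        have "(R p - b * J p)\<^sup>2 = R p * R p + (- 2 * b * (J p * R p) + b\<^sup>2 * (J p * J p))"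
          by (simp add: power2_eq_square algebra_simps)
        then show "(R p - b * J p)\<^sup>2 = R p * R p + (- 2 * b * (J p * R p) + b\<^sup>2 * J p)"
          by (simp only: JJ)
      qed
      also have "\<dots> = (\<integral>p. R p * R p \<partial>\<Q>) + (- 2 * b * s + b\<^sup>2 * (\<integral>p. J p \<partial>\<Q>))"
        unfolding s_def using int[OF bk(1,1)] int[OF bk(2,1)] bounded_kernel_integrable[OF bk(2)] by simp
      also have "(\<integral>p. J p \<partial>\<Q>) \<le> 1"
        using unit_square.P.abs_integral_le_const[of J 1] by (auto simp: J_def)
      finally have "(\<integral>p. (R p - b * J p)\<^sup>2 \<partial>\<Q>) \<le> (\<integral>p. R p * R p \<partial>\<Q>) - \<epsilon>\<^sup>2"
        using bs \<epsilon>(1) by (simp add: mult_left_mono)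
      moreover have "(\<integral>p. R p * R p \<partial>\<Q>) \<le> 1 - real n * \<epsilon>\<^sup>2"
        using alt False by (simp add: R_def power2_eq_square)
      moreover have "(\<integral>p. (?R (Suc n) (a(n := b)) (S(n := S')) (T(n := T')) p)\<^sup>2 \<partial>\<Q>)
          = (\<integral>p. (R p - b * J p)\<^sup>2 \<partial>\<Q>)"
        by (rule Bochner_Integration.integral_cong[OF refl]) (simp add: R_def J_def algebra_simps)
      moreover have "1 - real (Suc n) * \<epsilon>\<^sup>2 = 1 - real n * \<epsilon>\<^sup>2 - \<epsilon>\<^sup>2"
        by (simp add: algebra_simps)
      ultimately have "(\<integral>p. (?R (Suc n) (a(n := b)) (S(n := S')) (T(n := T')) p)\<^sup>2 \<partial>\<Q>) \<le> 1 - real (Suc n) * \<epsilon>\<^sup>2"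
        by linarith
      then show ?thesis using aST ST'
        by (intro exI[of _ "a(n := b)"] exI[of _ "S(n := S')"] exI[of _ "T(n := T')"]) (auto simp: b_def)
    qed
  qed
  from this[of m] obtain a S T where aST: "\<And>i. a i \<in> {- \<epsilon>, 0, \<epsilon>}" "\<And>i. S i \<in> sets \<I>" "\<And>i. T i \<in> sets \<I>"
    and alt: "cut_le (?R m a S T) \<epsilon> \<or> (\<integral>p. (?R m a S T p)\<^sup>2 \<partial>\<Q>) \<le> 1 - real m * \<epsilon>\<^sup>2" by blast
  have "0 \<le> (\<integral>p. (?R m a S T p)\<^sup>2 \<partial>\<Q>)" by simp
  with alt \<epsilon>(2) have "cut_le (?R m a S T) \<epsilon>" by linarith
  with that aST show thesis by blast
qed

section \<open>Grid sets and bijections that permute grid cells\<close>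

definition grid_set :: "nat \<Rightarrow> nat set \<Rightarrow> real set" where
  "grid_set N A = {x \<in> {0..<1}. nat \<lfloor>real N * x\<rfloor> \<in> A}"

lemma sets_unit_interval_borel: "A \<in> sets borel \<Longrightarrow> A \<subseteq> {0..1} \<Longrightarrow> A \<in> sets \<I>"
  by (auto simp: sets_restrict_space intro!: image_eqI[of _ _ A])

lemma measure_unit_interval: "A \<subseteq> {0..1} \<Longrightarrow> measure \<I> A = measure lebesgue A"
  by (rule measure_restrict_space) auto

lemma grid_set_borel [measurable]: "grid_set N A \<in> sets borel"
proof -
  have "{x. nat \<lfloor>real N * x\<rfloor> \<in> A} \<in> sets borel" by measurable
  moreover have "grid_set N A = {0..<1} \<inter> {x. nat \<lfloor>real N * x\<rfloor> \<in> A}" by (auto simp: grid_set_def)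
  ultimately show ?thesis by simp
qed

lemma grid_set_measurable [measurable]: "grid_set N A \<in> sets \<I>"
  by (rule sets_unit_interval_borel[OF grid_set_borel]) (auto simp: grid_set_def)

lemma floor_grid:
  assumes "0 \<le> x"
  shows "real (nat \<lfloor>real N * x\<rfloor>) \<le> real N * x" "real N * x < real (nat \<lfloor>real N * x\<rfloor>) + 1"
proof -
  have "real (nat \<lfloor>real N * x\<rfloor>) = of_int \<lfloor>real N * x\<rfloor>" using assms by simp
  then show "real (nat \<lfloor>real N * x\<rfloor>) \<le> real N * x" "real N * x < real (nat \<lfloor>real N * x\<rfloor>) + 1"
    by linarith+
qed

lemma floor_gridI:
  assumes "real j \<le> y" "y < real j + 1"
  shows "nat \<lfloor>y\<rfloor> = j"
proof -
  have "\<lfloor>y\<rfloor> = int j" using assms by linarith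
  then show ?thesis by simp
qed

text \<open>Squeeze S between a compact K and an open U, each up to \<eta>/2, where K is the part of
  the unit interval outside an open V covering the complement of S. Points of K have distance at
  least d from the complement of U, so once 1/N < d every cell meeting K lies in U. The union of
  these cells errs only inside U - S, inside \<open>V \<inter> S\<close>, and possibly at the point
  1, which belongs to no cell. The conclusion covers all large N so that several sets can share one
  grid.\<close>

lemma grid_approximation:
  assumes S: "S \<in> sets \<I>" and \<eta>: "0 < \<eta>"
  obtains N0 where "\<And>N. N0 \<le> N \<Longrightarrow> \<exists>A\<subseteq>{..<N}. measure \<I> (sym_diff S (grid_set N A)) \<le> \<eta>"
proof -
  have S': "S \<in> sets lebesgue" "S \<subseteq> {0..1}" using S by (auto simp: sets_restrict_space)
  obtain U where U: "open U" "S \<subseteq> U" "U - S \<in> lmeasurable" "emeasure lebesgue (U - S) < ennreal (\<eta> / 2)"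
    using sets_lebesgue_outer_open[OF S'(1), of "\<eta> / 2"] \<eta> by auto
  have cS: "- S \<in> sets lebesgue"
    using sets.compl_sets[OF S'(1)] by (simp add: Compl_eq_Diff_UNIV)
  obtain V where V: "open V" "- S \<subseteq> V" "V - (- S) \<in> lmeasurable" "emeasure lebesgue (V - (- S)) < ennreal (\<eta> / 2)"
    using sets_lebesgue_outer_open[OF cS, of "\<eta> / 2"] \<eta> by (metis half_gt_zero)
  have mU: "measure lebesgue (U - S) \<le> \<eta> / 2" "measure lebesgue (V \<inter> S) \<le> \<eta> / 2"
    using U(3,4) V(3,4) \<eta> by (auto simp: emeasure_eq_measure2 ennreal_less_iff Diff_eq)
  define K where "K = - V \<inter> {0..1}"
  have K: "compact K" "K \<subseteq> S" "S - V \<subseteq> K"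
    using V(1,2) S'(2) by (auto simp: K_def intro!: closed_Int_compact)
  obtain d where d: "0 < d" "(\<Union>x\<in>K. ball x d) \<subseteq> U"
    using compact_subset_open_imp_ball_epsilon_subset[OF K(1) U(1)] K(2) U(2) by blast
  obtain N0 :: nat where N0: "1 / d < real N0" using reals_Archimedean2 by blast
  show thesis
  proof (rule that[of N0])
    fix N assume N: "N0 \<le> N"
    have N1: "1 / d < real N" using N N0 by linarith
    then have Npos: "0 < real N" using d(1) by (meson divide_pos_pos less_trans zero_less_one)
    have Nd: "1 / real N < d" using N1 Npos d(1) by (simp add: field_simps)
    define A where "A = (\<lambda>x. nat \<lfloor>real N * x\<rfloor>) ` (K \<inter> {0..<1})"
    have "A \<subseteq> {..<N}"
    proof
      fix j assume "j \<in> A"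
      then obtain x where x: "j = nat \<lfloor>real N * x\<rfloor>" "0 \<le> x" "x < 1" by (auto simp: A_def)
      have "real N * x < real N" using x Npos by simp
      then have "real j < real N" using floor_grid(1)[OF x(2), of N] x(1) by linarith
      then show "j \<in> {..<N}" by simp
    qed
    have GU: "grid_set N A \<subseteq> U"
    proof
      fix y assume "y \<in> grid_set N A"
      then obtain x where x: "x \<in> K" "0 \<le> x" "nat \<lfloor>real N * y\<rfloor> = nat \<lfloor>real N * x\<rfloor>" "0 \<le> y"
        by (auto simp: grid_set_def A_def)
      have "\<bar>real N * x - real N * y\<bar> < 1"
        using floor_grid[OF x(2), of N] floor_grid[OF x(4), of N] x(3) by linarith
      moreover have "\<bar>real N * x - real N * y\<bar> = real N * \<bar>x - y\<bar>"
        by (metis abs_mult abs_of_nat right_diff_distrib')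
      ultimately have "\<bar>x - y\<bar> < 1 / real N"
        using Npos by (simp add: field_simps)
      then have "y \<in> ball x d" using Nd by (simp add: dist_real_def)
      then show "y \<in> U" using d(2) x(1) by blast
    qed
    have SG: "S - grid_set N A \<subseteq> (V \<inter> S) \<union> {1}"
    proof
      fix x assume x: "x \<in> S - grid_set N A"
      show "x \<in> (V \<inter> S) \<union> {1}"
      proof (rule ccontr)
        assume "x \<notin> (V \<inter> S) \<union> {1}"
        then have xK: "x \<in> K \<inter> {0..<1}" using x K(3) S'(2) by (fastforce simp: subset_iff)
        then have "nat \<lfloor>real N * x\<rfloor> \<in> A" unfolding A_def by (rule imageI)
        with x xK show False by (auto simp: grid_set_def)
      qed
    qed
    have sub: "sym_diff S (grid_set N A) \<subseteq> ((U - S) \<union> (V \<inter> S)) \<union> {1}"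
      using GU SG by auto
    have VS: "V \<inter> S \<in> lmeasurable" using V(3) by (simp add: Diff_eq)
    have m: "sym_diff S (grid_set N A) \<subseteq> {0..1}" using S'(2) by (auto simp: grid_set_def)
    have "measure \<I> (sym_diff S (grid_set N A)) = measure lebesgue (sym_diff S (grid_set N A))"
      by (rule measure_unit_interval[OF m])
    also have "\<dots> \<le> measure lebesgue (((U - S) \<union> (V \<inter> S)) \<union> {1})"
    proof (rule measure_mono_fmeasurable[OF sub])
      have "grid_set N A \<in> sets lebesgue" by simp
      then show "sym_diff S (grid_set N A) \<in> sets lebesgue"
        by (intro sets.Un sets.Diff S'(1))
      show "U - S \<union> V \<inter> S \<union> {1} \<in> lmeasurable"
        by (intro fmeasurable.Un U(3) VS lmeasurable_compact) simp
    qed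
    also have "\<dots> \<le> measure lebesgue ((U - S) \<union> (V \<inter> S)) + measure lebesgue {1 :: real}"
      by (intro measure_Un_le fmeasurableD fmeasurable.Un U(3) VS lmeasurable_compact) simp
    also have "measure lebesgue ((U - S) \<union> (V \<inter> S)) \<le> measure lebesgue (U - S) + measure lebesgue (V \<inter> S)"
      by (intro measure_Un_le fmeasurableD U(3) VS)
    finally have "measure \<I> (sym_diff S (grid_set N A)) \<le> \<eta>" using mU by simp
    with \<open>A \<subseteq> {..<N}\<close> show "\<exists>A\<subseteq>{..<N}. measure \<I> (sym_diff S (grid_set N A)) \<le> \<eta>" by blast
  qed
qed

text \<open>Translates the half-open cell with index j onto the cell with index \<sigma> j. The
  point 1 has index N, which a permutation of \<open>{..<N}\<close> fixes, so it stays in place and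
  the map is a bijection of the closed interval.\<close>

definition cell_permutation :: "nat \<Rightarrow> (nat \<Rightarrow> nat) \<Rightarrow> real \<Rightarrow> real" where
  "cell_permutation N \<sigma> x = (real (\<sigma> (nat \<lfloor>real N * x\<rfloor>)) - real (nat \<lfloor>real N * x\<rfloor>)) / real N + x"

lemma cell_permutation:
  assumes "0 < N" "\<sigma> permutes {..<N}" "x \<in> {0..1}"
  shows "nat \<lfloor>real N * cell_permutation N \<sigma> x\<rfloor> = \<sigma> (nat \<lfloor>real N * x\<rfloor>)"
    and "cell_permutation N \<sigma> x \<in> {0..1}"
    and "x < 1 \<Longrightarrow> cell_permutation N \<sigma> x < 1"
proof -
  let ?j = "nat \<lfloor>real N * x\<rfloor>"
  let ?y = "cell_permutation N \<sigma> x"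
  have x: "0 \<le> x" "x \<le> 1" using assms(3) by auto
  have eq: "real N * ?y = real N * x - real ?j + real (\<sigma> ?j)"
    using assms(1) by (simp add: cell_permutation_def field_simps)
  have b: "real (\<sigma> ?j) \<le> real N * ?y" "real N * ?y < real (\<sigma> ?j) + 1"
    using floor_grid[OF x(1), of N] eq by linarith+
  then show "nat \<lfloor>real N * ?y\<rfloor> = \<sigma> ?j" by (rule floor_gridI)
  have lt: "?y < 1" if "x < 1"
  proof -
    have "real N * x < real N" using that assms(1) by simp
    then have "?j < N" using floor_grid(1)[OF x(1), of N] by linarith
    then have "\<sigma> ?j < N" using permutes_in_image[OF assms(2)] by auto
    then have "real (\<sigma> ?j) + 1 \<le> real N" by linarith
    then have "real N * ?y < real N * 1" using b by linarith
    then show ?thesis using assms(1) by (simp only: mult_less_cancel_left_pos of_nat_0_less_iff)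
  qed
  then show "x < 1 \<Longrightarrow> ?y < 1" .
  have "0 \<le> real N * ?y" using b(1) by linarith
  then have "0 \<le> ?y" using assms(1) by (simp add: zero_le_mult_iff)
  moreover have "?y \<le> 1"
  proof (cases "x < 1")
    case False
    then have "x = 1" using x by simp
    then show ?thesis using permutes_not_in[OF assms(2), of N] by (simp add: cell_permutation_def)
  qed (use lt in simp)
  ultimately show "?y \<in> {0..1}" by simp
qed

lemma cell_permutation_inv:
  assumes "0 < N" "\<sigma> permutes {..<N}" "x \<in> {0..1}"
  shows "cell_permutation N (inv \<sigma>) (cell_permutation N \<sigma> x) = x"
proof -
  have "cell_permutation N (inv \<sigma>) (cell_permutation N \<sigma> x)
      = (real (nat \<lfloor>real N * x\<rfloor>) - real (\<sigma> (nat \<lfloor>real N * x\<rfloor>))) / real N + cell_permutation N \<sigma> x"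
    unfolding cell_permutation_def[of N "inv \<sigma>"] cell_permutation(1)[OF assms]
    by (simp add: permutes_inverses(2)[OF assms(2)])
  then show ?thesis by (simp add: cell_permutation_def diff_divide_distrib)
qed

text \<open>A is cut into its pieces in the single cells. On each piece the map is a translation, so
  measure is preserved piecewise, and injectivity keeps the images disjoint.\<close>

lemma cell_permutation_image:
  assumes N: "0 < N" and \<sigma>: "\<sigma> permutes {..<N}" and A: "A \<in> sets \<I>"
  shows "cell_permutation N \<sigma> ` A \<in> sets \<I>"
    and "emeasure \<I> (cell_permutation N \<sigma> ` A) = emeasure \<I> A"
proof -
  let ?\<phi> = "cell_permutation N \<sigma>"
  have A': "A \<in> sets lebesgue" "A \<subseteq> {0..1}" using A by (auto simp: sets_restrict_space)
  define J where "J j = A \<inter> {x. nat \<lfloor>real N * x\<rfloor> = j}" for j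
  have J: "J j \<in> sets lebesgue" for j
  proof -
    have "{x :: real. nat \<lfloor>real N * x\<rfloor> = j} \<in> sets borel" by measurable
    then show ?thesis unfolding J_def using A'(1) by (intro sets.Int) auto
  qed
  define \<delta> where "\<delta> j = (real (\<sigma> j) - real j) / real N" for j
  have img: "?\<phi> ` J j = (+) (\<delta> j) ` J j" for j
    by (rule image_cong) (auto simp: J_def cell_permutation_def \<delta>_def)
  have imgJ: "?\<phi> ` J j \<in> sets lebesgue" for j
    unfolding img by (rule lebesgue_sets_translation[OF J])
  have eimgJ: "emeasure lebesgue (?\<phi> ` J j) = emeasure lebesgue (J j)" for j
    unfolding img using emeasure_lebesgue_affine[of 1 "\<delta> j" "J j"] by (simp add: image_def add.commute)
  \<comment> \<open>The index N is included for the point 1.\<close>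
  have "A = (\<Union>j\<le>N. J j)"
  proof -
    have "nat \<lfloor>real N * x\<rfloor> \<le> N" if "x \<in> A" for x
    proof -
      have "real N * x \<le> real N" "0 \<le> x" using that A'(2) N by (auto simp: subset_iff)
      then show ?thesis by linarith
    qed
    then show ?thesis by (auto simp: J_def)
  qed
  then have \<phi>A: "?\<phi> ` A = (\<Union>j\<le>N. ?\<phi> ` J j)" by auto
  have inj: "inj_on ?\<phi> {0..1}"
    by (rule inj_on_inverseI[of _ "cell_permutation N (inv \<sigma>)"]) (rule cell_permutation_inv[OF N \<sigma>])
  have disj: "disjoint_family_on J {..N}" by (auto simp: disjoint_family_on_def J_def)
  have disj': "disjoint_family_on (\<lambda>j. ?\<phi> ` J j) {..N}"
    unfolding disjoint_family_on_def
  proof (intro ballI impI)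
    fix m n :: nat assume "m \<noteq> n"
    have "?\<phi> ` J m \<inter> ?\<phi> ` J n = ?\<phi> ` (J m \<inter> J n)"
      using A'(2) by (intro inj_on_image_Int[OF inj, symmetric]) (auto simp: J_def)
    also have "J m \<inter> J n = {}" using \<open>m \<noteq> n\<close> by (auto simp: J_def)
    finally show "?\<phi> ` J m \<inter> ?\<phi> ` J n = {}" by simp
  qed
  have sets: "?\<phi> ` A \<in> sets lebesgue" unfolding \<phi>A using imgJ by auto
  have sub: "?\<phi> ` A \<subseteq> {0..1}" using cell_permutation(2)[OF N \<sigma>] A'(2) by blast
  show "?\<phi> ` A \<in> sets \<I>" using sets sub by (auto simp: sets_restrict_space intro!: image_eqI[of _ _ "?\<phi> ` A"])
  have "emeasure lebesgue (?\<phi> ` A) = (\<Sum>j\<le>N. emeasure lebesgue (?\<phi> ` J j))"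
    unfolding \<phi>A by (rule sum_emeasure[OF _ disj', symmetric]) (use imgJ in auto)
  also have "\<dots> = (\<Sum>j\<le>N. emeasure lebesgue (J j))" by (simp only: eimgJ)
  also have "\<dots> = emeasure lebesgue (\<Union>j\<le>N. J j)"
    by (rule sum_emeasure[OF _ disj]) (use J in auto)
  finally have "emeasure lebesgue (?\<phi> ` A) = emeasure lebesgue A" using \<open>A = _\<close> by metis
  then show "emeasure \<I> (?\<phi> ` A) = emeasure \<I> A"
    using A'(2) sub by (simp add: emeasure_restrict_space)
qed

lemma cell_permutation_vimage:
  assumes "0 < N" "\<sigma> permutes {..<N}" "A \<subseteq> {0..1}"
  shows "cell_permutation N \<sigma> -` A \<inter> {0..1} = cell_permutation N (inv \<sigma>) ` A"
proof -
  note inv = permutes_inv[OF assms(2)]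
  have "cell_permutation N \<sigma> (cell_permutation N (inv \<sigma>) x) = x" if "x \<in> {0..1}" for x
    using cell_permutation_inv[OF assms(1) inv that] by (simp add: permutes_inv_inv[OF assms(2)])
  then show ?thesis
    using cell_permutation_inv[OF assms(1,2)] cell_permutation(2)[OF assms(1) inv] assms(3)
    by (auto simp: image_iff subset_iff) (metis atLeastAtMost_iff)
qed

lemma cell_permutation_measurable:
  assumes "0 < N" "\<sigma> permutes {..<N}"
  shows "cell_permutation N \<sigma> \<in> measurable \<I> \<I>"
proof (rule measurableI)
  show "cell_permutation N \<sigma> x \<in> space \<I>" if "x \<in> space \<I>" for x
    using that cell_permutation(2)[OF assms] by simp
  fix A assume A: "A \<in> sets \<I>"
  then have "A \<subseteq> {0..1}" by (auto simp: sets_restrict_space)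
  then show "cell_permutation N \<sigma> -` A \<inter> space \<I> \<in> sets \<I>"
    using cell_permutation_image(1)[OF assms(1) permutes_inv[OF assms(2)] A]
      cell_permutation_vimage[OF assms] by simp
qed

lemma ipm_cell_permutation:
  assumes "0 < N" "\<sigma> permutes {..<N}"
  shows "invertible_measure_preserving (cell_permutation N \<sigma>)"
proof (rule ipmI(1)[where \<psi> = "cell_permutation N (inv \<sigma>)"])
  note inv = permutes_inv[OF assms(2)]
  show "cell_permutation N \<sigma> \<in> measurable \<I> \<I>" "cell_permutation N (inv \<sigma>) \<in> measurable \<I> \<I>"
    using cell_permutation_measurable assms inv by auto
  show "cell_permutation N (inv \<sigma>) (cell_permutation N \<sigma> x) = x"
    "cell_permutation N \<sigma> (cell_permutation N (inv \<sigma>) x) = x" if "x \<in> {0..1}" for x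
    using cell_permutation_inv[OF assms that] cell_permutation_inv[OF assms(1) inv that]
    by (simp_all add: permutes_inv_inv[OF assms(2)])
  show "distr \<I> \<I> (cell_permutation N \<sigma>) = \<I>"
  proof (rule measure_eqI)
    fix A assume "A \<in> sets (distr \<I> \<I> (cell_permutation N \<sigma>))"
    then have A: "A \<in> sets \<I>" by simp
    then have "A \<subseteq> {0..1}" by (auto simp: sets_restrict_space)
    then have "emeasure (distr \<I> \<I> (cell_permutation N \<sigma>)) A = emeasure \<I> (cell_permutation N (inv \<sigma>) ` A)"
      using cell_permutation_vimage[OF assms] A cell_permutation_measurable[OF assms]
      by (simp add: emeasure_distr)
    then show "emeasure (distr \<I> \<I> (cell_permutation N \<sigma>)) A = emeasure \<I> A"
      using cell_permutation_image(2)[OF assms(1) inv A] by simp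
  qed simp
qed

subsection \<open>Completeness with respect to the cut norm\<close>

lemma sets_unit_square_generator:
  "sets \<Q> = sigma_sets ({0..1} \<times> {0..1}) {a \<times> b |a b. a \<in> sets \<I> \<and> b \<in> sets \<I>}"
  by (simp add: sets_pair_measure)

text \<open>Dominated exchange of limit and series. It is needed twice below: for convergence of the
  integrals over disjoint unions, and for countable additivity of their limit.\<close>

lemma tannery_sums:
  fixes a :: "nat \<Rightarrow> nat \<Rightarrow> real"
  assumes "\<And>i. (\<lambda>n. a i n) \<longlonglongrightarrow> b i" "\<And>i n. \<bar>a i n\<bar> \<le> m i" "summable m"
  shows "(\<lambda>n. \<Sum>i. a i n) \<longlonglongrightarrow> (\<Sum>i. b i)" "summable b"
proof -
  have "(\<forall>\<^sub>F n in sequentially. summable (\<lambda>k. norm (a k n))) \<and> summable (\<lambda>n. norm (b n)) \<and>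
      (\<lambda>n. \<Sum>k. a k n) \<longlonglongrightarrow> suminf b"
    by (rule tannerys_theorem[where M = m]) (use assms in \<open>auto intro!: always_eventually\<close>)
  then show "(\<lambda>n. \<Sum>i. a i n) \<longlonglongrightarrow> (\<Sum>i. b i)" "summable b"
    by (auto intro: summable_norm_cancel)
qed

text \<open>The Cauchy condition controls rectangles only. The sets on which the integrals \<nu> n
  converge form a Dynkin class: complements are subtractions, and disjoint unions are handled by
  Tannery, since the values of V lie in [0,1] and therefore \<open>\<nu> n (A i)\<close> is at most
  the measure of \<open>A i\<close>. Thus the limit L exists on all of \<open>\<Q>\<close> and, by
  the same domination, is a measure below \<open>\<Q>\<close>, which yields a density. The bounds
  \<open>b k\<close> survive because each is a limit of inequalities on one rectangle.\<close>

lemma cut_limit_exists: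
  assumes V: "\<And>n. borel_graphon (V n)"
    and cauchy: "\<And>k l. k \<le> l \<Longrightarrow> cut_le (\<lambda>p. V k p - V l p) (b k)" and b: "b \<longlonglongrightarrow> 0"
  obtains W where "borel_graphon W" "\<And>k. cut_le (\<lambda>p. V k p - W p) (b k)"
proof -
  note V01 = graphon_range[OF borel_graphon_graphon[OF V]]
  have Vm: "V n \<in> borel_measurable \<Q>" for n using V by (simp add: borel_graphon_def)
  have int: "integrable \<Q> (\<lambda>p. indicator A p * V n p)" if "A \<in> sets \<Q>" for A n
    by (rule unit_square.P.integrable_const_bound[of _ 1])
      (use that Vm V01 in \<open>auto intro!: AE_I2 simp: indicator_def\<close>)
  define \<nu> where "\<nu> n A = (\<integral>p. indicator A p * V n p \<partial>\<Q>)" for n A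
  have \<nu>_nonneg: "0 \<le> \<nu> n A" for n A
    unfolding \<nu>_def by (rule integral_nonneg_AE) (use V01 in \<open>auto intro!: AE_I2 simp: indicator_def\<close>)
  have \<nu>_le: "\<nu> n A \<le> measure \<Q> A" if "A \<in> sets \<Q>" for n A
  proof -
    have "\<nu> n A \<le> (\<integral>p. indicator A p \<partial>\<Q>)"
      unfolding \<nu>_def
    proof (rule integral_mono[OF int[OF that]])
      show "integrable \<Q> (indicat_real A)"
        using that by (intro integrable_real_indicator) (auto simp: unit_square.P.emeasure_eq_measure)
    qed (use V01 in \<open>auto simp: indicator_def\<close>)
    also have "\<dots> = measure \<Q> A" using that sets.sets_into_space[OF that] by (simp add: Int_absorb2)
    finally show ?thesis .
  qed
  have \<nu>_union: "(\<lambda>i. \<nu> n (A i)) sums \<nu> n (\<Union>i. A i)"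
    if A: "range A \<subseteq> sets \<Q>" "disjoint_family A" for n A
  proof -
    have meas: "\<And>i. A i \<in> sets \<Q>" using A(1) by auto
    have si: "set_integrable \<Q> (\<Union>i. A i) (V n)"
      using int[of "\<Union>i. A i"] meas by (simp add: set_integrable_def)
    have "(LINT p:(\<Union>i. A i)|\<Q>. V n p) = (\<Sum>i. (LINT p:A i|\<Q>. V n p))"
      by (rule lebesgue_integral_countable_add) (use meas A(2) si in \<open>auto simp: disjoint_family_on_def\<close>)
    moreover have "summable (\<lambda>i. \<nu> n (A i))"
    proof (rule summable_comparison_test')
      show "summable (\<lambda>i. measure \<Q> (A i))"
        using unit_square.P.finite_measure_UNION[OF A] by (rule sums_summable)
      show "norm (\<nu> n (A i)) \<le> measure \<Q> (A i)" if "0 \<le> i" for i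
        using \<nu>_nonneg \<nu>_le[OF meas] by simp
    qed
    ultimately show ?thesis
      by (simp add: \<nu>_def set_lebesgue_integral_def sums_iff)
  qed
  have conv_rect: "convergent (\<lambda>n. \<nu> n (S \<times> T))" if ST: "S \<in> sets \<I>" "T \<in> sets \<I>" for S T
  proof (rule Cauchy_convergent, rule metric_CauchyI)
    fix e :: real assume "0 < e"
    then have "\<forall>\<^sub>F n in sequentially. b n < e / 2" using b by (intro order_tendstoD(2)) auto
    then obtain k where k: "b k < e / 2" by (auto simp: eventually_sequentially)
    have close: "\<bar>\<nu> k (S \<times> T) - \<nu> n (S \<times> T)\<bar> \<le> b k" if "k \<le> n" for n
    proof -
      have "\<nu> k (S \<times> T) - \<nu> n (S \<times> T) = (\<integral>p. indicator (S \<times> T) p * (V k p - V n p) \<partial>\<Q>)"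
        unfolding \<nu>_def using ST
        by (subst Bochner_Integration.integral_diff[symmetric]) (auto intro!: int simp: right_diff_distrib)
      then show ?thesis using cut_leD[OF cauchy[OF that] ST] by simp
    qed
    show "\<exists>M. \<forall>m\<ge>M. \<forall>n\<ge>M. dist (\<nu> m (S \<times> T)) (\<nu> n (S \<times> T)) < e"
    proof (intro exI[of _ k] allI impI)
      fix m n assume "k \<le> m" "k \<le> n"
      then show "dist (\<nu> m (S \<times> T)) (\<nu> n (S \<times> T)) < e"
        using close[of m] close[of n] k by (simp add: dist_real_def abs_le_iff abs_less_iff)
    qed
  qed
  have closed: "{a \<times> b |a b. a \<in> sets \<I> \<and> b \<in> sets \<I>} \<subseteq> Pow ({0..1} \<times> {0..1})"
    using pair_measure_closed[of \<I> \<I>] by simp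
  \<comment> \<open>Rectangles generate \<open>\<Q>\<close> and are closed under intersection, so it
    is enough to pass through complements and disjoint countable unions.\<close>
  have conv: "convergent (\<lambda>n. \<nu> n A)" if "A \<in> sets \<Q>" for A
    using Int_stable_pair_measure_generator[of \<I> \<I>] closed that[unfolded sets_unit_square_generator]
  proof (induction rule: sigma_sets_induct_disjoint)
    case (basic A)
    then show ?case using conv_rect by auto
  next
    case empty
    then show ?case by (simp add: \<nu>_def convergent_const)
  next
    case (compl A)
    then have A: "A \<in> sets \<Q>" by (simp add: sets_unit_square_generator)
    have "\<nu> n ({0..1} \<times> {0..1} - A) = \<nu> n ({0..1} \<times> {0..1}) - \<nu> n A" for n
    proof -
      have "\<nu> n ({0..1} \<times> {0..1}) - \<nu> n A = (\<integral>p. indicator ({0..1} \<times> {0..1}) p * V n p - indicator A p * V n p \<partial>\<Q>)"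
        unfolding \<nu>_def by (rule Bochner_Integration.integral_diff[symmetric]) (use A in \<open>auto intro!: int\<close>)
      also have "\<dots> = \<nu> n ({0..1} \<times> {0..1} - A)"
        unfolding \<nu>_def
        by (rule Bochner_Integration.integral_cong) (auto simp: indicator_def)
      finally show ?thesis by simp
    qed
    moreover have "convergent (\<lambda>n. \<nu> n ({0..1} \<times> {0..1}))" by (rule conv_rect) auto
    ultimately show ?case using compl(2) by (simp add: convergent_diff)
  next
    case (union A)
    then have A: "range A \<subseteq> sets \<Q>" "disjoint_family A" by (auto simp: sets_unit_square_generator)
    have "(\<lambda>n. \<Sum>i. \<nu> n (A i)) \<longlonglongrightarrow> (\<Sum>i. lim (\<lambda>n. \<nu> n (A i)))"
    proof (rule tannery_sums(1)[where m = "\<lambda>i. measure \<Q> (A i)"])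
      show "(\<lambda>n. \<nu> n (A i)) \<longlonglongrightarrow> lim (\<lambda>n. \<nu> n (A i))" for i
        using union(3) by (simp add: convergent_LIMSEQ_iff)
      show "\<bar>\<nu> n (A i)\<bar> \<le> measure \<Q> (A i)" for i n
        using \<nu>_nonneg \<nu>_le[of "A i"] A(1) by (simp add: range_subsetD)
      show "summable (\<lambda>i. measure \<Q> (A i))"
        using unit_square.P.finite_measure_UNION[OF A] by (rule sums_summable)
    qed
    then show ?case using \<nu>_union[OF A] by (auto simp: sums_iff convergent_def)
  qed
  define L where "L A = lim (\<lambda>n. \<nu> n A)" for A
  have L: "(\<lambda>n. \<nu> n A) \<longlonglongrightarrow> L A" if "A \<in> sets \<Q>" for A
    using conv[OF that] by (simp add: L_def convergent_LIMSEQ_iff)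
  have L_nonneg: "0 \<le> L A" if "A \<in> sets \<Q>" for A
    by (rule LIMSEQ_le_const[OF L[OF that]]) (use \<nu>_nonneg in auto)
  have L_le: "L A \<le> measure \<Q> A" if "A \<in> sets \<Q>" for A
    by (rule LIMSEQ_le_const2[OF L[OF that]]) (use \<nu>_le[OF that] in auto)
  have L_union: "(\<lambda>i. L (A i)) sums L (\<Union>i. A i)" if A: "range A \<subseteq> sets \<Q>" "disjoint_family A" for A
  proof -
    have "(\<lambda>n. \<Sum>i. \<nu> n (A i)) \<longlonglongrightarrow> (\<Sum>i. L (A i))" "summable (\<lambda>i. L (A i))"
    proof (rule tannery_sums[where m = "\<lambda>i. measure \<Q> (A i)" and a = "\<lambda>i n. \<nu> n (A i)"])
      show *: "(\<lambda>n. \<nu> n (A i)) \<longlonglongrightarrow> L (A i)" for i using L A(1) by auto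
      show **: "\<bar>\<nu> n (A i)\<bar> \<le> measure \<Q> (A i)" for i n
        using \<nu>_nonneg \<nu>_le[of "A i"] A(1) by (simp add: range_subsetD)
      show ***: "summable (\<lambda>i. measure \<Q> (A i))"
        using unit_square.P.finite_measure_UNION[OF A] by (rule sums_summable)
      show "summable (\<lambda>i. L (A i))" by (rule tannery_sums(2)[OF * ** ***])
    qed
    moreover have "(\<lambda>n. \<Sum>i. \<nu> n (A i)) \<longlonglongrightarrow> L (\<Union>i. A i)"
    proof -
      have "\<Union> (range A) \<in> sets \<Q>" using A(1) by auto
      from L[OF this] show ?thesis using \<nu>_union[OF A] by (simp add: sums_iff)
    qed
    ultimately show ?thesis by (simp add: sums_iff LIMSEQ_unique)
  qed
  define M where "M = measure_of (space \<Q>) (sets \<Q>) (\<lambda>A. ennreal (L A))"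
  have sets_M: "sets M = sets \<Q>"
    unfolding M_def by (simp only: sets_measure_of[OF sets.space_closed] sets.sigma_sets_eq)
  have emeasure_M: "emeasure M A = ennreal (L A)" if "A \<in> sets \<Q>" for A
  proof (rule emeasure_measure_of[OF M_def])
    have "(\<lambda>n. \<nu> n {}) = (\<lambda>n. 0)" by (simp add: \<nu>_def)
    then have "L {} = 0" by (simp add: L_def)
    then show "positive (sets M) (\<lambda>A. ennreal (L A))" by (simp add: positive_def)
    show "countably_additive (sets M) (\<lambda>A. ennreal (L A))"
      unfolding countably_additive_def sets_M
    proof (intro allI impI)
      fix A :: "nat \<Rightarrow> (real \<times> real) set" assume A: "range A \<subseteq> sets \<Q>" "disjoint_family A" "\<Union> (range A) \<in> sets \<Q>"
      have "L (A i) \<ge> 0" for i using L_nonneg A(1) by auto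
      then show "(\<Sum>i. ennreal (L (A i))) = ennreal (L (\<Union> (range A)))"
        using L_union[OF A(1,2)] by (simp add: suminf_ennreal2 sums_iff)
    qed
    show "sets \<Q> \<subseteq> Pow (space \<Q>)" by (rule sets.space_closed)
  qed (use that sets_M in auto)
  have "absolutely_continuous \<Q> M"
    unfolding absolutely_continuous_def
  proof
    fix A assume A: "A \<in> null_sets \<Q>"
    then have "measure \<Q> A = 0" "A \<in> sets \<Q>" by (auto simp: measure_eq_0_null_sets)
    then have "L A = 0" using L_le[of A] L_nonneg[of A] by linarith
    then show "A \<in> null_sets M" using \<open>A \<in> sets \<Q>\<close> by (auto simp: emeasure_M sets_M intro!: null_setsI)
  qed
  from unit_square.P.Radon_Nikodym[OF this sets_M]
  obtain f where f[measurable]: "f \<in> borel_measurable \<Q>" and dens: "density \<Q> f = M" by blast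
  have f_int: "(\<integral>\<^sup>+p. f p * indicator A p \<partial>\<Q>) = ennreal (L A)" if "A \<in> sets \<Q>" for A
    using emeasure_density[OF f that] by (simp add: dens emeasure_M[OF that])
  \<comment> \<open>On the set A where f exceeds 1, the excess f - 1 has integral L A minus the
    measure of A. This difference is truncated at 0 in \<open>ennreal\<close>, and L A is at most
    the measure, so the excess vanishes almost everywhere.\<close>
  have f_le: "AE p in \<Q>. f p \<le> 1"
  proof -
    define A where "A = {p \<in> space \<Q>. 1 < f p}"
    have A[measurable]: "A \<in> sets \<Q>" unfolding A_def by measurable
    have "(\<integral>\<^sup>+p. f p * indicator A p - indicator A p \<partial>\<Q>)
        = (\<integral>\<^sup>+p. f p * indicator A p \<partial>\<Q>) - (\<integral>\<^sup>+p. indicator A p \<partial>\<Q>)"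
    proof (rule nn_integral_diff)
      show "(\<lambda>p. f p * indicator A p) \<in> borel_measurable \<Q>" "indicator A \<in> borel_measurable \<Q>"
        by measurable
      show "(\<integral>\<^sup>+p. indicator A p \<partial>\<Q>) \<noteq> \<infinity>"
        by (simp add: unit_square.P.emeasure_eq_measure)
      show "AE p in \<Q>. indicator A p \<le> f p * indicator A p"
        by (rule AE_I2) (auto simp: A_def indicator_def intro: less_imp_le)
    qed
    also have "\<dots> = ennreal (L A) - ennreal (measure \<Q> A)"
      by (simp add: f_int unit_square.P.emeasure_eq_measure)
    also have "\<dots> = 0" using L_le[OF A] by (simp add: ennreal_minus ennreal_eq_0_iff)
    finally have "AE p in \<Q>. f p * indicator A p - indicator A p = 0"
      by (subst (asm) nn_integral_0_iff_AE) auto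
    then show ?thesis
      using AE_space
    proof eventually_elim
      case (elim p)
      show ?case
      proof (rule ccontr)
        assume "\<not> f p \<le> 1"
        with elim have "f p - 1 = 0" by (simp add: A_def not_le)
        then have "f p \<le> 1" by (simp add: diff_eq_0_iff_ennreal)
        with \<open>\<not> f p \<le> 1\<close> show False by simp
      qed
    qed
  qed
  define g where "g p = enn2real (f p)" for p
  have [measurable]: "g \<in> borel_measurable \<Q>" unfolding g_def by measurable
  have fg: "AE p in \<Q>. f p = ennreal (g p) \<and> g p \<le> 1"
    using f_le
  proof eventually_elim
    case (elim p)
    then have "f p < top" by (rule le_less_trans) simp
    then show ?case using enn2real_mono[OF elim] by (simp add: g_def)
  qed
  have g0: "0 \<le> g p" for p by (simp add: g_def)
  have g_int: "(\<integral>p. indicator A p * g p \<partial>\<Q>) = L A" if A[measurable]: "A \<in> sets \<Q>" for A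
  proof -
    have "(\<integral>p. indicator A p * g p \<partial>\<Q>) = enn2real (\<integral>\<^sup>+p. ennreal (indicator A p * g p) \<partial>\<Q>)"
      by (rule integral_eq_nn_integral) (auto simp: g0)
    also have "(\<integral>\<^sup>+p. ennreal (indicator A p * g p) \<partial>\<Q>) = (\<integral>\<^sup>+p. f p * indicator A p \<partial>\<Q>)"
      by (rule nn_integral_cong_AE) (use fg in \<open>eventually_elim, auto simp: indicator_def\<close>)
    finally show ?thesis using L_nonneg[OF A] by (simp add: f_int)
  qed
  \<comment> \<open>The density is at most 1 only almost everywhere and need not be symmetric.
    Symmetrising keeps its integral over each rectangle because L takes the same value on
    \<open>S \<times> T\<close> and \<open>T \<times> S\<close>, a symmetry inherited from the
    graphons V n.\<close>
  define W where "W = restrict (\<lambda>(x, y). max 0 (min 1 ((g (x, y) + g (y, x)) / 2))) ({0..1} \<times> {0..1})"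
  have W: "borel_graphon W" unfolding W_def by (rule borel_graphon_symmetrise) measurable
  have W_int: "(\<integral>p. indicator (S \<times> T) p * W p \<partial>\<Q>) = L (S \<times> T)" if ST: "S \<in> sets \<I>" "T \<in> sets \<I>" for S T
  proof -
    have rect: "S \<times> T \<in> sets \<Q>" "T \<times> S \<in> sets \<Q>" using ST by auto
    have ig: "integrable \<Q> (\<lambda>p. indicator A p * g p)" if [measurable]: "A \<in> sets \<Q>" for A
      by (rule unit_square.P.integrable_const_bound[of _ 1])
        (use fg in \<open>eventually_elim, auto simp: indicator_def g0\<close>, measurable)
    have "(\<lambda>p. indicator (S \<times> T) p * g (snd p, fst p)) = (\<lambda>p. (\<lambda>q. indicator (T \<times> S) q * g q) (snd p, fst p))"
      by (auto simp: indicator_def)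
    moreover have "(\<lambda>q. indicator (T \<times> S) q * g q) \<in> borel_measurable \<Q>" using rect by measurable
    ultimately have sw: "(\<integral>p. indicator (S \<times> T) p * g (snd p, fst p) \<partial>\<Q>) = L (T \<times> S)"
        "integrable \<Q> (\<lambda>p. indicator (S \<times> T) p * g (snd p, fst p))"
      using integral_swap[of "\<lambda>q. indicator (T \<times> S) q * g q"] g_int[OF rect(2)]
        unit_square.integrable_product_swap[OF ig[OF rect(2)]] by (simp_all add: split_beta')
    have "\<nu> n (T \<times> S) = \<nu> n (S \<times> T)" for n
    proof -
      have "\<nu> n (S \<times> T) = (\<integral>p. (\<lambda>q. indicator (T \<times> S) q * V n q) (snd p, fst p) \<partial>\<Q>)"
        unfolding \<nu>_def
        by (rule Bochner_Integration.integral_cong)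
          (auto simp: indicator_def graphon_sym[OF borel_graphon_graphon[OF V]])
      also have "\<dots> = \<nu> n (T \<times> S)"
        unfolding \<nu>_def by (rule integral_swap) (use int[OF rect(2)] in auto)
      finally show ?thesis by simp
    qed
    then have LL: "L (T \<times> S) = L (S \<times> T)" by (simp add: L_def)
    obtain N where N: "N \<in> null_sets \<Q>" "\<And>p. p \<in> space \<Q> - N \<Longrightarrow> g p \<le> 1"
      using fg by (auto elim!: AE_E3)
    have "AE p in \<Q>. p \<notin> N \<union> {p \<in> {0..1} \<times> {0..1}. (snd p, fst p) \<in> N}"
      by (rule AE_not_in) (intro null_sets.Un N null_sets_swap)
    then have AE: "AE p in \<Q>. indicator (S \<times> T) p * W p
        = (indicator (S \<times> T) p * g p + indicator (S \<times> T) p * g (snd p, fst p)) / 2"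
      using AE_space
    proof eventually_elim
      case (elim p)
      obtain x y where p: "p = (x, y)" by (cases p)
      have "g (x, y) \<le> 1" "g (y, x) \<le> 1" using elim N(2) by (auto simp: p)
      then have "W p = (g p + g (snd p, fst p)) / 2"
        using elim(2) g0[of "(x, y)"] g0[of "(y, x)"] by (simp add: p W_def)
      then show ?case by (simp only: distrib_left[symmetric] times_divide_eq_right)
    qed
    have Wm[measurable]: "W \<in> borel_measurable \<Q>" using W by (simp add: borel_graphon_def)
    have "(\<integral>p. indicator (S \<times> T) p * W p \<partial>\<Q>)
        = (\<integral>p. (indicator (S \<times> T) p * g p + indicator (S \<times> T) p * g (snd p, fst p)) / 2 \<partial>\<Q>)"
    proof (rule integral_cong_AE[OF _ _ AE])
      show "(\<lambda>p. indicator (S \<times> T) p * W p) \<in> borel_measurable \<Q>" using rect by measurable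
      show "(\<lambda>p. (indicator (S \<times> T) p * g p + indicator (S \<times> T) p * g (snd p, fst p)) / 2) \<in> borel_measurable \<Q>"
        using rect by measurable
    qed
    also have "\<dots> = L (S \<times> T)"
      using ig[OF rect(1)] sw g_int[OF rect(1)] by (simp add: LL)
    finally show ?thesis .
  qed
  have "cut_le (\<lambda>p. V k p - W p) (b k)" for k
    unfolding cut_le_def
  proof (intro ballI)
    fix S T assume ST: "S \<in> sets \<I>" "T \<in> sets \<I>"
    have rect: "S \<times> T \<in> sets \<Q>" using ST by auto
    have iW: "integrable \<Q> (\<lambda>p. indicator (S \<times> T) p * W p)"
      by (intro bounded_kernel_integrable bounded_kernel_mult bounded_kernel_indicator ST borel_graphon_bounded W)
    have "(\<integral>p. indicator (S \<times> T) p * (V k p - W p) \<partial>\<Q>) = \<nu> k (S \<times> T) - L (S \<times> T)"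
      unfolding \<nu>_def W_int[OF ST, symmetric] right_diff_distrib
      by (rule Bochner_Integration.integral_diff[OF int[OF rect] iW])
    moreover have "\<bar>\<nu> k (S \<times> T) - L (S \<times> T)\<bar> \<le> b k"
    proof (rule LIMSEQ_le_const2)
      show "(\<lambda>n. \<bar>\<nu> k (S \<times> T) - \<nu> n (S \<times> T)\<bar>) \<longlonglongrightarrow> \<bar>\<nu> k (S \<times> T) - L (S \<times> T)\<bar>"
        by (intro tendsto_intros L rect)
      have "\<bar>\<nu> k (S \<times> T) - \<nu> n (S \<times> T)\<bar> \<le> b k" if "k \<le> n" for n
      proof -
        have "\<nu> k (S \<times> T) - \<nu> n (S \<times> T) = (\<integral>p. indicator (S \<times> T) p * (V k p - V n p) \<partial>\<Q>)"
          unfolding \<nu>_def right_diff_distrib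
          by (rule Bochner_Integration.integral_diff[symmetric]) (intro int rect)+
        then show ?thesis using cut_leD[OF cauchy[OF that] ST] by simp
      qed
      then show "\<exists>N. \<forall>n\<ge>N. \<bar>\<nu> k (S \<times> T) - \<nu> n (S \<times> T)\<bar> \<le> b k" by blast
    qed
    ultimately show "\<bar>\<integral>p. indicator (S \<times> T) p * (V k p - W p) \<partial>\<Q>\<bar> \<le> b k" by simp
  qed
  with W show thesis by (rule that)
qed

section \<open>Moving finitely many sets onto a coarse grid simultaneously\<close>

lemma sorting_permutation:
  fixes c :: "nat \<Rightarrow> nat"
  obtains \<sigma> where "\<sigma> permutes {..<N}" "\<And>i j. i \<le> j \<Longrightarrow> j < N \<Longrightarrow> c (\<sigma> i) \<le> c (\<sigma> j)"
proof -
  define xs where "xs = sort_key c [0..<N]"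
  have xs: "length xs = N" "distinct xs" "set xs = {..<N}" "sorted (map c xs)"
    unfolding xs_def by (simp_all only: length_sort length_upt diff_zero distinct_sort distinct_upt set_sort
        set_upt lessThan_atLeast0 sorted_sort_key)
  define \<sigma> where "\<sigma> i = (if i < N then xs ! i else i)" for i
  have "bij_betw ((!) xs) {..<N} {..<N}"
    by (rule bij_betw_nth[OF xs(2)]) (simp_all only: xs(1,3))
  moreover have "bij_betw \<sigma> {..<N} {..<N} = bij_betw ((!) xs) {..<N} {..<N}"
    by (rule bij_betw_cong) (simp add: \<sigma>_def)
  ultimately have "bij_betw \<sigma> {..<N} {..<N}" by simp
  then have "\<sigma> permutes {..<N}" by (rule bij_imp_permutes) (simp add: \<sigma>_def)
  moreover have "c (\<sigma> i) \<le> c (\<sigma> j)" if "i \<le> j" "j < N" for i j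
    using sorted_nth_mono[OF xs(4), of i j] that xs(1) by (simp add: \<sigma>_def)
  ultimately show thesis by (rule that)
qed

lemma measure_grid_set_le:
  assumes "finite B" "0 < L"
  shows "measure \<I> (grid_set L B) \<le> real (card B) / real L"
proof -
  have single: "measure \<I> (grid_set L {l}) \<le> 1 / real L" for l
  proof -
    have sub: "grid_set L {l} \<subseteq> {real l / real L..(real l + 1) / real L}"
    proof
      fix x assume "x \<in> grid_set L {l}"
      then have x: "0 \<le> x" "nat \<lfloor>real L * x\<rfloor> = l" by (auto simp: grid_set_def)
      then have "real l \<le> real L * x" "real L * x \<le> real l + 1"
        using floor_grid[OF x(1), of L] by auto
      then show "x \<in> {real l / real L..(real l + 1) / real L}"
        using assms(2) by (simp add: field_simps)
    qed
    have "measure \<I> (grid_set L {l}) = measure lebesgue (grid_set L {l})"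
      by (rule measure_unit_interval) (auto simp: grid_set_def)
    also have "\<dots> \<le> measure lebesgue {real l / real L..(real l + 1) / real L}"
      by (rule measure_mono_fmeasurable[OF sub]) auto
    also have "\<dots> = 1 / real L" using assms(2) by (simp add: field_simps)
    finally show ?thesis .
  qed
  have "grid_set L B = (\<Union>l\<in>B. grid_set L {l})" by (auto simp: grid_set_def)
  then have "measure \<I> (grid_set L B) \<le> (\<Sum>l\<in>B. measure \<I> (grid_set L {l}))"
    using measure_UNION_le[OF assms(1), of "\<lambda>l. grid_set L {l}" \<I>] by simp
  also have "\<dots> \<le> (\<Sum>l\<in>B. 1 / real L)" by (rule sum_mono) (rule single)
  finally show ?thesis by simp
qed

lemma measure_ipm_vimage:
  assumes "invertible_measure_preserving \<phi>" "A \<in> sets \<I>"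
  shows "\<phi> -` A \<inter> {0..1} \<in> sets \<I>" "measure \<I> (\<phi> -` A \<inter> {0..1}) = measure \<I> A"
proof -
  show "\<phi> -` A \<inter> {0..1} \<in> sets \<I>"
    using measurable_sets[OF ipm_measurable[OF assms(1)] assms(2)] by simp
  have "measure (distr \<I> \<I> \<phi>) A = measure \<I> (\<phi> -` A \<inter> space \<I>)"
    by (rule measure_distr[OF ipm_measurable[OF assms(1)] assms(2)])
  then show "measure \<I> (\<phi> -` A \<inter> {0..1}) = measure \<I> A"
    by (simp add: ipm_distr[OF assms(1)])
qed

text \<open>Sorting the cells of a fine grid by the sets they belong to leaves at most one coarse cell
  per class boundary that is not contained in a single class.\<close>
lemma simultaneous_rearrangement:
  fixes q :: nat
  assumes \<eta>: "0 < \<eta>"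
  obtains L where "\<And>S. (\<And>i. i < q \<Longrightarrow> S i \<in> sets \<I>) \<Longrightarrow>
    \<exists>\<phi> A. invertible_measure_preserving \<phi> \<and>
      (\<forall>i<q. A i \<subseteq> {..<L} \<and> measure \<I> (sym_diff (\<phi> -` S i \<inter> {0..1}) (grid_set L (A i))) \<le> \<eta>)"
proof -
  \<comment> \<open>K counts the possible classes of a fine cell, a class being the set of those i
    whose approximating grid set contains the cell. L is fixed here, before the sets S are known,
    with \<eta>/2 of the error left for at most K spoiled coarse cells of measure 1/L each.\<close>
  define K :: nat where "K = 2 ^ q"
  obtain L :: nat where L: "2 * real K / \<eta> < real L" using reals_Archimedean2 by blast
  have "0 < 2 * real K / \<eta>" using \<eta> by (simp add: K_def)
  with L have Lpos: "0 < L" by simp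
  have KL: "real K / real L \<le> \<eta> / 2" using L \<eta> Lpos by (simp add: field_simps)
  show thesis
  proof (rule that)
    fix S :: "nat \<Rightarrow> real set" assume S: "\<And>i. i < q \<Longrightarrow> S i \<in> sets \<I>"
    have "\<exists>N0. \<forall>N\<ge>N0. \<exists>A\<subseteq>{..<N}. measure \<I> (sym_diff (S i) (grid_set N A)) \<le> \<eta> / 2" if "i < q" for i
      using grid_approximation[OF S[OF that], of "\<eta> / 2"] \<eta> by (metis half_gt_zero)
    then obtain N0 where N0: "\<And>i N. i < q \<Longrightarrow> N0 i \<le> N \<Longrightarrow>
        \<exists>A\<subseteq>{..<N}. measure \<I> (sym_diff (S i) (grid_set N A)) \<le> \<eta> / 2" by metis
    define N where "N = Suc (\<Sum>i<q. N0 i)"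
    have "N0 i \<le> N" if "i < q" for i
      using member_le_sum[of i "{..<q}" N0] that by (simp add: N_def)
    then have "\<forall>i\<in>{..<q}. \<exists>A. A \<subseteq> {..<N} \<and> measure \<I> (sym_diff (S i) (grid_set N A)) \<le> \<eta> / 2"
      using N0 by blast
    then obtain A where "\<forall>i\<in>{..<q}. A i \<subseteq> {..<N} \<and> measure \<I> (sym_diff (S i) (grid_set N (A i))) \<le> \<eta> / 2"
      by (rule bchoice[THEN exE])
    then have A: "\<And>i. i < q \<Longrightarrow> A i \<subseteq> {..<N}"
        "\<And>i. i < q \<Longrightarrow> measure \<I> (sym_diff (S i) (grid_set N (A i))) \<le> \<eta> / 2"
      by auto
    have N: "0 < N" by (simp add: N_def)
    obtain h where h: "bij_betw h (Pow {..<q}) {0..<card (Pow {..<q})}"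
      using ex_bij_betw_finite_nat[of "Pow {..<q}"] by auto
    \<comment> \<open>Numbers the class of cell j by a natural number below K, so that cells can be
      sorted by class.\<close>
    define c where "c j = h {i. i < q \<and> j \<in> A i}" for j
    have c_lt: "c j < K" for j
      using bij_betwE[OF h] by (auto simp: c_def K_def card_Pow)
    have c_eq: "j \<in> A i \<longleftrightarrow> j' \<in> A i" if "c j = c j'" "i < q" for j j' i
    proof -
      have "{i. i < q \<and> j \<in> A i} = {i. i < q \<and> j' \<in> A i}"
        by (rule inj_onD[OF bij_betw_imp_inj_on[OF h]]) (use that(1) in \<open>auto simp: c_def\<close>)
      then show ?thesis using that(2) by blast
    qed
    obtain \<sigma> where \<sigma>: "\<sigma> permutes {..<N}" "\<And>i j. i \<le> j \<Longrightarrow> j < N \<Longrightarrow> c (\<sigma> i) \<le> c (\<sigma> j)"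
      using sorting_permutation[where N = N and c = c] by blast
    define \<phi> where "\<phi> = cell_permutation N \<sigma>"
    have imp: "invertible_measure_preserving \<phi>"
      unfolding \<phi>_def by (rule ipm_cell_permutation[OF N \<sigma>(1)])
    \<comment> \<open>The index of the fine cell into which \<phi> moves x. After sorting, the class
      of this cell increases weakly with x on [0,1).\<close>
    define t where "t x = \<sigma> (nat \<lfloor>real N * x\<rfloor>)" for x
    have t_mono: "c (t x) \<le> c (t y)" if "0 \<le> x" "x \<le> y" "y < 1" for x y
      unfolding t_def
    proof (rule \<sigma>(2))
      show "nat \<lfloor>real N * x\<rfloor> \<le> nat \<lfloor>real N * y\<rfloor>"
        using that by (intro nat_mono floor_mono mult_left_mono) auto
      have "real N * y < real N" using that N by simp
      then show "nat \<lfloor>real N * y\<rfloor> < N" using floor_grid(1)[of y N] that by linarith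
    qed
    have \<phi>_grid: "\<phi> x \<in> grid_set N B \<longleftrightarrow> x < 1 \<and> t x \<in> B" if "x \<in> {0..1}" for x B
    proof (cases "x < 1")
      case True
      then show ?thesis
        using cell_permutation[OF N \<sigma>(1) that] by (auto simp: grid_set_def \<phi>_def t_def)
    next
      case False
      then have "x = 1" using that by simp
      then have "\<phi> x = 1"
        using permutes_not_in[OF \<sigma>(1), of N] by (simp add: \<phi>_def cell_permutation_def)
      then show ?thesis using False by (simp add: grid_set_def)
    qed
    \<comment> \<open>A coarse cell is assigned to the sets according to the class at its left end.
      It is \<open>bad\<close> if the class changes inside it.\<close>
    define A' where "A' i = {l. l < L \<and> t (real l / real L) \<in> A i}" for i
    define split where "split l x \<longleftrightarrow> real l / real L \<le> x \<and> x < (real l + 1) / real L \<and> c (t x) \<noteq> c (t (real l / real L))" for l x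
    define bad where "bad = {l. l < L \<and> (\<exists>x. split l x)}"
    have bad_fin: "finite bad"
      by (rule finite_subset[of _ "{..<L}"]) (auto simp: bad_def)
    \<comment> \<open>The class increases inside a bad cell, hence before the left end of any later
      bad cell. Left ends of bad cells thus have distinct classes, which bounds the number of bad
      cells by K.\<close>
    have strict: "c (t (real l / real L)) < c (t (real l' / real L))" if "l \<in> bad" "l' \<in> bad" "l < l'" for l l'
    proof -
      have "\<exists>x. split l x" using that(1) unfolding bad_def by blast
      then obtain x where "split l x" by blast
      then have x: "real l / real L \<le> x" "x < (real l + 1) / real L" "c (t x) \<noteq> c (t (real l / real L))"
        unfolding split_def by blast+
      have "(real l + 1) / real L \<le> real l' / real L"
        using that(3) by (intro divide_right_mono) auto
      then have xl': "x \<le> real l' / real L" using x(2) by linarith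
      have "l' < L" using that(2) unfolding bad_def by blast
      then have l'1: "real l' / real L < 1" by simp
      have l0: "0 \<le> real l / real L" by simp
      have "c (t (real l / real L)) \<le> c (t x)"
        by (rule t_mono[OF l0 x(1)]) (use xl' l'1 in linarith)
      moreover have "c (t x) \<le> c (t (real l' / real L))"
        by (rule t_mono[OF _ xl' l'1]) (use x(1) l0 in linarith)
      ultimately show ?thesis using x(3) by linarith
    qed
    have "inj_on (\<lambda>l. c (t (real l / real L))) bad"
      by (rule linorder_inj_onI') (use strict in \<open>metis less_irrefl\<close>)
    then have "card bad \<le> card {..<K}"
      by (rule card_inj_on_le) (use c_lt in auto)
    then have card_bad: "real (card bad) \<le> real K" by simp
    have "A' i \<subseteq> {..<L} \<and> measure \<I> (sym_diff (\<phi> -` S i \<inter> {0..1}) (grid_set L (A' i))) \<le> \<eta>" if i: "i < q" for i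
    proof
      show "A' i \<subseteq> {..<L}" by (auto simp: A'_def)
      \<comment> \<open>Outside the bad cells the class at x is that at the left end of its coarse
        cell, so only the error of the fine grid, pulled back by \<phi>, remains.\<close>
      have sub: "sym_diff (\<phi> -` S i \<inter> {0..1}) (grid_set L (A' i))
          \<subseteq> (\<phi> -` sym_diff (S i) (grid_set N (A i)) \<inter> {0..1}) \<union> grid_set L bad"
      proof
        fix x assume x: "x \<in> sym_diff (\<phi> -` S i \<inter> {0..1}) (grid_set L (A' i))"
        then have x01: "x \<in> {0..1}" by (auto simp: grid_set_def)
        show "x \<in> (\<phi> -` sym_diff (S i) (grid_set N (A i)) \<inter> {0..1}) \<union> grid_set L bad"
        proof (rule ccontr)
          assume neg: "x \<notin> (\<phi> -` sym_diff (S i) (grid_set N (A i)) \<inter> {0..1}) \<union> grid_set L bad"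
          then have "\<phi> x \<in> S i \<longleftrightarrow> \<phi> x \<in> grid_set N (A i)" using x01 by blast
          also have "\<dots> \<longleftrightarrow> x < 1 \<and> t x \<in> A i" by (rule \<phi>_grid[OF x01])
          also have "\<dots> \<longleftrightarrow> x \<in> grid_set L (A' i)"
          proof (cases "x < 1")
            case True
            define l where "l = nat \<lfloor>real L * x\<rfloor>"
            have x0: "0 \<le> x" using x01 by simp
            have lx: "real l \<le> real L * x" "real L * x < real l + 1"
              using floor_grid[OF x0, of L] by (auto simp: l_def)
            have "real L * x < real L" using True Lpos by simp
            then have lL: "l < L" using lx by linarith
            have "l \<notin> bad" using neg True x0 by (auto simp: grid_set_def l_def)
            then have "\<not> split l x" using lL unfolding bad_def by blast
            moreover have "real l / real L \<le> x" "x < (real l + 1) / real L"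
              using lx Lpos by (simp_all add: field_simps)
            ultimately have "c (t x) = c (t (real l / real L))" unfolding split_def by blast
            from c_eq[OF this i] show ?thesis
              using True x0 lL by (simp add: grid_set_def A'_def l_def)
          qed (simp add: grid_set_def)
          finally show False using x x01 by blast
        qed
      qed
      have m1: "sym_diff (S i) (grid_set N (A i)) \<in> sets \<I>" using S[OF i] by simp
      note v = measure_ipm_vimage[OF imp m1]
      have "measure \<I> (sym_diff (\<phi> -` S i \<inter> {0..1}) (grid_set L (A' i)))
          \<le> measure \<I> ((\<phi> -` sym_diff (S i) (grid_set N (A i)) \<inter> {0..1}) \<union> grid_set L bad)"
        by (rule unit_interval.finite_measure_mono[OF sub]) (use v(1) in simp)
      also have "\<dots> \<le> measure \<I> (\<phi> -` sym_diff (S i) (grid_set N (A i)) \<inter> {0..1}) + measure \<I> (grid_set L bad)"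
        by (rule measure_Un_le[OF v(1) grid_set_measurable])
      also have "\<dots> \<le> \<eta> / 2 + real (card bad) / real L"
        using v(2) A(2)[OF i] measure_grid_set_le[OF bad_fin Lpos] by simp
      also have "real (card bad) / real L \<le> real K / real L"
        using card_bad by (rule divide_right_mono) simp
      finally show "measure \<I> (sym_diff (\<phi> -` S i \<inter> {0..1}) (grid_set L (A' i))) \<le> \<eta>"
        using KL by linarith
    qed
    with imp show "\<exists>\<phi> A. invertible_measure_preserving \<phi> \<and>
        (\<forall>i<q. A i \<subseteq> {..<L} \<and> measure \<I> (sym_diff (\<phi> -` S i \<inter> {0..1}) (grid_set L (A i))) \<le> \<eta>)"
      by blast
  qed
qed

text \<open>Two rectangles can differ only over the difference of the first sides or over that of
  the second sides, that is, inside two strips.\<close>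

lemma rectangle_L1:
  assumes "S \<in> sets \<I>" "T \<in> sets \<I>" "S' \<in> sets \<I>" "T' \<in> sets \<I>"
  shows "(\<integral>p. \<bar>indicator (S \<times> T) p - indicator (S' \<times> T') p\<bar> \<partial>\<Q>)
    \<le> measure \<I> (sym_diff S S') + measure \<I> (sym_diff T T')"
proof -
  let ?A = "sym_diff S S' \<times> {0..1 :: real}" and ?B = "{0..1 :: real} \<times> sym_diff T T'"
  have AB: "?A \<in> sets \<Q>" "?B \<in> sets \<Q>" using assms by auto
  have fin: "emeasure \<Q> X < \<infinity>" for X by (simp add: unit_square.P.emeasure_eq_measure)
  have meas: "measure \<Q> (X \<times> Y) = measure \<I> X * measure \<I> Y" if "X \<in> sets \<I>" "Y \<in> sets \<I>" for X Y
    using unit_interval.emeasure_pair_measure_Times[OF that]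
    by (simp add: measure_def enn2real_mult)
  have int: "integrable \<Q> (indicator X :: _ \<Rightarrow> real)" if "X \<in> sets \<Q>" for X
    using that fin by (rule integrable_real_indicator)
  have rect: "S \<times> T \<in> sets \<Q>" "S' \<times> T' \<in> sets \<Q>" using assms by auto
  have "(\<integral>p. \<bar>indicator (S \<times> T) p - indicator (S' \<times> T') p\<bar> \<partial>\<Q>) \<le> (\<integral>p. indicator ?A p + indicator ?B p \<partial>\<Q> :: real)"
  proof (rule integral_mono)
    show "integrable \<Q> (\<lambda>p. \<bar>indicator (S \<times> T) p - indicator (S' \<times> T') p\<bar> :: real)"
      by (intro integrable_abs Bochner_Integration.integrable_diff int rect)
    show "integrable \<Q> (\<lambda>p. indicator ?A p + indicator ?B p :: real)"
      by (intro Bochner_Integration.integrable_add int AB)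
    show "\<bar>indicator (S \<times> T) p - indicator (S' \<times> T') p\<bar> \<le> (indicator ?A p + indicator ?B p :: real)"
      if "p \<in> space \<Q>" for p
      using that by (cases p) (auto simp: indicator_def)
  qed
  also have "\<dots> = measure \<Q> ?A + measure \<Q> ?B"
    using int[OF AB(1)] int[OF AB(2)] sets.sets_into_space[OF AB(1)] sets.sets_into_space[OF AB(2)]
    by (simp add: Int_absorb2)
  also have "measure \<Q> ?A = measure \<I> (sym_diff S S') * measure \<I> {0..1}"
    by (rule meas) (use assms in auto)
  also have "measure \<Q> ?B = measure \<I> {0..1} * measure \<I> (sym_diff T T')"
    by (rule meas) (use assms in auto)
  also have "measure \<I> {0..1} = 1" using unit_interval.prob_space by simp
  finally show ?thesis by simp
qed

subsection \<open>Compactness of the space of graphons\<close>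

lemma indicator_pullback:
  assumes "p \<in> {0..1} \<times> {0..1}"
  shows "indicator (S \<times> T) (map_prod \<phi> \<phi> p) = (indicator ((\<phi> -` S \<inter> {0..1}) \<times> (\<phi> -` T \<inter> {0..1})) p :: real)"
  using assms by (cases p) (simp add: indicator_def)

text \<open>Half of \<epsilon> pays for the Frieze-Kannan approximation, the other half for
  replacing the rearranged sides by coarse grid sets. The members of C are kernels and in general
  not symmetric, hence not graphons; this is enough, as they serve only as intermediate points in
  the triangle inequality.\<close>

lemma finite_cut_cover:
  assumes \<epsilon>: "0 < \<epsilon>"
  obtains C where "finite C" "\<And>c. c \<in> C \<Longrightarrow> bounded_kernel c"
    "\<And>U. borel_graphon U \<Longrightarrow>
      \<exists>\<phi>. \<exists>c\<in>C. invertible_measure_preserving \<phi> \<and> cut_le (\<lambda>p. U (map_prod \<phi> \<phi> p) - c p) \<epsilon>"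
proof -
  define e where "e = \<epsilon> / 2"
  have e: "0 < e" using \<epsilon> by (simp add: e_def)
  obtain m :: nat where m: "1 / e\<^sup>2 < real m" using reals_Archimedean2 by blast
  have "0 < 1 / e\<^sup>2" using e by simp
  with m have mpos: "0 < real m" by linarith
  have me: "1 < real m * e\<^sup>2" using m e by (simp add: field_simps)
  \<comment> \<open>There are m terms with coefficients at most e in absolute value; each changes by
    at most 2\<eta> in L1 when both sides move by \<eta>. With this \<eta> the total is e.\<close>
  define \<eta> where "\<eta> = 1 / (2 * real m)"
  have \<eta>: "0 < \<eta>" using mpos by (simp add: \<eta>_def)
  obtain L where L: "\<And>S. (\<And>i. i < 2 * m \<Longrightarrow> S i \<in> sets \<I>) \<Longrightarrow>
    \<exists>\<phi> A. invertible_measure_preserving \<phi> \<and>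
      (\<forall>i<2 * m. A i \<subseteq> {..<L} \<and> measure \<I> (sym_diff (\<phi> -` S i \<inter> {0..1}) (grid_set L (A i))) \<le> \<eta>)"
    using simultaneous_rearrangement[OF \<eta>, of "2 * m"] by blast
  define step :: "(nat \<Rightarrow> real) \<times> (nat \<Rightarrow> nat set) \<Rightarrow> real \<times> real \<Rightarrow> real" where
    "step = (\<lambda>(a, A) p. \<Sum>i<m. a i * indicator (grid_set L (A i) \<times> grid_set L (A (m + i))) p)"
  \<comment> \<open>Extensional function spaces are used because functions on all naturals would
    form an infinite set; only the first m coefficients and the first 2m index sets enter
    \<open>step\<close>.\<close>
  define C where "C = step ` (({..<m} \<rightarrow>\<^sub>E {- e, 0, e}) \<times> ({..<2 * m} \<rightarrow>\<^sub>E Pow {..<L}))"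
  have bk_step: "bounded_kernel (step z)" for z
    unfolding step_def
    by (cases z, simp only: prod.case)
      (intro bounded_kernel_sum bounded_kernel_cmult bounded_kernel_indicator grid_set_measurable finite_lessThan)
  show thesis
  proof (rule that[of C])
    show "finite C" unfolding C_def by (intro finite_imageI finite_cartesian_product finite_PiE) auto
    show "bounded_kernel c" if "c \<in> C" for c using that bk_step by (auto simp: C_def)
    fix U assume U: "borel_graphon U"
    have U1: "\<bar>U p\<bar> \<le> 1" if "p \<in> {0..1} \<times> {0..1}" for p
      using graphon_range[OF borel_graphon_graphon[OF U] that] by auto
    obtain a :: "nat \<Rightarrow> real" and S T :: "nat \<Rightarrow> real set"
      where a: "\<And>i. a i \<in> {- e, 0, e}" and ST: "\<And>i. S i \<in> sets \<I>" "\<And>i. T i \<in> sets \<I>"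
        and fk: "cut_le (\<lambda>p. U p - (\<Sum>i<m. a i * indicator (S i \<times> T i) p)) e"
      using frieze_kannan[OF borel_graphon_bounded[OF U] U1 e me] by blast
    \<comment> \<open>All 2m sides form a single family, because one \<phi> has to straighten them
      together.\<close>
    define X where "X i = (if i < m then S i else T (i - m))" for i
    have "\<exists>\<phi> A. invertible_measure_preserving \<phi> \<and>
      (\<forall>i<2 * m. A i \<subseteq> {..<L} \<and> measure \<I> (sym_diff (\<phi> -` X i \<inter> {0..1}) (grid_set L (A i))) \<le> \<eta>)"
      by (rule L) (simp add: X_def ST)
    then obtain \<phi> A where imp: "invertible_measure_preserving \<phi>"
      and A: "\<And>i. i < 2 * m \<Longrightarrow> A i \<subseteq> {..<L} \<and> measure \<I> (sym_diff (\<phi> -` X i \<inter> {0..1}) (grid_set L (A i))) \<le> \<eta>"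
      by blast
    define z where "z = (restrict a {..<m}, restrict A {..<2 * m})"
    have "restrict a {..<m} \<in> {..<m} \<rightarrow>\<^sub>E {- e, 0, e}"
      unfolding restrict_PiE_iff using a by blast
    moreover have "restrict A {..<2 * m} \<in> {..<2 * m} \<rightarrow>\<^sub>E Pow {..<L}"
      unfolding restrict_PiE_iff using A by simp
    ultimately have zC: "step z \<in> C"
      unfolding C_def z_def by (intro imageI SigmaI)
    have stepz: "step z p = (\<Sum>i<m. a i * indicator (grid_set L (A i) \<times> grid_set L (A (m + i))) p)" for p
      unfolding step_def z_def by (auto intro!: sum.cong)
    define S' where "S' i = \<phi> -` S i \<inter> {0..1}" for i
    define T' where "T' i = \<phi> -` T i \<inter> {0..1}" for i
    have S'T': "S' i \<in> sets \<I>" "T' i \<in> sets \<I>" for i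
      unfolding S'_def T'_def by (rule measure_ipm_vimage(1)[OF imp ST(1)], rule measure_ipm_vimage(1)[OF imp ST(2)])
    define U\<^sub>1 where "U\<^sub>1 p = (\<Sum>i<m. a i * indicator (S i \<times> T i) p)" for p
    define U\<^sub>2 where "U\<^sub>2 p = (\<Sum>i<m. a i * indicator (S' i \<times> T' i) p)" for p
    have bk: "bounded_kernel U\<^sub>1" "bounded_kernel U\<^sub>2"
      unfolding U\<^sub>1_def U\<^sub>2_def
      by (intro bounded_kernel_sum bounded_kernel_cmult bounded_kernel_indicator ST S'T' finite_lessThan)+
    note bkU = borel_graphon_bounded[OF U]
    have "cut_le (\<lambda>p. U (map_prod \<phi> \<phi> p) - U\<^sub>1 (map_prod \<phi> \<phi> p)) e"
      by (rule cut_le_pullback[OF imp bounded_kernel_diff[OF bkU bk(1)]]) (use fk in \<open>simp only: U\<^sub>1_def\<close>)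
    then have c1: "cut_le (\<lambda>p. U (map_prod \<phi> \<phi> p) - U\<^sub>2 p) e"
      by (rule cut_le_cong) (simp only: U\<^sub>1_def U\<^sub>2_def S'_def T'_def indicator_pullback)
    have bkd: "bounded_kernel (\<lambda>p. \<bar>indicator (S' i \<times> T' i) p - indicator (grid_set L (A i) \<times> grid_set L (A (m + i))) p\<bar>)" for i
    proof (rule bounded_kernelI[of _ 1])
      have [measurable]: "S' i \<in> sets \<I>" "T' i \<in> sets \<I>" by (rule S'T')+
      show "(\<lambda>p. \<bar>indicator (S' i \<times> T' i) p - indicator (grid_set L (A i) \<times> grid_set L (A (m + i))) p\<bar> :: real) \<in> borel_measurable \<Q>"
        by measurable
    qed (simp add: indicator_def)
    have c2: "cut_le (\<lambda>p. U\<^sub>2 p - step z p) e"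
    proof (rule cut_le_L1[OF bounded_kernel_diff[OF bk(2) bk_step]])
      let ?d = "\<lambda>i p. \<bar>indicator (S' i \<times> T' i) p - indicator (grid_set L (A i) \<times> grid_set L (A (m + i))) p\<bar> :: real"
      have "(\<integral>p. \<bar>U\<^sub>2 p - step z p\<bar> \<partial>\<Q>) \<le> (\<integral>p. (\<Sum>i<m. e * ?d i p) \<partial>\<Q>)"
      proof (rule integral_mono)
        show "integrable \<Q> (\<lambda>p. \<bar>U\<^sub>2 p - step z p\<bar>)"
          by (intro integrable_abs bounded_kernel_integrable bounded_kernel_diff bk bk_step)
        show "integrable \<Q> (\<lambda>p. \<Sum>i<m. e * ?d i p)"
          by (intro bounded_kernel_integrable bounded_kernel_sum bounded_kernel_cmult bkd finite_lessThan)
        fix p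
        have "U\<^sub>2 p - step z p = (\<Sum>i<m. a i * (indicator (S' i \<times> T' i) p - indicator (grid_set L (A i) \<times> grid_set L (A (m + i))) p))"
          by (simp only: U\<^sub>2_def stepz sum_subtractf[symmetric] right_diff_distrib)
        also have "\<bar>\<dots>\<bar> \<le> (\<Sum>i<m. \<bar>a i * (indicator (S' i \<times> T' i) p - indicator (grid_set L (A i) \<times> grid_set L (A (m + i))) p)\<bar>)"
          by (rule sum_abs)
        also have "\<dots> \<le> (\<Sum>i<m. e * ?d i p)"
        proof (rule sum_mono)
          fix i
          have "\<bar>a i\<bar> \<le> e" using a[of i] e by auto
          then show "\<bar>a i * (indicator (S' i \<times> T' i) p - indicator (grid_set L (A i) \<times> grid_set L (A (m + i))) p)\<bar> \<le> e * ?d i p"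
            unfolding abs_mult by (rule mult_right_mono) simp
        qed
        finally show "\<bar>U\<^sub>2 p - step z p\<bar> \<le> (\<Sum>i<m. e * ?d i p)" .
      qed
      also have "\<dots> = (\<Sum>i<m. e * (\<integral>p. ?d i p \<partial>\<Q>))"
        using bounded_kernel_integrable[OF bkd] by (subst Bochner_Integration.integral_sum) auto
      also have "\<dots> \<le> (\<Sum>i<m. e * (\<eta> + \<eta>))"
      proof (intro sum_mono mult_left_mono)
        fix i assume "i \<in> {..<m}"
        then have i: "i < m" by simp
        have "(\<integral>p. ?d i p \<partial>\<Q>) \<le> measure \<I> (sym_diff (S' i) (grid_set L (A i))) + measure \<I> (sym_diff (T' i) (grid_set L (A (m + i))))"
          by (rule rectangle_L1) (intro S'T' grid_set_measurable)+
        moreover have "measure \<I> (sym_diff (S' i) (grid_set L (A i))) \<le> \<eta>"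
          using A[of i] i by (simp add: X_def S'_def)
        moreover have "measure \<I> (sym_diff (T' i) (grid_set L (A (m + i)))) \<le> \<eta>"
          using A[of "m + i"] i by (simp add: X_def T'_def)
        ultimately show "(\<integral>p. ?d i p \<partial>\<Q>) \<le> \<eta> + \<eta>" by linarith
      qed (use e in simp)
      also have "\<dots> = e" using mpos by (simp add: \<eta>_def)
      finally show "(\<integral>p. \<bar>U\<^sub>2 p - step z p\<bar> \<partial>\<Q>) \<le> e" .
    qed
    have "cut_le (\<lambda>p. U (map_prod \<phi> \<phi> p) - step z p) (e + e)"
      by (rule cut_le_trans[OF c1 c2 bounded_kernel_pullback[OF imp bkU] bk(2) bk_step])
    then have "cut_le (\<lambda>p. U (map_prod \<phi> \<phi> p) - step z p) \<epsilon>" by (simp add: e_def)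
    with imp zC show "\<exists>\<phi>. \<exists>c\<in>C. invertible_measure_preserving \<phi> \<and> cut_le (\<lambda>p. U (map_prod \<phi> \<phi> p) - c p) \<epsilon>"
      by blast
  qed
qed

lemma finite_range_diagonal_subsequence:
  fixes \<kappa> :: "nat \<Rightarrow> nat \<Rightarrow> 'b"
  assumes "\<And>k. finite (range (\<kappa> k))"
  obtains r where "strict_mono r" "\<And>k m n. k \<le> m \<Longrightarrow> k \<le> n \<Longrightarrow> \<kappa> k (r m) = \<kappa> k (r n)"
proof -
  define P where "P k s = (\<exists>v. \<forall>n. \<kappa> k (s n) = v)" for k and s :: "nat \<Rightarrow> nat"
  interpret subseqs P
  proof
    fix n and s :: "nat \<Rightarrow> nat" assume "strict_mono s"
    have "finite (range (\<lambda>i. \<kappa> n (s i)))"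
      by (rule finite_subset[OF _ assms[of n]]) auto
    then obtain v where inf: "infinite {i. \<kappa> n (s i) = v}"
      using pigeonhole_infinite[of UNIV "\<lambda>i. \<kappa> n (s i)"] by auto
    have "strict_mono (enumerate {i. \<kappa> n (s i) = v})" "\<And>i. \<kappa> n (s (enumerate {i. \<kappa> n (s i) = v} i)) = v"
      using strict_mono_enumerate[OF inf] enumerate_in_set[OF inf] by auto
    then show "\<exists>r'. strict_mono r' \<and> P n (s \<circ> r')" unfolding P_def comp_def by blast
  qed
  have const: "P k (diagseq \<circ> (+) (Suc k))" for k
    by (rule diagseq_holds) (auto simp: P_def)
  \<comment> \<open>The diagonal sequence becomes constant for \<kappa> k only from index Suc k on;
    the shift by one makes the condition \<open>k \<le> m\<close> sufficient.\<close>
  have "\<kappa> k (diagseq (Suc m)) = \<kappa> k (diagseq (Suc n))" if "k \<le> m" "k \<le> n" for k m n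
  proof -
    obtain v where v: "\<And>i. \<kappa> k (diagseq (Suc k + i)) = v" using const[of k] by (auto simp: P_def)
    from v[of "m - k"] v[of "n - k"] that show ?thesis by simp
  qed
  moreover have "strict_mono (\<lambda>n. diagseq (Suc n))"
    using subseq_diagseq by (simp add: strict_mono_def)
  ultimately show thesis by (intro that) blast+
qed

text \<open>At precision k every term is rearranged to lie near one of finitely many approximants.
  Along the diagonal subsequence, terms k and k + 1 share the approximant of precision k, so one can
  be aligned with the other. Composing these alignments puts all terms into common coordinates,
  where they are Cauchy in cut norm. The rearranged terms V k have the densities of the original
  ones, so \<open>counting_lemma\<close> applies to V k and the limit.\<close>

lemma graphon_compactness:
  fixes U :: "nat \<Rightarrow> real \<times> real \<Rightarrow> real"
  assumes U: "\<And>n. graphon (U n)"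
  obtains r W where "strict_mono r" "borel_graphon W" "(\<lambda>n. cut_dist (U (r n)) W) \<longlonglongrightarrow> 0"
    "\<forall>F :: 'a graph. simple_graph F \<longrightarrow> (\<lambda>n. hom_density F (U (r n))) \<longlonglongrightarrow> hom_density F W"
proof -
  have "\<exists>U' N. borel_graphon U' \<and> N \<in> null_sets \<Q> \<and> (\<forall>p\<in>{0..1} \<times> {0..1} - N. U n p = U' p)" for n
    using graphon_borel_representative[OF U[of n]] by metis
  then obtain U' N where U': "\<And>n. borel_graphon (U' n)" and N: "\<And>n. N n \<in> null_sets \<Q>"
    and UU': "\<And>n p. p \<in> {0..1} \<times> {0..1} - N n \<Longrightarrow> U n p = U' n p" by metis
  have "\<exists>C. finite C \<and> (\<forall>c\<in>C. bounded_kernel c) \<and> (\<forall>U. borel_graphon U \<longrightarrow>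
      (\<exists>\<phi>. \<exists>c\<in>C. invertible_measure_preserving \<phi> \<and> cut_le (\<lambda>p. U (map_prod \<phi> \<phi> p) - c p) ((1 / 2) ^ k)))" for k :: nat
    by (rule finite_cut_cover[of "(1 / 2) ^ k"]) (simp, blast)
  then obtain C where C: "\<And>k :: nat. finite (C k)" "\<And>k c. c \<in> C k \<Longrightarrow> bounded_kernel c"
    "\<And>k U. borel_graphon U \<Longrightarrow>
      \<exists>\<phi>. \<exists>c\<in>C k. invertible_measure_preserving \<phi> \<and> cut_le (\<lambda>p. U (map_prod \<phi> \<phi> p) - c p) ((1 / 2) ^ k)"
    by metis
  have "\<exists>\<phi> c. c \<in> C k \<and> invertible_measure_preserving \<phi> \<and> cut_le (\<lambda>p. U' n (map_prod \<phi> \<phi> p) - c p) ((1 / 2) ^ k)" for k n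
    using C(3)[OF U'] by blast
  then obtain \<phi> and c :: "nat \<Rightarrow> nat \<Rightarrow> real \<times> real \<Rightarrow> real" where \<phi>: "\<And>k n. c k n \<in> C k" "\<And>k n. invertible_measure_preserving (\<phi> k n)"
    "\<And>k n. cut_le (\<lambda>p. U' n (map_prod (\<phi> k n) (\<phi> k n) p) - c k n p) ((1 / 2) ^ k)" by metis
  have "finite (range (c k))" for k by (rule finite_subset[OF _ C(1)[of k]]) (use \<phi>(1) in auto)
  then obtain r where r: "strict_mono r" "\<And>k m n. k \<le> m \<Longrightarrow> k \<le> n \<Longrightarrow> c k (r m) = c k (r n)"
    using finite_range_diagonal_subsequence[of c] by metis
  note bU' = borel_graphon_bounded[OF U']
  \<comment> \<open>Aligns term k + 1 with term k itself: undo the rearrangement that brought term k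
    near the common approximant, then apply the one belonging to term k + 1.\<close>
  define \<zeta> where "\<zeta> k x = \<phi> k (r (Suc k)) (inv_into {0..1} (\<phi> k (r k)) x)" for k x
  have \<zeta>: "invertible_measure_preserving (\<zeta> k)" for k
    unfolding \<zeta>_def by (rule ipm_comp[OF \<phi>(2) ipm_inv[OF \<phi>(2)]])
  have step: "cut_le (\<lambda>p. U' (r k) p - U' (r (Suc k)) (map_prod (\<zeta> k) (\<zeta> k) p)) (2 * (1 / 2) ^ k)" for k
  proof -
    let ?\<phi> = "\<phi> k (r k)" and ?\<psi> = "\<phi> k (r (Suc k))"
    let ?i = "inv_into {0..1} ?\<phi>"
    have c: "c k (r (Suc k)) = c k (r k)" by (rule r(2)) auto
    have bc: "bounded_kernel (c k (r k))" by (rule C(2)[OF \<phi>(1)])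
    have "cut_le (\<lambda>p. U' (r k) (map_prod ?\<phi> ?\<phi> p) - U' (r (Suc k)) (map_prod ?\<psi> ?\<psi> p)) ((1 / 2) ^ k + (1 / 2) ^ k)"
      by (rule cut_le_trans[OF \<phi>(3) cut_le_minus_commute[OF \<phi>(3)[of "r (Suc k)" k, unfolded c]]])
        (intro bounded_kernel_pullback \<phi>(2) bU' bc)+
    moreover have "bounded_kernel (\<lambda>p. U' (r k) (map_prod ?\<phi> ?\<phi> p) - U' (r (Suc k)) (map_prod ?\<psi> ?\<psi> p))"
      by (intro bounded_kernel_diff bounded_kernel_pullback \<phi>(2) bU')
    ultimately have "cut_le (\<lambda>p. U' (r k) (map_prod ?\<phi> ?\<phi> (map_prod ?i ?i p)) - U' (r (Suc k)) (map_prod ?\<psi> ?\<psi> (map_prod ?i ?i p)))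
        ((1 / 2) ^ k + (1 / 2) ^ k)"
      by (intro cut_le_pullback[where D = "\<lambda>p. U' (r k) (map_prod ?\<phi> ?\<phi> p) - U' (r (Suc k)) (map_prod ?\<psi> ?\<psi> p)",
          OF ipm_inv[OF \<phi>(2)[of k "r k"]]])
    then have "cut_le (\<lambda>p. U' (r k) p - U' (r (Suc k)) (map_prod (\<zeta> k) (\<zeta> k) p)) ((1 / 2) ^ k + (1 / 2) ^ k)"
    proof (rule cut_le_cong)
      fix p :: "real \<times> real" assume "p \<in> {0..1} \<times> {0..1}"
      then have "map_prod ?\<phi> ?\<phi> (map_prod ?i ?i p) = p"
        using ipm_inv_right[OF \<phi>(2)[of k "r k"]] by (cases p) auto
      moreover have "map_prod ?\<psi> ?\<psi> (map_prod ?i ?i p) = map_prod (\<zeta> k) (\<zeta> k) p"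
        by (cases p) (simp add: \<zeta>_def)
      ultimately show "U' (r k) (map_prod ?\<phi> ?\<phi> (map_prod ?i ?i p)) - U' (r (Suc k)) (map_prod ?\<psi> ?\<psi> (map_prod ?i ?i p))
          = U' (r k) p - U' (r (Suc k)) (map_prod (\<zeta> k) (\<zeta> k) p)" by simp
    qed
    then show ?thesis by simp
  qed
  \<comment> \<open>Pulling back by \<theta> k expresses term k in the coordinates of term 0. Since
    \<open>\<theta> (Suc k)\<close> applies \<zeta> k after \<theta> k, the closeness of consecutive
    terms in \<open>step\<close> is simply pulled back along \<theta> k.\<close>
  define \<theta> where "\<theta> = rec_nat (\<lambda>x. x) (\<lambda>k f x. \<zeta> k (f x))"
  have \<theta>_Suc: "\<theta> (Suc k) x = \<zeta> k (\<theta> k x)" for k x by (simp add: \<theta>_def)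
  have \<theta>: "invertible_measure_preserving (\<theta> k)" for k
  proof (induction k)
    case 0
    show ?case using ipm_id by (simp add: \<theta>_def)
  next
    case (Suc k)
    show ?case unfolding \<theta>_Suc by (rule ipm_comp[OF \<zeta> Suc])
  qed
  define V where "V k = pullback (\<theta> k) (U' (r k))" for k
  have V: "borel_graphon (V k)" for k
    unfolding V_def by (rule borel_graphon_pullback[OF \<theta> U'])
  have V_step: "cut_le (\<lambda>p. V k p - V (Suc k) p) (2 * (1 / 2) ^ k)" for k
  proof -
    have "cut_le (\<lambda>p. U' (r k) (map_prod (\<theta> k) (\<theta> k) p)
        - U' (r (Suc k)) (map_prod (\<zeta> k) (\<zeta> k) (map_prod (\<theta> k) (\<theta> k) p))) (2 * (1 / 2) ^ k)"
      by (rule cut_le_pullback[OF \<theta> _ step]) (intro bounded_kernel_diff bounded_kernel_pullback \<zeta> bU')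
    then show ?thesis
    proof (rule cut_le_cong)
      fix p :: "real \<times> real" assume p: "p \<in> {0..1} \<times> {0..1}"
      have "map_prod (\<zeta> k) (\<zeta> k) (map_prod (\<theta> k) (\<theta> k) p) = map_prod (\<theta> (Suc k)) (\<theta> (Suc k)) p"
        by (cases p) (simp add: \<theta>_Suc)
      then show "U' (r k) (map_prod (\<theta> k) (\<theta> k) p) - U' (r (Suc k)) (map_prod (\<zeta> k) (\<zeta> k) (map_prod (\<theta> k) (\<theta> k) p))
          = V k p - V (Suc k) p"
        using p by (simp only: V_def pullback_apply)
    qed
  qed
  \<comment> \<open>The steps form a geometric series with sum 4 times the k-th power of 1/2.
    Keeping the remainder after l explicit makes the induction close.\<close>
  have V_diff: "cut_le (\<lambda>p. V k p - V l p) (4 * (1 / 2) ^ k - 4 * (1 / 2) ^ l)" if "k \<le> l" for k l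
    using that
  proof (induction l rule: dec_induct)
    case base
    show ?case by (simp add: cut_le_def)
  next
    case (step l)
    have "cut_le (\<lambda>p. V k p - V (Suc l) p) (4 * (1 / 2) ^ k - 4 * (1 / 2) ^ l + 2 * (1 / 2) ^ l)"
      by (rule cut_le_trans[OF step(3) V_step]) (rule borel_graphon_bounded[OF V])+
    then show ?case by simp
  qed
  have V_cauchy: "cut_le (\<lambda>p. V k p - V l p) (4 * (1 / 2) ^ k)" if "k \<le> l" for k l
    by (rule cut_le_mono[OF V_diff[OF that]]) simp
  have b0: "(\<lambda>k. 4 * (1 / 2) ^ k :: real) \<longlonglongrightarrow> 0"
    by (rule tendsto_mult_right_zero, rule LIMSEQ_power_zero) simp
  obtain W where W: "borel_graphon W" "\<And>k. cut_le (\<lambda>p. V k p - W p) (4 * (1 / 2) ^ k)"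
    using cut_limit_exists[OF V V_cauchy b0] by blast
  \<comment> \<open>V k is a rearrangement of term k, whereas \<open>cut_dist\<close> rearranges its
    second argument. Pulling back by the inverse of \<theta> k moves the rearrangement from the term
    to W.\<close>
  have dist: "cut_dist (U (r k)) W \<le> 4 * (1 / 2) ^ k" for k
  proof (rule cut_dist_le[OF U U' N UU' W(1) ipm_inv[OF \<theta>[of k]]])
    let ?i = "inv_into {0..1} (\<theta> k)"
    from cut_le_pullback[OF ipm_inv[OF \<theta>[of k]] bounded_kernel_diff[OF borel_graphon_bounded[OF V] borel_graphon_bounded[OF W(1)]] W(2)]
    show "cut_le (\<lambda>p. U' (r k) p - W (map_prod ?i ?i p)) (4 * (1 / 2) ^ k)"
    proof (rule cut_le_cong)
      fix p :: "real \<times> real" assume p: "p \<in> {0..1} \<times> {0..1}"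
      have "map_prod ?i ?i p \<in> {0..1} \<times> {0..1}"
        using ipm_range[OF ipm_inv[OF \<theta>[of k]]] p by (cases p) auto
      moreover have "map_prod (\<theta> k) (\<theta> k) (map_prod ?i ?i p) = p"
        using ipm_inv_right[OF \<theta>[of k]] p by (cases p) auto
      ultimately show "V k (map_prod ?i ?i p) - W (map_prod ?i ?i p) = U' (r k) p - W (map_prod ?i ?i p)"
        by (simp only: V_def pullback_apply)
    qed
  qed
  show thesis
  proof (rule that[OF r(1) W(1)])
    show "(\<lambda>n. cut_dist (U (r n)) W) \<longlonglongrightarrow> 0"
      by (rule tendsto_sandwich[OF _ _ tendsto_const b0])
        (use dist cut_dist_nonneg[OF U borel_graphon_graphon[OF W(1)]] in \<open>auto intro!: always_eventually\<close>)
    show "\<forall>F :: 'a graph. simple_graph F \<longrightarrow> (\<lambda>n. hom_density F (U (r n))) \<longlonglongrightarrow> hom_density F W"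
    proof (intro allI impI)
      fix F :: "'a graph" assume F: "simple_graph F"
      have "hom_density F (U n) = hom_density F (U' n)" for n
        by (rule hom_density_cong_AE[OF F U U' N]) (rule UU')
      then have "hom_density F (U (r k)) = hom_density F (V k)" for k
        by (simp add: V_def hom_density_pullback[OF F U' \<theta>])
      then have "\<bar>hom_density F (U (r k)) - hom_density F W\<bar> \<le> real (card (snd F)) * (4 * (1 / 2) ^ k)" for k
        using counting_lemma[OF F V W(1) W(2)] by simp
      moreover have "(\<lambda>k. real (card (snd F)) * (4 * (1 / 2) ^ k)) \<longlonglongrightarrow> 0"
        by (rule tendsto_mult_right_zero[OF b0])
      ultimately have "(\<lambda>k. hom_density F (U (r k)) - hom_density F W) \<longlonglongrightarrow> 0"
        by (intro Lim_null_comparison[where f = "\<lambda>k. hom_density F (U (r k)) - hom_density F W"] always_eventually) auto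
      then show "(\<lambda>n. hom_density F (U (r n))) \<longlonglongrightarrow> hom_density F W"
        by (simp add: LIM_zero_iff)
    qed
  qed
qed

section \<open>Contradiction from a sequence of counterexamples\<close>

theorem theorem12:
  fixes \<F> :: "'a graph set"
    and \<delta> :: "(real \<times> real \<Rightarrow> real) \<Rightarrow> (real \<times> real \<Rightarrow> real) \<Rightarrow> real"
  assumes "\<And>F. F \<in> \<F> \<Longrightarrow> simple_graph F"
    and "pseudometric_on (Collect graphon) \<delta>"
    and "compatible_with_cut_dist \<delta>"
    and "\<And>U W. graphon U \<Longrightarrow> graphon W \<Longrightarrow>
           (\<forall>F\<in>\<F>. hom_density F U = hom_density F W) \<Longrightarrow> \<delta> U W = 0"
  shows "\<forall>\<epsilon>>0. \<exists>k::nat. \<exists>\<eta>::real. k > 0 \<and> \<eta> > 0 \<and>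
           (\<forall>U W. graphon U \<longrightarrow> graphon W \<longrightarrow>
              (\<forall>F\<in>\<F>. card (fst F) \<le> k \<longrightarrow> \<bar>hom_density F U - hom_density F W\<bar> \<le> \<eta>) \<longrightarrow>
              \<delta> U W \<le> \<epsilon>)"
proof (intro allI impI, rule ccontr)
  fix \<epsilon> :: real
  assume \<epsilon>: "0 < \<epsilon>"
  let ?close = "\<lambda>k \<eta> U W. \<forall>F\<in>\<F>. card (fst F) \<le> k \<longrightarrow> \<bar>hom_density F U - hom_density F W\<bar> \<le> \<eta>"
  assume neg: "\<nexists>k :: nat. \<exists>\<eta> :: real. k > 0 \<and> \<eta> > 0 \<and>
      (\<forall>U W. graphon U \<longrightarrow> graphon W \<longrightarrow> ?close k \<eta> U W \<longrightarrow> \<delta> U W \<le> \<epsilon>)"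
  \<comment> \<open>Counterexamples for k = n + 1 and \<eta> = 1/(n + 1): a single index drives both
    parameters.\<close>
  define P where "P n U W \<longleftrightarrow> graphon U \<and> graphon W \<and> ?close (Suc n) (1 / real (Suc n)) U W \<and> \<epsilon> < \<delta> U W"
    for n U W
  have "\<exists>U W. P n U W" for n
  proof (rule ccontr)
    assume "\<nexists>U W. P n U W"
    then have "\<forall>U W. graphon U \<longrightarrow> graphon W \<longrightarrow> ?close (Suc n) (1 / real (Suc n)) U W \<longrightarrow> \<delta> U W \<le> \<epsilon>"
      unfolding P_def by (meson not_le)
    moreover have "0 < Suc n" "0 < 1 / real (Suc n)" by simp_all
    ultimately show False using neg by blast
  qed
  then obtain U W where P: "\<And>n. P n (U n) (W n)" by metis
  have U: "graphon (U n)" and W: "graphon (W n)"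
    and close: "?close (Suc n) (1 / real (Suc n)) (U n) (W n)" and far: "\<epsilon> < \<delta> (U n) (W n)" for n
    using P[of n] unfolding P_def by blast+
  obtain r U\<^sub>0 where r: "strict_mono r" and U\<^sub>0: "borel_graphon U\<^sub>0"
    and dU: "(\<lambda>n. cut_dist (U (r n)) U\<^sub>0) \<longlonglongrightarrow> 0"
    and hU: "\<forall>F :: 'a graph. simple_graph F \<longrightarrow> (\<lambda>n. hom_density F (U (r n))) \<longlonglongrightarrow> hom_density F U\<^sub>0"
    by (rule graphon_compactness[of U, OF U])
  \<comment> \<open>The second extraction is made inside the first subsequence, so that both
    sequences converge along r composed with s.\<close>
  obtain s W\<^sub>0 where s: "strict_mono s" and W\<^sub>0: "borel_graphon W\<^sub>0"
    and dW: "(\<lambda>n. cut_dist (W (r (s n))) W\<^sub>0) \<longlonglongrightarrow> 0"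
    and hW: "\<forall>F :: 'a graph. simple_graph F \<longrightarrow> (\<lambda>n. hom_density F (W (r (s n)))) \<longlonglongrightarrow> hom_density F W\<^sub>0"
    by (rule graphon_compactness[of "\<lambda>n. W (r n)", OF W])
  note gU = borel_graphon_graphon[OF U\<^sub>0] and gW = borel_graphon_graphon[OF W\<^sub>0]
  define q where "q n = r (s n)" for n
  have q: "strict_mono q" unfolding q_def using strict_mono_compose[OF r s] by (simp add: comp_def)
  have dU': "(\<lambda>n. cut_dist (U (q n)) U\<^sub>0) \<longlonglongrightarrow> 0"
    using LIMSEQ_subseq_LIMSEQ[OF dU s] by (simp add: comp_def q_def)
  have "hom_density F U\<^sub>0 = hom_density F W\<^sub>0" if F: "F \<in> \<F>" for F
  proof -
    have hU': "(\<lambda>n. hom_density F (U (q n))) \<longlonglongrightarrow> hom_density F U\<^sub>0"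
      using LIMSEQ_subseq_LIMSEQ[OF hU[rule_format, OF assms(1)[OF F]] s] by (simp add: comp_def q_def)
    have "(\<lambda>n. hom_density F (U (q n)) - hom_density F (W (q n))) \<longlonglongrightarrow> hom_density F U\<^sub>0 - hom_density F W\<^sub>0"
      by (rule tendsto_diff[OF hU']) (use hW[rule_format, OF assms(1)[OF F]] in \<open>simp only: q_def\<close>)
    moreover have "(\<lambda>n. hom_density F (U (q n)) - hom_density F (W (q n))) \<longlonglongrightarrow> 0"
    proof (rule Lim_null_comparison)
      show "(\<lambda>n. 1 / real (Suc n)) \<longlonglongrightarrow> 0" by (rule LIMSEQ_Suc[OF lim_1_over_n])
      show "\<forall>\<^sub>F n in sequentially. norm (hom_density F (U (q n)) - hom_density F (W (q n))) \<le> 1 / real (Suc n)"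
      \<comment> \<open>A fixed F has finitely many vertices, so it is subject to the closeness
        condition from some index on. Hence no uniformity over the class of graphs is
        required.\<close>
      proof (rule eventually_sequentiallyI[of "card (fst F)"])
        fix n assume n: "card (fst F) \<le> n"
        have qn: "n \<le> q n" by (rule strict_mono_imp_increasing[OF q])
        then have "\<bar>hom_density F (U (q n)) - hom_density F (W (q n))\<bar> \<le> 1 / real (Suc (q n))"
          using close[of "q n"] F n by simp
        also have "\<dots> \<le> 1 / real (Suc n)" using qn by (intro divide_left_mono) auto
        finally show "norm (hom_density F (U (q n)) - hom_density F (W (q n))) \<le> 1 / real (Suc n)" by simp
      qed
    qed
    ultimately show ?thesis using LIMSEQ_unique by fastforce
  qed
  then have zero: "\<delta> U\<^sub>0 W\<^sub>0 = 0" using assms(4)[OF gU gW] by blast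
  have compat: "(\<lambda>n. \<delta> (X n) Y) \<longlonglongrightarrow> 0"
    if "\<And>n. graphon (X n)" "graphon Y" "(\<lambda>n. cut_dist (X n) Y) \<longlonglongrightarrow> 0" for X Y
    using assms(3) that unfolding compatible_with_cut_dist_def by blast
  have "(\<lambda>n. \<delta> (U (q n)) U\<^sub>0 + \<delta> (W (q n)) W\<^sub>0) \<longlonglongrightarrow> 0 + 0"
    by (intro tendsto_add compat U W gU gW dU') (use dW in \<open>simp only: q_def\<close>)
  then have "\<forall>\<^sub>F n in sequentially. \<delta> (U (q n)) U\<^sub>0 + \<delta> (W (q n)) W\<^sub>0 < \<epsilon>"
    using \<epsilon> by (intro order_tendstoD(2)) auto
  then obtain n where n: "\<delta> (U (q n)) U\<^sub>0 + \<delta> (W (q n)) W\<^sub>0 < \<epsilon>"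
    by (auto simp: eventually_sequentially)
  have tri: "\<delta> X Z \<le> \<delta> X Y + \<delta> Y Z" and sym: "\<delta> X Y = \<delta> Y X"
    if "graphon X" "graphon Y" "graphon Z" for X Y Z
    using assms(2) that unfolding pseudometric_on_def by auto
  have "\<delta> (U (q n)) (W (q n)) \<le> \<delta> (U (q n)) U\<^sub>0 + (\<delta> U\<^sub>0 W\<^sub>0 + \<delta> W\<^sub>0 (W (q n)))"
    using tri[OF U gU W, of "q n" "q n"] tri[OF gU gW W, of "q n"] by linarith
  also have "\<dots> < \<epsilon>" using n zero sym[OF gW W gW, of "q n"] by simp
  finally show False using far[of "q n"] by simp
qed

end
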